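(* The following three statements are equivalent: (i) every bounded Bessel sequence in a Hilbert space can be partitioned into finitely many Riesz basic sequences; (ii) every bounded Bessel sequence of the form $\{P\widetilde{k}_{z_i}\}_{i\in\mathbb{N}}$, where $P\in B(H^2)$ is a positive operator and $\{z_i\}_{i\in\mathbb{N}}\subseteq\mathbb{D}$ is a sequence, can be partitioned into finitely many Riesz basic sequences; (iii) every bounded Bessel sequence of the form $\{\widetilde{k}^{\mathcal{H}}_{z_i}\}_{i\in\mathbb{N}}$, where $\mathcal{H}$ is a Hilbert space contractively contained in $H^2$ and $\{z_i\}_{i\in\mathbb{N}}\subseteq\mathbb{D}$ is a sequence, can be partitioned into finitely many Riesz basic sequences.
   Context: A countable indexed family $\{f_i\}_{i\in J}$ in a Hilbert space $\mathcal{H}$ is a Bessel sequence if there is $B>0$ with $\sum_{i\in J}|\langle x,f_i\rangle|^2\le B\|x\|^2$ for all $x\in\mathcal{H}$. A Bessel sequence is bounded if there is $\delta>0$ with $\|f_i\|\ge\delta$ for all $i\in J$. The family $\{f_i\}_{i\in J}$ is a Riesz basis for a Hilbert space $\mathcal{K}$ if there are an orthonormal basis $\{u_i\}_{i\in J}$ of $\mathcal{K}$ and an invertible $S\in B(\mathcal{K})$ with $Su_i=f_i$ for all $i$; it is a Riesz basic sequence if it is a Riesz basis for the closure of its linear span. A family $\{f_i\}_{i\in J}$ can be partitioned into finitely many Riesz basic sequences if there is a finite partition $J=A_1\cup\dots\cup A_n$ such that each $\{f_i\}_{i\in A_m}$ is a Riesz basic sequence. $\mathbb{D}$ is the open unit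 disk in $\mathbb{C}$, and $H^2$ is the Hardy space on $\mathbb{D}$, with reproducing kernel $K(z,w)=\frac{1}{1-z\bar w}$. For $w\in\mathbb{D}$, $k_w(z)=K(z,w)$ is the kernel function and $\widetilde{k}_w=k_w/\|k_w\|$ is the normalized kernel function in $H^2$. A positive operator means a bounded operator $P$ with $\langle Px,x\rangle\ge0$ for all $x$. A Hilbert space $\mathcal{H}$ is contractively contained in $H^2$ if it is a vector subspace of $H^2$ and $\|h\|_{H^2}\le\|h\|_{\mathcal{H}}$ for all $h\in\mathcal{H}$. Such an $\mathcal{H}$ is a reproducing kernel Hilbert space on $\mathbb{D}$; $k^{\mathcal{H}}_w\in\mathcal{H}$ denotes its kernel function at $w$ (so $f(w)=\langle f,k^{\mathcal{H}}_w\rangle_{\mathcal{H}}$ for $f\in\mathcal{H}$) and, whenever $k^{\mathcal{H}}_w\neq0$, $\widetilde{k}^{\mathcal{H}}_w=k^{\mathcal{H}}_w/\|k^{\mathcal{H}}_w\|_{\mathcal{H}}$ is the normalized kernel function. *)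

theory Defs
  imports
    "HOL-Complex_Analysis.Complex_Analysis"
    "HOL-Algebra.Module"
    "HOL-Library.Disjoint_Sets"
    "HOL-Library.Equipollence"
begin

section \<open>Complex Hilbert spaces on a carrier set\<close>

definition complex_ring :: "complex ring" where
  "complex_ring = \<lparr>carrier = UNIV, mult = (*), one = 1, zero = 0, add = (+)\<rparr>"

text \<open>As for modules in HOL-Algebra, the ring multiplication and unit of the vector space that
  the record inherits are unused.\<close>

record 'a inner_space = "(complex, 'a) module" +
  cinner :: "'a \<Rightarrow> 'a \<Rightarrow> complex"

definition hnorm :: "'a inner_space \<Rightarrow> 'a \<Rightarrow> real" where
  "hnorm H x = sqrt (Re (cinner H x x))"

text \<open>The locale \<open>Metric_space\<close> asks for symmetry and nonnegativity off the carrier as well, hence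
  the case distinction.\<close>

definition hdist :: "'a inner_space \<Rightarrow> 'a \<Rightarrow> 'a \<Rightarrow> real" where
  "hdist H x y = (if x \<in> carrier H \<and> y \<in> carrier H then hnorm H (x \<ominus>\<^bsub>H\<^esub> y) else 0)"

locale hilbert_space = Module.module complex_ring H for H :: "'a inner_space" (structure) +
  assumes cinner_add_left:
      "\<lbrakk>x \<in> carrier H; y \<in> carrier H; z \<in> carrier H\<rbrakk> \<Longrightarrow>
        cinner H (x \<oplus> y) z = cinner H x z + cinner H y z"
    and cinner_smult_left:
      "\<lbrakk>x \<in> carrier H; y \<in> carrier H\<rbrakk> \<Longrightarrow> cinner H (c \<odot> x) y = c * cinner H x y"
    and cinner_commute:
      "\<lbrakk>x \<in> carrier H; y \<in> carrier H\<rbrakk> \<Longrightarrow> cinner H y x = cnj (cinner H x y)"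
    and cinner_self_nonneg: "x \<in> carrier H \<Longrightarrow> cinner H x x \<in> \<real>\<^sub>\<ge>\<^sub>0"
    and cinner_self_eq_0: "\<lbrakk>x \<in> carrier H; cinner H x x = 0\<rbrakk> \<Longrightarrow> x = \<zero>"
    and complete: "Metric_space.mcomplete (carrier H) (hdist H)"

definition hspan :: "'a inner_space \<Rightarrow> 'a set \<Rightarrow> 'a set" where
  "hspan H S = {finsum H (\<lambda>x. c x \<odot>\<^bsub>H\<^esub> x) F | c F. finite F \<and> F \<subseteq> S}"

definition closed_hspan :: "'a inner_space \<Rightarrow> 'a set \<Rightarrow> 'a set" where
  "closed_hspan H S = Metric_space.mtopology (carrier H) (hdist H) closure_of (hspan H S)"

definition bounded_operator :: "'a inner_space \<Rightarrow> ('a \<Rightarrow> 'a) \<Rightarrow> bool" where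
  "bounded_operator H T \<longleftrightarrow>
    T \<in> carrier H \<rightarrow> carrier H \<and>
    (\<forall>x\<in>carrier H. \<forall>y\<in>carrier H. T (x \<oplus>\<^bsub>H\<^esub> y) = T x \<oplus>\<^bsub>H\<^esub> T y) \<and>
    (\<forall>c. \<forall>x\<in>carrier H. T (c \<odot>\<^bsub>H\<^esub> x) = c \<odot>\<^bsub>H\<^esub> T x) \<and>
    (\<exists>C. \<forall>x\<in>carrier H. hnorm H (T x) \<le> C * hnorm H x)"

definition invertible_operator :: "'a inner_space \<Rightarrow> ('a \<Rightarrow> 'a) \<Rightarrow> bool" where
  "invertible_operator H S \<longleftrightarrow>
    bounded_operator H S \<and>
    (\<exists>T. bounded_operator H T \<and> (\<forall>x\<in>carrier H. T (S x) = x \<and> S (T x) = x))"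

definition positive_operator :: "'a inner_space \<Rightarrow> ('a \<Rightarrow> 'a) \<Rightarrow> bool" where
  "positive_operator H P \<longleftrightarrow>
    bounded_operator H P \<and> (\<forall>x\<in>carrier H. cinner H (P x) x \<in> \<real>\<^sub>\<ge>\<^sub>0)"


section \<open>Bessel sequences and Riesz basic sequences\<close>

definition bessel_sequence :: "'a inner_space \<Rightarrow> 'i set \<Rightarrow> ('i \<Rightarrow> 'a) \<Rightarrow> bool" where
  "bessel_sequence H J f \<longleftrightarrow>
    countable J \<and> f \<in> J \<rightarrow> carrier H \<and>
    (\<exists>B>0. \<forall>x\<in>carrier H.
      (\<lambda>i. (cmod (cinner H x (f i)))\<^sup>2) summable_on J \<and>
      (\<Sum>\<^sub>\<infinity>i\<in>J. (cmod (cinner H x (f i)))\<^sup>2) \<le> B * (hnorm H x)\<^sup>2)"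

text \<open>Bounded means bounded below in norm; a Bessel sequence is always bounded above.\<close>

definition bounded_bessel_sequence :: "'a inner_space \<Rightarrow> 'i set \<Rightarrow> ('i \<Rightarrow> 'a) \<Rightarrow> bool" where
  "bounded_bessel_sequence H J f \<longleftrightarrow>
    bessel_sequence H J f \<and> (\<exists>\<delta>>0. \<forall>i\<in>J. \<delta> \<le> hnorm H (f i))"

definition orthonormal_basis :: "'a inner_space \<Rightarrow> 'i set \<Rightarrow> ('i \<Rightarrow> 'a) \<Rightarrow> bool" where
  "orthonormal_basis K J u \<longleftrightarrow>
    u \<in> J \<rightarrow> carrier K \<and>
    (\<forall>i\<in>J. \<forall>j\<in>J. cinner K (u i) (u j) = (if i = j then 1 else 0)) \<and>
    closed_hspan K (u ` J) = carrier K"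

definition riesz_basis :: "'a inner_space \<Rightarrow> 'i set \<Rightarrow> ('i \<Rightarrow> 'a) \<Rightarrow> bool" where
  "riesz_basis K J f \<longleftrightarrow>
    (\<exists>u S. orthonormal_basis K J u \<and> invertible_operator K S \<and> (\<forall>i\<in>J. S (u i) = f i))"

definition riesz_basic_sequence :: "'a inner_space \<Rightarrow> 'i set \<Rightarrow> ('i \<Rightarrow> 'a) \<Rightarrow> bool" where
  "riesz_basic_sequence H J f \<longleftrightarrow> riesz_basis (H\<lparr>carrier := closed_hspan H (f ` J)\<rparr>) J f"

definition riesz_partitionable :: "'a inner_space \<Rightarrow> 'i set \<Rightarrow> ('i \<Rightarrow> 'a) \<Rightarrow> bool" where
  "riesz_partitionable H J f \<longleftrightarrow>
    (\<exists>\<A>. finite \<A> \<and> partition_on J \<A> \<and> (\<forall>A\<in>\<A>. riesz_basic_sequence H A f))"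


section \<open>The Hardy space and the Hilbert spaces contractively contained in it\<close>

abbreviation unit_disk :: "complex set" (\<open>\<bbbD>\<close>) where
  "\<bbbD> \<equiv> ball 0 1"

text \<open>Functions on the disk are total functions that vanish outside it, so that equality of
  such functions is equality on the disk. The Hardy space consists of the holomorphic functions
  whose Taylor coefficients at 0 are square summable.\<close>

definition taylor_coeff :: "(complex \<Rightarrow> complex) \<Rightarrow> nat \<Rightarrow> complex" where
  "taylor_coeff f n = fps_nth (fps_expansion f 0) n"

definition hardy_space :: "(complex \<Rightarrow> complex) inner_space" (\<open>H\<^sup>2\<close>) where
  "H\<^sup>2 = \<lparr>
    carrier = {f. f holomorphic_on \<bbbD> \<and> (\<forall>z. z \<notin> \<bbbD> \<longrightarrow> f z = 0) \<and>
      summable (\<lambda>n. (cmod (taylor_coeff f n))\<^sup>2)},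
    mult = undefined, one = undefined,
    zero = (\<lambda>z. 0), add = (\<lambda>f g z. f z + g z), smult = (\<lambda>c f z. c * f z),
    cinner = (\<lambda>f g. \<Sum>n. taylor_coeff f n * cnj (taylor_coeff g n))\<rparr>"

definition szego_kernel :: "complex \<Rightarrow> complex \<Rightarrow> complex" where
  "szego_kernel w = (\<lambda>z. if z \<in> \<bbbD> then 1 / (1 - z * cnj w) else 0)"

definition normalized :: "'a inner_space \<Rightarrow> 'a \<Rightarrow> 'a" where
  "normalized H x = complex_of_real (1 / hnorm H x) \<odot>\<^bsub>H\<^esub> x"

definition contractively_contained :: "(complex \<Rightarrow> complex) inner_space \<Rightarrow> bool" where
  "contractively_contained H \<longleftrightarrow>
    hilbert_space H \<and>
    carrier H \<subseteq> carrier H\<^sup>2 \<and>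
    (\<forall>f\<in>carrier H. \<forall>g\<in>carrier H. f \<oplus>\<^bsub>H\<^esub> g = f \<oplus>\<^bsub>H\<^sup>2\<^esub> g) \<and>
    (\<forall>c. \<forall>f\<in>carrier H. c \<odot>\<^bsub>H\<^esub> f = c \<odot>\<^bsub>H\<^sup>2\<^esub> f) \<and>
    (\<forall>f\<in>carrier H. hnorm H\<^sup>2 f \<le> hnorm H f)"

definition kernel_at :: "(complex \<Rightarrow> complex) inner_space \<Rightarrow> complex \<Rightarrow> complex \<Rightarrow> complex" where
  "kernel_at H w = (THE k. k \<in> carrier H \<and> (\<forall>f\<in>carrier H. f w = cinner H f k))"

end

theory Submission
  imports Defs
begin

text \<open>Whether a family is a bounded Bessel sequence, and whether it splits into finitely many Riesz
  basic sequences, depends only on its Gram matrix. So (i) implies (ii) and (iii) once the Gram matrix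
  is realized in a copy of \<open>\<ell>\<^sup>2\<close> inside the type \<open>'a\<close>.

  Conversely, let \<open>a\<^sub>i\<close> be a bounded Bessel sequence in \<open>\<ell>\<^sup>2\<close>. For points \<open>z\<^sub>i\<close> that converge
  rapidly to the boundary the normalized kernels are a Riesz basic sequence in \<open>H\<^sup>2\<close>, hence there is an
  operator \<open>W\<close> from \<open>\<ell>\<^sup>2\<close> to \<open>H\<^sup>2\<close>, bounded below, whose adjoint maps the normalized kernel at \<open>z\<^sub>i\<close> to
  \<open>a\<^sub>i\<close>. With \<open>P = W W\<^sup>*\<close> the family in (ii) is \<open>W a\<^sub>i\<close>, and its lower Riesz bounds carry over to \<open>a\<^sub>i\<close>.
  For (iii), the range of \<open>W\<close> with a multiple of the norm transported from \<open>\<ell>\<^sup>2\<close> is contractively contained in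
  \<open>H\<^sup>2\<close>, and its normalized kernel at \<open>z\<^sub>i\<close> corresponds to a positive multiple of \<open>a\<^sub>i\<close>. No square roots
  of operators are needed because the Riesz property only depends on the Gram matrix up to
  equivalence.\<close>

section \<open>The sequence space\<close>

text \<open>For a Bessel family the upper Riesz bound passes to every subfamily, so partitioning is
  only a question of lower bounds for quadratic forms, and boundedness of \<open>W\<close> already
  pulls such bounds back from \<open>W (a i)\<close> to \<open>a i\<close>. That \<open>W\<close> is
  bounded below serves another purpose: it keeps the vectors \<open>W (a i)\<close> away from 0 in
  (ii), and it makes \<open>W\<close> injective in (iii), so that its range can carry the norm of
  the sequence space. Prescribing the adjoint on the kernels for \<open>a i\<close> alone would
  allow a nonzero null space of \<open>W\<close>, hence half of the points are reserved for
  coordinates. Since (i) permits any set \<open>J\<close> of naturals while (ii) and (iii) ask for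
  full sequences, missing indices are filled with unit vectors, which a restriction to
  \<open>J\<close> removes at the end. The sequence space is a type, not a carrier set, so that
  Cauchy sequences and Banach's fixed point theorem are those of the type classes.\<close>

typedef ell2 = "{a :: nat \<Rightarrow> complex. summable (\<lambda>n. (cmod (a n))\<^sup>2)}"
  morphisms coord Abs_ell2
  by (rule exI[of _ "\<lambda>_. 0"]) simp

setup_lifting type_definition_ell2

lemma summable_coord: "summable (\<lambda>n. (cmod (coord x n))\<^sup>2)"
  using coord[of x] by simp

lemma ell2_eqI: "(\<And>n. coord x n = coord y n) \<Longrightarrow> x = y"
  by (simp add: coord_inject[symmetric] ext)

lemma cmod_add_square_le: "(cmod (a + b))\<^sup>2 \<le> 2 * (cmod a)\<^sup>2 + 2 * (cmod b)\<^sup>2"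
proof -
  have "(cmod (a + b))\<^sup>2 \<le> (cmod a + cmod b)\<^sup>2"
    by (intro power_mono norm_triangle_ineq) auto
  also have "\<dots> \<le> 2 * (cmod a)\<^sup>2 + 2 * (cmod b)\<^sup>2"
    using sum_squares_bound[of "cmod a" "cmod b"] by (simp add: power2_sum)
  finally show ?thesis .
qed

lemma square_summable_add:
  assumes "summable (\<lambda>n. (cmod (a n))\<^sup>2)" "summable (\<lambda>n. (cmod (b n))\<^sup>2)"
  shows "summable (\<lambda>n. (cmod (a n + b n))\<^sup>2)"
  by (rule summable_comparison_test'[OF summable_add[OF summable_mult[OF assms(1), of 2] summable_mult[OF assms(2), of 2]]])
    (simp add: cmod_add_square_le)

lemma square_summable_mult:
  assumes "summable (\<lambda>n. (cmod (a n))\<^sup>2)"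
  shows "summable (\<lambda>n. (cmod (c * a n))\<^sup>2)"
  using summable_mult[OF assms, of "(cmod c)\<^sup>2"] by (simp add: norm_mult power_mult_distrib)

lemma summable_mult_cnj:
  assumes "summable (\<lambda>n. (cmod (a n))\<^sup>2)" "summable (\<lambda>n. (cmod (b n))\<^sup>2)"
  shows "summable (\<lambda>n. a n * cnj (b n))"
proof (rule summable_comparison_test'[OF summable_add[OF assms]])
  show "norm (a n * cnj (b n)) \<le> (cmod (a n))\<^sup>2 + (cmod (b n))\<^sup>2" for n
  proof -
    have "0 \<le> cmod (a n) * cmod (b n)" by simp
    with sum_squares_bound[of "cmod (a n)" "cmod (b n)"] show ?thesis
      unfolding norm_mult complex_mod_cnj mult.assoc by linarith
  qed
qed

definition cip :: "ell2 \<Rightarrow> ell2 \<Rightarrow> complex" where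
  "cip x y = (\<Sum>n. coord x n * cnj (coord y n))"

lift_definition csc :: "complex \<Rightarrow> ell2 \<Rightarrow> ell2" is "\<lambda>c a n. c * a n"
  by (rule square_summable_mult)

lemma summable_cip: "summable (\<lambda>n. coord x n * cnj (coord y n))"
  by (intro summable_mult_cnj summable_coord)

lemma cip_self: "cip x x = complex_of_real (\<Sum>n. (cmod (coord x n))\<^sup>2)"
proof -
  have "cip x x = (\<Sum>n. complex_of_real ((cmod (coord x n))\<^sup>2))"
    unfolding cip_def by (metis complex_norm_square)
  then show ?thesis using suminf_of_real[OF summable_coord] by metis
qed

lemma cip_commute: "cip y x = cnj (cip x y)"
proof -
  have "(\<lambda>n. cnj (coord x n * cnj (coord y n))) sums cnj (cip x y)"
    unfolding cip_def sums_cnj by (rule summable_sums[OF summable_cip])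
  then show ?thesis unfolding cip_def
    by (auto simp: mult.commute dest: sums_unique[symmetric])
qed

text \<open>\<open>real_inner\<close> is a class of real spaces: the real part of \<open>cip\<close>
  serves as its inner product, with the same norm, while complex scalars stay in
  \<open>csc\<close>.\<close>

instantiation ell2 :: real_inner
begin

lift_definition zero_ell2 :: ell2 is "\<lambda>_. 0" by simp
lift_definition plus_ell2 :: "ell2 \<Rightarrow> ell2 \<Rightarrow> ell2" is "\<lambda>a b n. a n + b n"
  by (rule square_summable_add)
lift_definition uminus_ell2 :: "ell2 \<Rightarrow> ell2" is "\<lambda>a n. - a n" by simp
lift_definition minus_ell2 :: "ell2 \<Rightarrow> ell2 \<Rightarrow> ell2" is "\<lambda>a b n. a n - b n"
  using square_summable_add[of _ "\<lambda>n. - _ n"] by simp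
definition scaleR_ell2 :: "real \<Rightarrow> ell2 \<Rightarrow> ell2" where
  "scaleR_ell2 r x = csc (complex_of_real r) x"
definition inner_ell2 :: "ell2 \<Rightarrow> ell2 \<Rightarrow> real" where
  "inner_ell2 x y = Re (cip x y)"
definition norm_ell2 :: "ell2 \<Rightarrow> real" where
  "norm_ell2 x = sqrt (inner x x)"
definition sgn_ell2 :: "ell2 \<Rightarrow> ell2" where
  "sgn_ell2 x = inverse (norm x) *\<^sub>R x"
definition dist_ell2 :: "ell2 \<Rightarrow> ell2 \<Rightarrow> real" where
  "dist_ell2 x y = norm (x - y)"
definition uniformity_ell2 :: "(ell2 \<times> ell2) filter" where
  "uniformity_ell2 = (INF e\<in>{0 <..}. principal {(x, y). dist x y < e})"
definition open_ell2 :: "ell2 set \<Rightarrow> bool" where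
  "open_ell2 U = (\<forall>x\<in>U. eventually (\<lambda>(x', y). x' = x \<longrightarrow> y \<in> U) uniformity)"

lemma coord_csc [simp]: "coord (csc c x) n = c * coord x n"
  by (simp add: csc.rep_eq)

lemma coord_plus [simp]: "coord (x + y) n = coord x n + coord y n"
  by (simp add: plus_ell2.rep_eq)

lemma coord_zero [simp]: "coord 0 n = 0"
  by (simp add: zero_ell2.rep_eq)

lemma cip_add_left: "cip (x + y) z = cip x z + cip y z"
  using suminf_add[OF summable_cip[of x z] summable_cip[of y z]]
  by (simp add: cip_def ring_distribs)

lemma cip_csc_left: "cip (csc c x) y = c * cip x y"
  using suminf_mult[OF summable_cip[of x y], of c] by (simp add: cip_def mult.assoc)

instance
proof
  fix x y z :: ell2 and r s :: real
  show "inner x y = inner y x"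
    unfolding inner_ell2_def using cip_commute[of x y] by simp
  show "inner (x + y) z = inner x z + inner y z"
    by (simp add: inner_ell2_def cip_add_left)
  show "inner (r *\<^sub>R x) y = r * inner x y"
    by (simp add: inner_ell2_def scaleR_ell2_def cip_csc_left)
  show "0 \<le> inner x x"
    by (simp add: inner_ell2_def cip_self suminf_nonneg[OF summable_coord])
  show "(inner x x = 0) = (x = 0)"
  proof -
    have "inner x x = 0 \<longleftrightarrow> (\<forall>n. (cmod (coord x n))\<^sup>2 = 0)"
      unfolding inner_ell2_def cip_self Re_complex_of_real
      by (rule suminf_eq_zero_iff[OF summable_coord]) simp
    then show ?thesis by (auto intro: ell2_eqI)
  qed
qed (simp_all add: norm_ell2_def sgn_ell2_def dist_ell2_def uniformity_ell2_def open_ell2_def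
    scaleR_ell2_def ell2_eqI uminus_ell2.rep_eq minus_ell2.rep_eq algebra_simps)

end

lemma coord_uminus [simp]: "coord (- x) n = - coord x n"
  by (simp add: uminus_ell2.rep_eq)

lemma coord_minus [simp]: "coord (x - y) n = coord x n - coord y n"
  by (simp add: minus_ell2.rep_eq)

lemma coord_scaleR [simp]: "coord (r *\<^sub>R x) n = of_real r * coord x n"
  by (simp add: scaleR_ell2_def)

lemma coord_sum [simp]: "coord (sum f F) n = (\<Sum>i\<in>F. coord (f i) n)"
  by (induction F rule: infinite_finite_induct) auto

lemma cip_add_right: "cip x (y + z) = cip x y + cip x z"
  by (metis cip_add_left cip_commute complex_cnj_add)

lemma cip_csc_right: "cip x (csc c y) = cnj c * cip x y"
  by (metis cip_csc_left cip_commute complex_cnj_mult)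

lemma cip_zero [simp]: "cip 0 y = 0" "cip x 0 = 0"
  by (simp_all add: cip_def)

lemma cip_sum_left: "cip (sum f F) y = (\<Sum>i\<in>F. cip (f i) y)"
  by (induction F rule: infinite_finite_induct) (auto simp: cip_add_left)

lemma cip_sum_right: "cip x (sum f F) = (\<Sum>i\<in>F. cip x (f i))"
  by (induction F rule: infinite_finite_induct) (auto simp: cip_add_right)

lemma csc_simps [simp]:
  "csc c (x + y) = csc c x + csc c y" "csc c (x - y) = csc c x - csc c y"
  "csc c (csc d x) = csc (c * d) x" "csc 1 x = x" "csc 0 x = 0" "csc c 0 = 0" "csc c (- x) = - csc c x"
  by (auto intro!: ell2_eqI simp: algebra_simps)

lemma csc_add: "csc (c + d) x = csc c x + csc d x"
  by (auto intro!: ell2_eqI simp: algebra_simps)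

lemma csc_of_real: "csc (complex_of_real r) x = r *\<^sub>R x"
  by (simp add: scaleR_ell2_def)

lemma cip_norm: "cip x x = complex_of_real ((norm x)\<^sup>2)"
  by (simp add: cip_self norm_ell2_def inner_ell2_def suminf_nonneg[OF summable_coord])

lemma norm_ell2_square: "(norm x)\<^sup>2 = (\<Sum>n. (cmod (coord x n))\<^sup>2)" for x :: ell2
  using cip_norm[of x] cip_self[of x] by (metis of_real_eq_iff)

lemma norm_csc [simp]: "norm (csc c x) = cmod c * norm x"
proof -
  have "complex_of_real ((norm (csc c x))\<^sup>2) = complex_of_real ((cmod c * norm x)\<^sup>2)"
    unfolding cip_norm[symmetric] cip_csc_left cip_csc_right
    by (simp add: cip_norm power_mult_distrib) (metis complex_norm_square mult.commute of_real_power)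
  then have "(norm (csc c x))\<^sup>2 = (cmod c * norm x)\<^sup>2" by (metis of_real_eq_iff)
  then show ?thesis by simp
qed

text \<open>Multiplying \<open>x\<close> by a unimodular \<open>c\<close> makes the complex product
  real and nonnegative; then the real Cauchy--Schwarz inequality applies.\<close>

lemma cmod_cip_le: "cmod (cip x y) \<le> norm x * norm y"
proof (cases "cip x y = 0")
  case False
  define c where "c = cnj (cip x y) / cmod (cip x y)"
  have c: "cmod c = 1" using False by (simp add: c_def norm_divide)
  have "complex_of_real (cmod (cip x y)) = cip (csc c x) y"
    using False complex_norm_square[of "cip x y"]
    by (simp add: cip_csc_left c_def field_simps power2_eq_square)
  then have "cmod (cip x y) = inner (csc c x) y"
    by (metis inner_ell2_def Re_complex_of_real)
  also have "\<dots> \<le> norm (csc c x) * norm y" by (rule norm_cauchy_schwarz)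
  finally show ?thesis using c by simp
qed simp

lemma cmod_coord_le: "cmod (coord x n) \<le> norm x"
proof -
  have "(cmod (coord x n))\<^sup>2 \<le> (\<Sum>n. (cmod (coord x n))\<^sup>2)"
    using sum_le_suminf[OF summable_coord, of "{n}"] by simp
  then show ?thesis
    by (metis norm_ell2_square norm_ge_zero power2_le_imp_le)
qed

text \<open>The first conclusion amounts to square summability of \<open>a\<close>. Limits, adjoints
  and analysis operators are all given by explicit coordinates, and this places them in the sequence
  space.\<close>

lemma ell2_boundedI:
  assumes "\<And>N. (\<Sum>n<N. (cmod (a n))\<^sup>2) \<le> B\<^sup>2" "B \<ge> 0"
  shows "coord (Abs_ell2 a) = a" "norm (Abs_ell2 a) \<le> B"
proof -
  have s: "summable (\<lambda>n. (cmod (a n))\<^sup>2)"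
    by (rule bounded_imp_summable[of _ "B\<^sup>2"]) (use assms(1)[of "Suc _"] in \<open>auto simp: lessThan_Suc_atMost\<close>)
  then show a: "coord (Abs_ell2 a) = a" by (simp add: Abs_ell2_inverse)
  have "(norm (Abs_ell2 a))\<^sup>2 \<le> B\<^sup>2"
    unfolding norm_ell2_square a by (rule suminf_le_const[OF s assms(1)])
  then show "norm (Abs_ell2 a) \<le> B" using assms(2) by simp
qed

lemma sum_coord_le: "(\<Sum>n<N. (cmod (coord x n))\<^sup>2) \<le> (norm x)\<^sup>2"
  unfolding norm_ell2_square by (rule sum_le_suminf[OF summable_coord]) auto

instance ell2 :: banach
proof
  fix X :: "nat \<Rightarrow> ell2"
  assume X: "Cauchy X"
  have "Cauchy (\<lambda>m. coord (X m) n)" for n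
  proof (rule metric_CauchyI)
    fix e :: real assume "e > 0"
    then obtain M where M: "\<And>m p. m \<ge> M \<Longrightarrow> p \<ge> M \<Longrightarrow> dist (X m) (X p) < e"
      using metric_CauchyD[OF X] by blast
    have "dist (coord (X m) n) (coord (X p) n) < e" if "m \<ge> M" "p \<ge> M" for m p
      using cmod_coord_le[of "X m - X p" n] M[OF that] by (simp add: dist_norm)
    then show "\<exists>M. \<forall>m\<ge>M. \<forall>p\<ge>M. dist (coord (X m) n) (coord (X p) n) < e" by blast
  qed
  then have "\<forall>n. \<exists>l. (\<lambda>m. coord (X m) n) \<longlonglongrightarrow> l"
    by (metis Cauchy_convergent_iff convergent_def)
  then obtain a where a: "\<And>n. (\<lambda>m. coord (X m) n) \<longlonglongrightarrow> a n" by metis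
  \<comment> \<open>For fixed \<open>N\<close> the Cauchy estimate survives the limit in
    \<open>p\<close>; the bound does not depend on \<open>N\<close>, so it controls the whole
    norm.\<close>
  have key: "\<exists>M. \<forall>m\<ge>M. \<forall>N. (\<Sum>n<N. (cmod (coord (X m) n - a n))\<^sup>2) \<le> e\<^sup>2" if "e > 0" for e :: real
  proof -
    obtain M where M: "\<And>m p. m \<ge> M \<Longrightarrow> p \<ge> M \<Longrightarrow> dist (X m) (X p) < e"
      using metric_CauchyD[OF X \<open>e > 0\<close>] by blast
    have "(\<Sum>n<N. (cmod (coord (X m) n - a n))\<^sup>2) \<le> e\<^sup>2" if "m \<ge> M" for m N
    proof (rule tendsto_upperbound)
      show "((\<lambda>p. \<Sum>n<N. (cmod (coord (X m) n - coord (X p) n))\<^sup>2) \<longlonglongrightarrow> (\<Sum>n<N. (cmod (coord (X m) n - a n))\<^sup>2))"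
        by (intro tendsto_intros a)
      show "\<forall>\<^sub>F p in sequentially. (\<Sum>n<N. (cmod (coord (X m) n - coord (X p) n))\<^sup>2) \<le> e\<^sup>2"
        unfolding eventually_sequentially
      proof (intro exI allI impI)
        fix p assume "p \<ge> M"
        then have "norm (X m - X p) \<le> e" using M[OF \<open>m \<ge> M\<close>] by (simp add: dist_norm less_imp_le)
        then have "(norm (X m - X p))\<^sup>2 \<le> e\<^sup>2" by (intro power_mono) auto
        then show "(\<Sum>n<N. (cmod (coord (X m) n - coord (X p) n))\<^sup>2) \<le> e\<^sup>2"
          using sum_coord_le[of "X m - X p" N] by simp
      qed
    qed simp
    then show ?thesis by blast
  qed
  obtain M where "\<And>N. (\<Sum>n<N. (cmod (coord (X M) n - a n))\<^sup>2) \<le> 1\<^sup>2"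
    using key[of 1] by auto
  note d = ell2_boundedI(1)[OF this]
  \<comment> \<open>Square summability is known so far for the difference
    \<open>coord (X M) n - a n\<close>; the limit with coordinates \<open>a\<close> is recovered by
    subtraction.\<close>
  define x where "x = X M - Abs_ell2 (\<lambda>n. coord (X M) n - a n)"
  have x: "coord x n = a n" for n by (simp add: x_def d)
  have "X \<longlonglongrightarrow> x"
  proof (rule LIMSEQ_I)
    fix e :: real assume "e > 0"
    then obtain M where M: "\<And>m N. m \<ge> M \<Longrightarrow> (\<Sum>n<N. (cmod (coord (X m) n - a n))\<^sup>2) \<le> (e/2)\<^sup>2"
      using key[of "e/2"] by auto
    have "norm (X m - x) < e" if "m \<ge> M" for m
    proof -
      have "norm (Abs_ell2 (\<lambda>n. coord (X m) n - a n)) \<le> e/2"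
        by (rule ell2_boundedI(2)) (use M[OF that] \<open>e > 0\<close> in auto)
      moreover have "Abs_ell2 (\<lambda>n. coord (X m) n - a n) = X m - x"
        by (rule ell2_eqI, subst ell2_boundedI(1)[OF M[OF that]]) (use \<open>e > 0\<close> x in auto)
      ultimately show ?thesis using \<open>e > 0\<close> by simp
    qed
    then show "\<exists>no. \<forall>n\<ge>no. norm (X n - x) < e" by blast
  qed
  then show "convergent X" by (auto simp: convergent_def)
qed


section \<open>Operators on the sequence space\<close>

definition ell2_unit :: "nat \<Rightarrow> ell2" where
  "ell2_unit n = Abs_ell2 (\<lambda>k. if k = n then 1 else 0)"

lemma coord_ell2_unit [simp]: "coord (ell2_unit n) k = (if k = n then 1 else 0)"
proof -
  have "(\<lambda>k. (cmod (if k = n then 1 else 0))\<^sup>2) = (\<lambda>k. if k = n then 1 else 0)" by auto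
  then show ?thesis by (simp add: ell2_unit_def Abs_ell2_inverse)
qed

lemma cip_unit_right [simp]: "cip x (ell2_unit n) = coord x n"
proof -
  have "cip x (ell2_unit n) = (\<Sum>k. if k = n then coord x n else 0)"
    unfolding cip_def by (rule suminf_cong) auto
  also have "\<dots> = (\<Sum>k\<in>{n}. if k = n then coord x n else 0)"
    by (rule suminf_finite) auto
  finally show ?thesis by simp
qed

lemma cip_unit_left [simp]: "cip (ell2_unit n) x = cnj (coord x n)"
  using cip_commute[of "ell2_unit n" x] by simp

lemma ell2_eqI_cip:
  assumes "\<And>z. cip z x = cip z y" shows "x = y"
proof (rule ell2_eqI)
  fix n
  show "coord x n = coord y n" using assms[of "ell2_unit n"] by simp
qed

lemma coord_finite_combination:
  "finite F \<Longrightarrow> coord (\<Sum>n\<in>F. csc (c n) (ell2_unit n)) k = (if k \<in> F then c k else 0)"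
proof -
  assume "finite F"
  have "coord (\<Sum>n\<in>F. csc (c n) (ell2_unit n)) k = (\<Sum>n\<in>F. if n = k then c n else 0)"
    by (auto intro!: sum.cong)
  then show ?thesis using \<open>finite F\<close> by (simp add: sum.delta)
qed

lemma norm_finite_combination:
  assumes "finite F"
  shows "(norm (\<Sum>n\<in>F. csc (c n) (ell2_unit n)))\<^sup>2 = (\<Sum>n\<in>F. (cmod (c n))\<^sup>2)"
proof -
  have "(norm (\<Sum>n\<in>F. csc (c n) (ell2_unit n)))\<^sup>2 = (\<Sum>k. if k \<in> F then (cmod (c k))\<^sup>2 else 0)"
    unfolding norm_ell2_square coord_finite_combination[OF assms] by (rule suminf_cong) auto
  also have "\<dots> = (\<Sum>k\<in>F. if k \<in> F then (cmod (c k))\<^sup>2 else 0)"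
    by (rule suminf_finite[OF assms]) auto
  finally show ?thesis by simp
qed

text \<open>The squared error is the tail of the series for the squared norm.\<close>

lemma ell2_expansion: "(\<lambda>N. \<Sum>n<N. csc (coord x n) (ell2_unit n)) \<longlonglongrightarrow> x"
proof -
  define s where "s N = (\<Sum>n<N. csc (coord x n) (ell2_unit n))" for N
  have c: "coord (s N) k = (if k < N then coord x k else 0)" for N k
    unfolding s_def by (subst coord_finite_combination) auto
  have n: "(norm (s N - x))\<^sup>2 = (norm x)\<^sup>2 - (\<Sum>k<N. (cmod (coord x k))\<^sup>2)" for N
  proof -
    have "(norm (s N - x))\<^sup>2 = (\<Sum>k. (cmod (coord (s N - x) (k + N)))\<^sup>2)"
      unfolding norm_ell2_square suminf_split_initial_segment[OF summable_coord[of "s N - x"], of N]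
      by (simp add: c)
    also have "\<dots> = (\<Sum>k. (cmod (coord x (k + N)))\<^sup>2)" by (simp add: c)
    finally show ?thesis
      unfolding norm_ell2_square[of x] suminf_split_initial_segment[OF summable_coord[of x], of N] by simp
  qed
  have "(\<lambda>N. (norm (s N - x))\<^sup>2) \<longlonglongrightarrow> (norm x)\<^sup>2 - (norm x)\<^sup>2"
    unfolding n using summable_LIMSEQ[OF summable_coord[of x]]
    by (intro tendsto_intros) (simp add: norm_ell2_square)
  then have "(\<lambda>N. sqrt ((norm (s N - x))\<^sup>2)) \<longlonglongrightarrow> sqrt 0"
    by (intro tendsto_intros) simp
  then have "(\<lambda>N. norm (s N - x)) \<longlonglongrightarrow> 0" by simp
  then show ?thesis
    unfolding s_def by (rule LIM_zero_cancel[OF tendsto_norm_zero_cancel])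
qed

lemma bounded_linear_cip_left: "bounded_linear (\<lambda>x. cip x z)"
  by (rule bounded_linear_intro[where K = "norm z"])
    (auto simp: cip_add_left scaleR_ell2_def cip_csc_left scaleR_conv_of_real cmod_cip_le)

section \<open>Bounded complex linear operators and their adjoints\<close>

definition bounded_clinear :: "(ell2 \<Rightarrow> ell2) \<Rightarrow> bool" where
  "bounded_clinear T \<longleftrightarrow> bounded_linear T \<and> (\<forall>c x. T (csc c x) = csc c (T x))"

lemma bounded_clinearI:
  assumes "\<And>x y. T (x + y) = T x + T y" "\<And>c x. T (csc c x) = csc c (T x)" "\<And>x. norm (T x) \<le> K * norm x"
  shows "bounded_clinear T"
  unfolding bounded_clinear_def
  by (intro conjI allI bounded_linear_intro[where K = K] assms(1,2))
    (auto simp: scaleR_ell2_def assms(2) assms(3) mult.commute[of _ K])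

lemma bounded_clinear_add: "bounded_clinear T \<Longrightarrow> T (x + y) = T x + T y"
  by (simp add: bounded_clinear_def bounded_linear.linear linear_add)

lemma bounded_clinear_diff: "bounded_clinear T \<Longrightarrow> T (x - y) = T x - T y"
  by (simp add: bounded_clinear_def bounded_linear.linear linear_diff)

lemma bounded_clinear_zero: "bounded_clinear T \<Longrightarrow> T 0 = 0"
  by (simp add: bounded_clinear_def bounded_linear.linear linear_0)

lemma bounded_clinear_csc: "bounded_clinear T \<Longrightarrow> T (csc c x) = csc c (T x)"
  by (simp add: bounded_clinear_def)

lemma bounded_clinear_sum: "bounded_clinear T \<Longrightarrow> T (sum f F) = (\<Sum>i\<in>F. T (f i))"
  by (simp add: bounded_clinear_def bounded_linear.linear linear_sum)

lemma bounded_clinear_bound: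
  "bounded_clinear T \<Longrightarrow> \<exists>K>0. \<forall>x. norm (T x) \<le> K * norm x"
  using bounded_linear.pos_bounded[of T] by (auto simp: bounded_clinear_def mult.commute)

lemma bounded_clinear_tendsto: "bounded_clinear T \<Longrightarrow> X \<longlonglongrightarrow> x \<Longrightarrow> (\<lambda>n. T (X n)) \<longlonglongrightarrow> T x"
  by (simp add: bounded_clinear_def bounded_linear.tendsto)

lemma bounded_clinear_compose:
  "bounded_clinear S \<Longrightarrow> bounded_clinear T \<Longrightarrow> bounded_clinear (\<lambda>x. S (T x))"
  by (auto simp: bounded_clinear_def bounded_linear_compose)

text \<open>Coordinate \<open>n\<close> of the adjoint is forced: it is the product with
  \<open>ell2_unit n\<close>, moved across \<open>T\<close>. \<open>adj_aux\<close> shows that these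
  coordinates are square summable.\<close>

definition adj :: "(ell2 \<Rightarrow> ell2) \<Rightarrow> ell2 \<Rightarrow> ell2" where
  "adj T y = Abs_ell2 (\<lambda>n. cip y (T (ell2_unit n)))"

text \<open>Duality between synthesis and analysis with the same constant: for the combination
  \<open>s\<close> whose coefficients are the numbers \<open>cip y (b n)\<close>, the product
  \<open>cip y s\<close> is the sum \<open>S\<close> to be bounded. This gives
  \<open>S\<^sup>2 \<le> B * S * (norm y)\<^sup>2\<close>, where one factor \<open>S\<close>
  cancels.\<close>

lemma sum_cip_le:
  assumes "\<And>c. (norm (\<Sum>n\<in>F. csc (c n) (b n)))\<^sup>2 \<le> B * (\<Sum>n\<in>F. (cmod (c n))\<^sup>2)" "B \<ge> 0"
  shows "(\<Sum>n\<in>F. (cmod (cip y (b n)))\<^sup>2) \<le> B * (norm y)\<^sup>2"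
proof -
  define S where "S = (\<Sum>n\<in>F. (cmod (cip y (b n)))\<^sup>2)"
  define s where "s = (\<Sum>n\<in>F. csc (cip y (b n)) (b n))"
  have "cip y s = complex_of_real S"
    unfolding s_def S_def of_real_sum complex_norm_square cip_sum_right cip_csc_right
    by (simp add: mult.commute)
  moreover have S0: "S \<ge> 0" by (simp add: S_def sum_nonneg)
  ultimately have "S = cmod (cip y s)" by simp
  also have "\<dots> \<le> norm y * norm s" by (rule cmod_cip_le)
  finally have "S\<^sup>2 \<le> (norm y * norm s)\<^sup>2" using S0 by (rule power_mono)
  also have "\<dots> \<le> (norm y)\<^sup>2 * (B * S)"
    unfolding power_mult_distrib s_def S_def by (intro mult_left_mono assms(1)) simp
  finally have "S * S \<le> (B * (norm y)\<^sup>2) * S" by (simp add: power2_eq_square mult_ac)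
  then have "S \<le> B * (norm y)\<^sup>2 \<or> S = 0"
    using S0 by (metis mult_right_le_imp_le order_le_less)
  then show ?thesis using assms(2) unfolding S_def[symmetric] by auto
qed

lemma adj_aux:
  assumes T: "bounded_clinear T" and K: "\<And>x. norm (T x) \<le> K * norm x" "K \<ge> 0"
  shows "coord (adj T y) n = cip y (T (ell2_unit n))" "norm (adj T y) \<le> K * norm y"
proof -
  have "(norm (\<Sum>n\<in>F. csc (c n) (T (ell2_unit n))))\<^sup>2 \<le> K\<^sup>2 * (\<Sum>n\<in>F. (cmod (c n))\<^sup>2)" if "finite F" for F c
  proof -
    have "(norm (T (\<Sum>n\<in>F. csc (c n) (ell2_unit n))))\<^sup>2 \<le> (K * norm (\<Sum>n\<in>F. csc (c n) (ell2_unit n)))\<^sup>2"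
      by (intro power_mono K) simp
    then show ?thesis
      by (simp add: power_mult_distrib norm_finite_combination[OF that] bounded_clinear_sum[OF T] bounded_clinear_csc[OF T])
  qed
  then have *: "(\<Sum>n<N. (cmod (cip y (T (ell2_unit n))))\<^sup>2) \<le> (K * norm y)\<^sup>2" for N
    unfolding power_mult_distrib by (rule sum_cip_le[OF _ zero_le_power2]) simp
  show "coord (adj T y) n = cip y (T (ell2_unit n))" "norm (adj T y) \<le> K * norm y"
    unfolding adj_def using ell2_boundedI[OF *] K(2) by auto
qed

lemma coord_adj:
  assumes "bounded_clinear T" shows "coord (adj T y) n = cip y (T (ell2_unit n))"
proof -
  obtain K where "K > 0" "\<And>x. norm (T x) \<le> K * norm x" using bounded_clinear_bound[OF assms] by blast
  then show ?thesis by (intro adj_aux(1)[OF assms]) auto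
qed

lemma bounded_clinear_adj:
  assumes "bounded_clinear T" shows "bounded_clinear (adj T)"
proof -
  obtain K where "K > 0" "\<And>x. norm (T x) \<le> K * norm x" using bounded_clinear_bound[OF assms] by blast
  then show ?thesis
    by (intro bounded_clinearI[where K = K] adj_aux assms)
      (auto intro!: ell2_eqI simp: coord_adj[OF assms] cip_add_left cip_csc_left)
qed

text \<open>Holds on finite combinations of unit vectors by the choice of coordinates; both sides
  are continuous in \<open>x\<close>.\<close>

lemma cip_adj:
  assumes T: "bounded_clinear T" shows "cip (T x) y = cip x (adj T y)"
proof -
  define s where "s N = (\<Sum>n<N. csc (coord x n) (ell2_unit n))" for N
  have s: "s \<longlonglongrightarrow> x" unfolding s_def by (rule ell2_expansion)
  have "cip (T (s N)) y = cip (s N) (adj T y)" for N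
    by (simp add: s_def bounded_clinear_sum[OF T] bounded_clinear_csc[OF T] cip_sum_left cip_csc_left
        coord_adj[OF T] cip_commute[of y])
  then have "(\<lambda>N. cip (s N) (adj T y)) \<longlonglongrightarrow> cip (T x) y"
    using bounded_linear.tendsto[OF bounded_linear_cip_left bounded_clinear_tendsto[OF T s], of y] by simp
  then show ?thesis
    by (rule LIMSEQ_unique) (rule bounded_linear.tendsto[OF bounded_linear_cip_left s])
qed

section \<open>Bessel sequences and interpolation in the sequence space\<close>

definition ell2_bessel :: "real \<Rightarrow> (nat \<Rightarrow> ell2) \<Rightarrow> bool" where
  "ell2_bessel B b \<longleftrightarrow> (\<forall>x N. (\<Sum>n<N. (cmod (cip x (b n)))\<^sup>2) \<le> B * (norm x)\<^sup>2)"

definition analysis :: "(nat \<Rightarrow> ell2) \<Rightarrow> ell2 \<Rightarrow> ell2" where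
  "analysis b x = Abs_ell2 (\<lambda>n. cip x (b n))"

lemma analysis_aux:
  assumes "ell2_bessel B b" "B \<ge> 0"
  shows "coord (analysis b x) n = cip x (b n)" "norm (analysis b x) \<le> sqrt B * norm x"
proof -
  have *: "(\<Sum>n<N. (cmod (cip x (b n)))\<^sup>2) \<le> (sqrt B * norm x)\<^sup>2" for N
    using assms by (simp add: ell2_bessel_def power_mult_distrib)
  show "coord (analysis b x) n = cip x (b n)" "norm (analysis b x) \<le> sqrt B * norm x"
    unfolding analysis_def using ell2_boundedI[OF *] assms(2) by auto
qed

lemma bounded_clinear_analysis:
  assumes "ell2_bessel B b" "B \<ge> 0" shows "bounded_clinear (analysis b)"
  by (rule bounded_clinearI[where K = "sqrt B"])
    (auto intro!: ell2_eqI simp: analysis_aux[OF assms] cip_add_left cip_csc_left)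

text \<open>So \<open>adj (analysis b)\<close> is the synthesis operator of \<open>b\<close>,
  obtained without summing a series.\<close>

lemma adj_analysis_unit:
  assumes "ell2_bessel B b" "B \<ge> 0" shows "adj (analysis b) (ell2_unit n) = b n"
proof (rule ell2_eqI_cip)
  note A = bounded_clinear_analysis[OF assms]
  fix z
  show "cip z (adj (analysis b) (ell2_unit n)) = cip z (b n)"
    unfolding cip_adj[OF A, symmetric] by (simp add: analysis_aux[OF assms])
qed

text \<open>The Lax--Milgram argument: \<open>c \<mapsto> c + t (d - T\<^sup>*T c)\<close> is a contraction for small \<open>t\<close>.\<close>

lemma adj_right_inverse:
  assumes T: "bounded_clinear T" and m: "m > 0" "\<And>x. m * norm x \<le> norm (T x)"
  obtains I where "bounded_clinear I" "\<And>d. adj T (I d) = d"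
proof -
  define A where "A c = adj T (T c)" for c
  have A: "bounded_clinear A"
    unfolding A_def by (rule bounded_clinear_compose[OF bounded_clinear_adj[OF T] T])
  have lower: "m\<^sup>2 * (norm c)\<^sup>2 \<le> inner (A c) c" for c
  proof -
    have "cip (T c) (T c) = cip c (A c)" unfolding A_def by (rule cip_adj[OF T])
    then have "inner (A c) c = (norm (T c))\<^sup>2"
      unfolding power2_norm_eq_inner inner_ell2_def by (simp add: cip_commute[of "A c" c])
    moreover have "(m * norm c)\<^sup>2 \<le> (norm (T c))\<^sup>2" using m by (intro power_mono) auto
    ultimately show ?thesis by (simp add: power_mult_distrib)
  qed
  obtain K0 where "K0 > 0" "\<And>x. norm (A x) \<le> K0 * norm x" using bounded_clinear_bound[OF A] by blast
  \<comment> \<open>Enlarging \<open>K0\<close> ensures that \<open>m\<^sup>2 / K \<le> 1\<close>,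
    so that the radicand of \<open>q\<close> is nonnegative.\<close>
  define K where "K = max K0 (m\<^sup>2)"
  have K: "norm (A x) \<le> K * norm x" for x
    using \<open>norm (A x) \<le> K0 * norm x\<close> mult_right_mono[of K0 K "norm x"] by (simp add: K_def)
  have K0: "K > 0" and mK: "m\<^sup>2 \<le> K" using \<open>K0 > 0\<close> by (auto simp: K_def)
  \<comment> \<open>This \<open>t\<close> minimizes the bound
    \<open>1 - 2 * t * m\<^sup>2 + t\<^sup>2 * K\<^sup>2\<close> for the squared contraction
    factor.\<close>
  define t where "t = m\<^sup>2 / K\<^sup>2"
  define q where "q = sqrt (1 - (m\<^sup>2 / K)\<^sup>2)"
  have mK1: "m\<^sup>2 / K \<le> 1" "0 < m\<^sup>2 / K" using K0 mK m by auto
  then have q1: "0 \<le> 1 - (m\<^sup>2 / K)\<^sup>2" "1 - (m\<^sup>2 / K)\<^sup>2 < 1"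
    by (auto simp: power_le_one)
  then have q: "0 \<le> q" "q < 1" by (auto simp: q_def)
  have contr: "norm (u - t *\<^sub>R A u) \<le> q * norm u" for u
  proof -
    have "(norm (u - t *\<^sub>R A u))\<^sup>2 = (norm u)\<^sup>2 - 2 * t * inner (A u) u + t\<^sup>2 * (norm (A u))\<^sup>2"
      unfolding power2_norm_eq_inner
      by (simp add: inner_diff_left inner_diff_right inner_commute[of u "A u"] power2_eq_square right_diff_distrib)
    also have "\<dots> \<le> (norm u)\<^sup>2 - 2 * t * (m\<^sup>2 * (norm u)\<^sup>2) + t\<^sup>2 * (K * norm u)\<^sup>2"
      using K0 by (intro add_mono diff_mono mult_left_mono lower power_mono K) (auto simp: t_def)
    also have "\<dots> = (1 - (m\<^sup>2 / K)\<^sup>2) * (norm u)\<^sup>2"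
    proof -
      have "t * m\<^sup>2 = (m\<^sup>2 / K)\<^sup>2" "t\<^sup>2 * K\<^sup>2 = (m\<^sup>2 / K)\<^sup>2"
        using K0 by (simp_all add: t_def power2_eq_square)
      then have "2 * t * (m\<^sup>2 * (norm u)\<^sup>2) = 2 * ((m\<^sup>2 / K)\<^sup>2 * (norm u)\<^sup>2)"
        "t\<^sup>2 * (K * norm u)\<^sup>2 = (m\<^sup>2 / K)\<^sup>2 * (norm u)\<^sup>2"
        unfolding power_mult_distrib by (metis mult.assoc)+
      then show ?thesis by (simp only: left_diff_distrib)
    qed
    also have "\<dots> = (q * norm u)\<^sup>2"
      using q1 by (simp add: q_def power_mult_distrib)
    finally show ?thesis by (rule power2_le_imp_le) (simp add: q)
  qed
  \<comment> \<open>Uniqueness of solutions makes the solution map \<open>G\<close>, which is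
    defined by choice, linear.\<close>
  have inj: "c = c'" if "A c = A c'" for c c'
  proof -
    have "m\<^sup>2 * (norm (c - c'))\<^sup>2 \<le> 0"
      using lower[of "c - c'"] that by (simp add: bounded_clinear_diff[OF A])
    then show ?thesis using m(1) by (simp add: mult_le_0_iff)
  qed
  have t0: "t > 0" using K0 m by (simp add: t_def)
  have ex: "\<exists>c. A c = d" for d
  proof -
    have "\<exists>!c\<in>UNIV. c + t *\<^sub>R (d - A c) = c"
    proof (rule Banach_fix)
      show "complete (UNIV :: ell2 set)" by (rule complete_UNIV)
      show "dist (x + t *\<^sub>R (d - A x)) (y + t *\<^sub>R (d - A y)) \<le> q * dist x y" for x y
        using contr[of "x - y"] by (simp add: dist_norm bounded_clinear_diff[OF A] algebra_simps)
    qed (use q in auto)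
    then show ?thesis using t0 by auto
  qed
  define G where "G d = (SOME c. A c = d)" for d
  have AG: "A (G d) = d" for d unfolding G_def by (rule someI_ex[OF ex])
  have "bounded_clinear G"
  proof (rule bounded_clinearI)
    show "G (x + y) = G x + G y" for x y
      by (rule inj) (simp add: AG bounded_clinear_add[OF A])
    show "G (csc c x) = csc c (G x)" for c x
      by (rule inj) (simp add: AG bounded_clinear_csc[OF A])
    show "norm (G d) \<le> (1 / m\<^sup>2) * norm d" for d
    proof (cases "G d = 0")
      case False
      have "m\<^sup>2 * (norm (G d))\<^sup>2 \<le> norm d * norm (G d)"
        using lower[of "G d"] norm_cauchy_schwarz[of d "G d"] by (simp add: AG)
      then have "m\<^sup>2 * norm (G d) \<le> norm d" using False by (simp add: power2_eq_square)
      then show ?thesis using m(1) by (simp add: field_simps)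
    qed simp
  qed
  then have "bounded_clinear (\<lambda>d. T (G d))" by (rule bounded_clinear_compose[OF T])
  moreover have "adj T (T (G d)) = d" for d using AG by (simp add: A_def)
  ultimately show thesis using that by blast
qed

lemma ell2_besselI:
  assumes "\<And>N c. (norm (\<Sum>n<N. csc (c n) (b n)))\<^sup>2 \<le> B * (\<Sum>n<N. (cmod (c n))\<^sup>2)" "B \<ge> 0"
  shows "ell2_bessel B b"
  unfolding ell2_bessel_def by (intro allI sum_cip_le assms)

text \<open>The lower bound extends from finite combinations to the whole sequence space by
  continuity, so the synthesis operator \<open>T\<close> is bounded below. Its adjoint is the
  analysis operator, and a bounded right inverse of that solves the moment problem linearly.\<close>

lemma riesz_interpolation:
  assumes up: "\<And>N c. (norm (\<Sum>n<N. csc (c n) (b n)))\<^sup>2 \<le> B * (\<Sum>n<N. (cmod (c n))\<^sup>2)" "B \<ge> 0"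
    and low: "\<And>N c. m * (\<Sum>n<N. (cmod (c n))\<^sup>2) \<le> (norm (\<Sum>n<N. csc (c n) (b n)))\<^sup>2" "m > 0"
  obtains I where "bounded_clinear I" "\<And>d n. cip (I d) (b n) = coord d n"
proof -
  have bes: "ell2_bessel B b" by (rule ell2_besselI[OF up])
  define T where "T = adj (analysis b)"
  have T: "bounded_clinear T"
    unfolding T_def by (intro bounded_clinear_adj bounded_clinear_analysis[OF bes up(2)])
  have Tu: "T (ell2_unit n) = b n" for n
    unfolding T_def by (rule adj_analysis_unit[OF bes up(2)])
  have "sqrt m * norm x \<le> norm (T x)" for x
  proof -
    define s where "s N = (\<Sum>n<N. csc (coord x n) (ell2_unit n))" for N
    have s: "s \<longlonglongrightarrow> x" unfolding s_def by (rule ell2_expansion)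
    have "sqrt m * norm (s N) \<le> norm (T (s N))" for N
    proof -
      have "m * (norm (s N))\<^sup>2 \<le> (norm (T (s N)))\<^sup>2"
        using low(1)[of "coord x" N]
        by (simp add: s_def norm_finite_combination bounded_clinear_sum[OF T] bounded_clinear_csc[OF T] Tu)
      then have "sqrt (m * (norm (s N))\<^sup>2) \<le> sqrt ((norm (T (s N)))\<^sup>2)" by (rule real_sqrt_le_mono)
      then show ?thesis by (simp add: real_sqrt_mult)
    qed
    moreover have "(\<lambda>N. sqrt m * norm (s N)) \<longlonglongrightarrow> sqrt m * norm x" by (intro tendsto_intros s)
    moreover have "(\<lambda>N. norm (T (s N))) \<longlonglongrightarrow> norm (T x)"
      by (intro tendsto_intros bounded_clinear_tendsto[OF T] s)
    ultimately show ?thesis by (blast intro: LIMSEQ_le)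
  qed
  then obtain I where I: "bounded_clinear I" "\<And>d. adj T (I d) = d"
    using adj_right_inverse[OF T, of "sqrt m"] low(2) by auto
  have "cip (I d) (b n) = coord d n" for d n
    using coord_adj[OF T, of "I d" n] by (simp add: I(2) Tu)
  with I(1) show thesis using that by blast
qed

text \<open>The odd-indexed vectors of \<open>b\<close> serve to make \<open>W\<close> bounded below: there it interpolates the
  coordinates of its argument.\<close>

lemma riesz_realization:
  assumes up: "\<And>N c. (norm (\<Sum>n<N. csc (c n) (b n)))\<^sup>2 \<le> B * (\<Sum>n<N. (cmod (c n))\<^sup>2)" "B \<ge> 0"
    and low: "\<And>N c. m * (\<Sum>n<N. (cmod (c n))\<^sup>2) \<le> (norm (\<Sum>n<N. csc (c n) (b n)))\<^sup>2" "m > 0"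
    and a: "ell2_bessel B' a" "B' \<ge> 0"
  obtains W K where "bounded_clinear W" "K > 0" "\<And>x. norm x \<le> K * norm (W x)" "\<And>i. adj W (b (2 * i)) = a i"
proof -
  obtain I where I: "bounded_clinear I" "\<And>d n. cip (I d) (b n) = coord d n"
    using riesz_interpolation[OF up low] by blast
  have bes: "ell2_bessel B b" by (rule ell2_besselI[OF up])
  define d where "d n = (if even n then a (n div 2) else ell2_unit (n div 2))" for n
  have split: "(\<Sum>n<2*N. (cmod (cip x (d n)))\<^sup>2) = (\<Sum>n<N. (cmod (cip x (a n)))\<^sup>2) + (\<Sum>n<N. (cmod (coord x n))\<^sup>2)" for N x
    by (induction N) (auto simp: d_def)
  have dbes: "ell2_bessel (B' + 1) d"
    unfolding ell2_bessel_def
  proof (intro allI)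
    fix x N
    have "(\<Sum>n<N. (cmod (cip x (d n)))\<^sup>2) \<le> (\<Sum>n<2*N. (cmod (cip x (d n)))\<^sup>2)"
      by (rule sum_mono2) auto
    also have "\<dots> \<le> (B' + 1) * (norm x)\<^sup>2"
      using a(1) sum_coord_le[of x N] unfolding split ell2_bessel_def
      by (simp add: ring_distribs add_mono)
    finally show "(\<Sum>n<N. (cmod (cip x (d n)))\<^sup>2) \<le> (B' + 1) * (norm x)\<^sup>2" .
  qed
  have B1: "B' + 1 \<ge> 0" using a(2) by simp
  define W where "W x = I (analysis d x)" for x
  have W: "bounded_clinear W"
    unfolding W_def by (rule bounded_clinear_compose[OF I(1) bounded_clinear_analysis[OF dbes B1]])
  \<comment> \<open>Testing \<open>W x\<close> against \<open>b n\<close> gives the prescribed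
    number \<open>cip x (d n)\<close>, so the adjoint of \<open>W\<close> sends \<open>b n\<close>
    to \<open>d n\<close>.\<close>
  have Wb: "cip (W x) (b n) = cip x (d n)" for x n
    by (simp add: W_def I(2) analysis_aux[OF dbes B1])
  \<comment> \<open>The analysis coefficients of \<open>W x\<close> for \<open>b\<close> are those
    of \<open>x\<close> for \<open>d\<close>: the unit vectors among the \<open>d n\<close> bound
    their norm below by \<open>norm x\<close>, the Bessel bound of \<open>b\<close> above by a
    multiple of \<open>norm (W x)\<close>. The summand 1 keeps the constant positive if
    \<open>B = 0\<close>.\<close>
  have "norm x \<le> (sqrt B + 1) * norm (W x)" for x
  proof -
    have eq: "analysis b (W x) = analysis d x"
      by (rule ell2_eqI) (simp add: analysis_aux[OF dbes B1] analysis_aux[OF bes up(2)] Wb)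
    have "(norm x)\<^sup>2 \<le> (norm (analysis d x))\<^sup>2"
      unfolding norm_ell2_square[of x]
    proof (rule suminf_le_const[OF summable_coord])
      fix N
      have "(\<Sum>n<N. (cmod (coord x n))\<^sup>2) \<le> (\<Sum>n<2*N. (cmod (cip x (d n)))\<^sup>2)"
        unfolding split by (simp add: sum_nonneg)
      also have "\<dots> \<le> (norm (analysis d x))\<^sup>2"
        using sum_coord_le[of "analysis d x" "2 * N"] by (simp add: analysis_aux[OF dbes B1])
      finally show "(\<Sum>n<N. (cmod (coord x n))\<^sup>2) \<le> (norm (analysis d x))\<^sup>2" .
    qed
    then have "norm x \<le> norm (analysis b (W x))" unfolding eq
      by (rule power2_le_imp_le) simp
    also have "\<dots> \<le> sqrt B * norm (W x)" by (rule analysis_aux(2)[OF bes up(2)])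
    finally show ?thesis by (simp add: ring_distribs add_increasing2)
  qed
  moreover have "adj W (b (2 * i)) = a i" for i
  proof (rule ell2_eqI_cip)
    fix z
    show "cip z (adj W (b (2 * i))) = cip z (a i)"
      unfolding cip_adj[OF W, symmetric] Wb by (simp add: d_def)
  qed
  moreover have "sqrt B + 1 > 0" using real_sqrt_ge_zero[OF up(2)] by linarith
  ultimately show thesis using that W by blast
qed


section \<open>Hilbert spaces on a carrier set\<close>

lemma complex_ring_simps [simp]:
  "carrier complex_ring = UNIV" "mult complex_ring = (*)" "one complex_ring = 1"
  "zero complex_ring = 0" "add complex_ring = (+)"
  by (simp_all add: complex_ring_def)

lemma cring_complex_ring: "cring complex_ring"
proof (rule cringI)
  show "abelian_group complex_ring"
    by (rule abelian_groupI) (auto simp: algebra_simps intro: exI[of _ "- _"])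
  show "Group.comm_monoid complex_ring"
    by (rule comm_monoidI) (auto simp: algebra_simps)
qed (auto simp: algebra_simps)

text \<open>\<open>hilbert_space\<close> without completeness, so that norms and limits are
  available while completeness is still to be proved, and on subspaces that need not be
  closed.\<close>

locale prehilbert = Module.module complex_ring H for H :: "'a inner_space" (structure) +
  assumes cinner_add_left:
      "\<lbrakk>x \<in> carrier H; y \<in> carrier H; z \<in> carrier H\<rbrakk> \<Longrightarrow>
        cinner H (x \<oplus> y) z = cinner H x z + cinner H y z"
    and cinner_smult_left:
      "\<lbrakk>x \<in> carrier H; y \<in> carrier H\<rbrakk> \<Longrightarrow> cinner H (c \<odot> x) y = c * cinner H x y"
    and cinner_commute:
      "\<lbrakk>x \<in> carrier H; y \<in> carrier H\<rbrakk> \<Longrightarrow> cinner H y x = cnj (cinner H x y)"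
    and cinner_self_nonneg: "x \<in> carrier H \<Longrightarrow> cinner H x x \<in> \<real>\<^sub>\<ge>\<^sub>0"
    and cinner_self_eq_0: "\<lbrakk>x \<in> carrier H; cinner H x x = 0\<rbrakk> \<Longrightarrow> x = \<zero>"
begin

definition hlim :: "(nat \<Rightarrow> 'a) \<Rightarrow> 'a \<Rightarrow> bool" where
  "hlim \<sigma> x \<longleftrightarrow> (\<forall>n. \<sigma> n \<in> carrier H) \<and> x \<in> carrier H \<and> (\<lambda>n. hnorm H (\<sigma> n \<ominus> x)) \<longlonglongrightarrow> 0"

definition hcauchy :: "(nat \<Rightarrow> 'a) \<Rightarrow> bool" where
  "hcauchy \<sigma> \<longleftrightarrow> (\<forall>n. \<sigma> n \<in> carrier H) \<and>
    (\<forall>e>0. \<exists>M. \<forall>m n. M \<le> m \<longrightarrow> M \<le> n \<longrightarrow> hnorm H (\<sigma> m \<ominus> \<sigma> n) < e)"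

definition is_subspace :: "'a set \<Rightarrow> bool" where
  "is_subspace N \<longleftrightarrow> N \<subseteq> carrier H \<and> \<zero> \<in> N \<and> (\<forall>x\<in>N. \<forall>y\<in>N. x \<oplus> y \<in> N) \<and> (\<forall>c. \<forall>x\<in>N. c \<odot> x \<in> N)"

lemma smult_in [simp]: "x \<in> carrier H \<Longrightarrow> c \<odot> x \<in> carrier H"
  by simp

lemma uminus_eq_smult: "x \<in> carrier H \<Longrightarrow> \<ominus> x = (- 1) \<odot> x"
proof -
  assume x: "x \<in> carrier H"
  have "(- 1) \<odot> x \<oplus> x = (- 1 + 1) \<odot> x" using smult_l_distr[of "- 1" 1 x] smult_one[of x] x by simp
  also have "\<dots> = \<zero>" using smult_l_null[of x] x by simp
  finally show ?thesis using x by (intro M.minus_equality) auto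
qed

lemma cinner_add_right:
  "\<lbrakk>x \<in> carrier H; y \<in> carrier H; z \<in> carrier H\<rbrakk> \<Longrightarrow> cinner H z (x \<oplus> y) = cinner H z x + cinner H z y"
  by (simp add: cinner_add_left cinner_commute[of _ z])

lemma cinner_smult_right:
  "\<lbrakk>x \<in> carrier H; y \<in> carrier H\<rbrakk> \<Longrightarrow> cinner H y (c \<odot> x) = cnj c * cinner H y x"
  by (simp add: cinner_smult_left cinner_commute[of _ y])

lemma cinner_zero_left [simp]: "x \<in> carrier H \<Longrightarrow> cinner H \<zero> x = 0"
  using cinner_smult_left[of x x 0] smult_l_null[of x] by simp

lemma cinner_zero_right [simp]: "x \<in> carrier H \<Longrightarrow> cinner H x \<zero> = 0"
  using cinner_smult_right[of x x 0] smult_l_null[of x] by simp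

lemma cinner_diff_left:
  "\<lbrakk>x \<in> carrier H; y \<in> carrier H; z \<in> carrier H\<rbrakk> \<Longrightarrow> cinner H (x \<ominus> y) z = cinner H x z - cinner H y z"
  by (simp add: a_minus_def uminus_eq_smult cinner_add_left cinner_smult_left)

lemma cinner_diff_right:
  "\<lbrakk>x \<in> carrier H; y \<in> carrier H; z \<in> carrier H\<rbrakk> \<Longrightarrow> cinner H z (x \<ominus> y) = cinner H z x - cinner H z y"
  by (simp add: a_minus_def uminus_eq_smult cinner_add_right cinner_smult_right)

lemma cinner_finsum_left:
  "\<lbrakk>finite F; \<And>i. i \<in> F \<Longrightarrow> f i \<in> carrier H; y \<in> carrier H\<rbrakk> \<Longrightarrow>
    cinner H (finsum H f F) y = (\<Sum>i\<in>F. cinner H (f i) y)"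
  by (induction F rule: finite_induct) (auto simp: Pi_def cinner_add_left M.finsum_closed)

lemma cinner_finsum_right:
  "\<lbrakk>finite F; \<And>i. i \<in> F \<Longrightarrow> f i \<in> carrier H; y \<in> carrier H\<rbrakk> \<Longrightarrow>
    cinner H y (finsum H f F) = (\<Sum>i\<in>F. cinner H y (f i))"
  by (induction F rule: finite_induct) (auto simp: Pi_def cinner_add_right M.finsum_closed)

lemma cinner_self: "x \<in> carrier H \<Longrightarrow> cinner H x x = complex_of_real ((hnorm H x)\<^sup>2)"
  using cinner_self_nonneg[of x]
  by (auto simp: hnorm_def complex_eq_iff complex_nonneg_Reals_iff)

lemma hnorm_square: "x \<in> carrier H \<Longrightarrow> (hnorm H x)\<^sup>2 = Re (cinner H x x)"
  by (simp add: cinner_self)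

lemma hnorm_nonneg [simp]: "x \<in> carrier H \<Longrightarrow> 0 \<le> hnorm H x"
  using cinner_self_nonneg[of x] by (simp add: hnorm_def complex_nonneg_Reals_iff)

lemma hnorm_eq_0 [simp]:
  assumes "x \<in> carrier H" shows "hnorm H x = 0 \<longleftrightarrow> x = \<zero>"
proof
  assume "hnorm H x = 0"
  then show "x = \<zero>" using cinner_self[OF assms] cinner_self_eq_0[OF assms] by simp
next
  assume "x = \<zero>"
  then show "hnorm H x = 0" by (simp add: hnorm_def)
qed

lemma hnorm_zero [simp]: "hnorm H \<zero> = 0"
  by (simp add: hnorm_def)

lemma minus_eq_zeroD:
  assumes "x \<in> carrier H" "y \<in> carrier H" "x \<ominus> y = \<zero>" shows "x = y"
proof -
  have "x = (x \<ominus> y) \<oplus> y" using assms(1,2) by (simp add: a_minus_def M.a_assoc M.l_neg)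
  then show ?thesis using assms by simp
qed

lemma minus_self [simp]: "x \<in> carrier H \<Longrightarrow> x \<ominus> x = \<zero>"
  by (simp add: a_minus_def M.r_neg)

text \<open>The device for vector identities on a carrier: testing against all vectors turns them
  into identities of complex numbers.\<close>

lemma cinner_eqI:
  assumes "x \<in> carrier H" "y \<in> carrier H" "\<And>z. z \<in> carrier H \<Longrightarrow> cinner H x z = cinner H y z"
  shows "x = y"
proof -
  have "cinner H (x \<ominus> y) (x \<ominus> y) = 0" using assms by (simp add: cinner_diff_left)
  then have "x \<ominus> y = \<zero>" using assms(1,2) cinner_self_eq_0 by simp
  then show ?thesis by (rule minus_eq_zeroD[OF assms(1,2)])
qed

lemma minus_zero_right [simp]: "x \<in> carrier H \<Longrightarrow> x \<ominus> \<zero> = x"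
  by (rule cinner_eqI) (auto simp: cinner_diff_left)

lemma hnorm_smult: "x \<in> carrier H \<Longrightarrow> hnorm H (c \<odot> x) = cmod c * hnorm H x"
proof -
  assume x: "x \<in> carrier H"
  have "complex_of_real ((hnorm H (c \<odot> x))\<^sup>2) = c * cnj c * cinner H x x"
    unfolding cinner_self[OF smult_in[OF x], symmetric]
    using x by (simp add: cinner_smult_left cinner_smult_right)
  also have "\<dots> = complex_of_real ((cmod c * hnorm H x)\<^sup>2)"
    unfolding complex_norm_square[symmetric] cinner_self[OF x] by (simp add: power_mult_distrib)
  finally have "(hnorm H (c \<odot> x))\<^sup>2 = (cmod c * hnorm H x)\<^sup>2" unfolding of_real_eq_iff .
  then show ?thesis using x by simp
qed

lemma cauchy_schwarz:
  assumes x: "x \<in> carrier H" and y: "y \<in> carrier H"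
  shows "cmod (cinner H x y) \<le> hnorm H x * hnorm H y"
proof (cases "y = \<zero>")
  case False
  define N where "N = (hnorm H y)\<^sup>2"
  have N: "N > 0" using False y by (simp add: N_def)
  \<comment> \<open>\<open>t \<odot> y\<close> is the orthogonal projection of \<open>x\<close> onto
    \<open>y\<close>; the squared length of the remainder is nonnegative.\<close>
  define t where "t = cinner H x y / N"
  have yy: "cinner H y y = N" using y by (simp add: cinner_self N_def)
  have yx: "cinner H y x = cnj (cinner H x y)" using x y by (rule cinner_commute)
  have "complex_of_real ((hnorm H (x \<ominus> t \<odot> y))\<^sup>2) = cinner H x x - cnj t * cinner H x y - t * cinner H y x + t * cnj t * cinner H y y"
    unfolding cinner_self[OF M.minus_closed[OF x smult_in[OF y]], symmetric]
    using x y by (simp add: cinner_diff_left cinner_diff_right cinner_smult_left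
        cinner_smult_right algebra_simps)
  also have "\<dots> = cinner H x x - (cinner H x y * cnj (cinner H x y)) / N"
    using N unfolding yy yx t_def by (simp add: field_simps)
  also have "\<dots> = complex_of_real ((hnorm H x)\<^sup>2 - (cmod (cinner H x y))\<^sup>2 / N)"
    unfolding complex_norm_square[symmetric] cinner_self[OF x] by simp
  finally have "(hnorm H (x \<ominus> t \<odot> y))\<^sup>2 = (hnorm H x)\<^sup>2 - (cmod (cinner H x y))\<^sup>2 / N"
    unfolding of_real_eq_iff .
  then have "(cmod (cinner H x y))\<^sup>2 / N \<le> (hnorm H x)\<^sup>2"
    by (metis diff_ge_0_iff_ge zero_le_power2)
  then have "(cmod (cinner H x y))\<^sup>2 \<le> (hnorm H x * hnorm H y)\<^sup>2"
    using N by (simp add: pos_divide_le_eq power_mult_distrib N_def)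
  then show ?thesis by (rule power2_le_imp_le) (simp add: x y)
qed (use x in simp)

lemma hnorm_triangle:
  assumes x: "x \<in> carrier H" and y: "y \<in> carrier H"
  shows "hnorm H (x \<oplus> y) \<le> hnorm H x + hnorm H y"
proof (rule power2_le_imp_le)
  have yx: "cinner H y x = cnj (cinner H x y)" using x y by (rule cinner_commute)
  have "(hnorm H (x \<oplus> y))\<^sup>2 = (hnorm H x)\<^sup>2 + 2 * Re (cinner H x y) + (hnorm H y)\<^sup>2"
    using x y by (simp add: hnorm_square cinner_add_left cinner_add_right yx)
  also have "\<dots> \<le> (hnorm H x)\<^sup>2 + 2 * (hnorm H x * hnorm H y) + (hnorm H y)\<^sup>2"
    using complex_Re_le_cmod[of "cinner H x y"] cauchy_schwarz[OF x y] by simp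
  finally show "(hnorm H (x \<oplus> y))\<^sup>2 \<le> (hnorm H x + hnorm H y)\<^sup>2" by (simp add: power2_sum)
qed (simp add: x y)

lemma hnorm_minus_commute:
  assumes "x \<in> carrier H" "y \<in> carrier H" shows "hnorm H (x \<ominus> y) = hnorm H (y \<ominus> x)"
proof -
  have "(hnorm H (x \<ominus> y))\<^sup>2 = (hnorm H (y \<ominus> x))\<^sup>2"
    using assms by (simp add: hnorm_square cinner_diff_left cinner_diff_right algebra_simps)
  then show ?thesis using assms by simp
qed

lemma hnorm_minus_triangle:
  assumes "x \<in> carrier H" "y \<in> carrier H" "z \<in> carrier H"
  shows "hnorm H (x \<ominus> z) \<le> hnorm H (x \<ominus> y) + hnorm H (y \<ominus> z)"
proof -
  have "x \<ominus> z = (x \<ominus> y) \<oplus> (y \<ominus> z)"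
    by (rule cinner_eqI) (use assms in \<open>auto simp: cinner_add_left cinner_diff_left\<close>)
  then show ?thesis using hnorm_triangle[of "x \<ominus> y" "y \<ominus> z"] assms by simp
qed

lemma metric: "Metric_space (carrier H) (hdist H)"
proof
  fix x y z
  show "0 \<le> hdist H x y" by (simp add: hdist_def)
  show "hdist H x y = hdist H y x" using hnorm_minus_commute by (auto simp: hdist_def)
  assume xy: "x \<in> carrier H" "y \<in> carrier H"
  then show "(hdist H x y = 0) = (x = y)" using minus_eq_zeroD by (auto simp: hdist_def)
  assume "z \<in> carrier H"
  then show "hdist H x z \<le> hdist H x y + hdist H y z"
    using xy hnorm_minus_triangle by (auto simp: hdist_def)
qed

section \<open>Limits, completeness and closed spans in terms of sequences\<close>

lemma limitin_iff_hlim: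
  assumes \<sigma>: "\<And>n. \<sigma> n \<in> carrier H"
  shows "limitin (Metric_space.mtopology (carrier H) (hdist H)) \<sigma> x sequentially \<longleftrightarrow> hlim \<sigma> x"
proof -
  have "(\<forall>e>0. \<exists>N. \<forall>n\<ge>N. hnorm H (\<sigma> n \<ominus> x) < e) \<longleftrightarrow> (\<lambda>n. hnorm H (\<sigma> n \<ominus> x)) \<longlonglongrightarrow> 0"
    if "x \<in> carrier H"
    using \<sigma> that by (simp add: lim_sequentially)
  then show ?thesis
    unfolding Metric_space.limit_metric_sequentially[OF metric] hlim_def
    using \<sigma> by (auto simp: hdist_def)
qed

lemma mcomplete_iff:
  "Metric_space.mcomplete (carrier H) (hdist H) \<longleftrightarrow> (\<forall>\<sigma>. hcauchy \<sigma> \<longrightarrow> (\<exists>x. hlim \<sigma> x))"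
proof -
  have "Metric_space.MCauchy (carrier H) (hdist H) \<sigma> \<longleftrightarrow> hcauchy \<sigma>" for \<sigma>
    unfolding Metric_space.MCauchy_def[OF metric] hcauchy_def by (auto simp: hdist_def image_subset_iff)
  then show ?thesis
    unfolding Metric_space.mcomplete_def[OF metric] using limitin_iff_hlim hcauchy_def by metis
qed

lemma hspan_mono_subspace:
  assumes N: "is_subspace N" and S: "S \<subseteq> N" shows "hspan H S \<subseteq> N"
proof -
  have "finsum H (\<lambda>x. c x \<odot> x) F \<in> N" if "finite F" "F \<subseteq> S" for c F
    using that
  proof (induction F rule: finite_induct)
    case empty then show ?case using N by (simp add: is_subspace_def)
  next
    case (insert x F)
    then have "x \<in> N" "F \<subseteq> carrier H" using S N by (auto simp: is_subspace_def)
    then have "finsum H (\<lambda>x. c x \<odot> x) (insert x F) = c x \<odot> x \<oplus> finsum H (\<lambda>x. c x \<odot> x) F"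
      using insert N by (intro M.finsum_insert) (auto simp: is_subspace_def)
    then show ?case using insert \<open>x \<in> N\<close> N by (simp add: is_subspace_def)
  qed
  then show ?thesis by (auto simp: hspan_def)
qed

lemma hspan_subspace:
  assumes S: "S \<subseteq> carrier H" shows "is_subspace (hspan H S)" "S \<subseteq> hspan H S"
proof -
  have fs: "finsum H (\<lambda>x. c x \<odot> x) F \<in> carrier H" if "F \<subseteq> S" for c F
    using that S by (intro M.finsum_closed) auto
  have mem: "x \<in> hspan H S" if "x = finsum H (\<lambda>x. c x \<odot> x) F" "finite F" "F \<subseteq> S" for x c F
    using that unfolding hspan_def by blast
  show "is_subspace (hspan H S)"
    unfolding is_subspace_def
  proof (intro conjI ballI allI)
    show "hspan H S \<subseteq> carrier H" using fs by (auto simp: hspan_def)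
    show "\<zero> \<in> hspan H S" by (rule mem[of _ _ "{}"]) auto
    fix x assume "x \<in> hspan H S"
    then obtain c F where x: "x = finsum H (\<lambda>x. c x \<odot> x) F" "finite F" "F \<subseteq> S" by (auto simp: hspan_def)
    have in_x: "i \<in> F \<Longrightarrow> i \<in> carrier H" for i using x S by auto
    show "a \<odot> x \<in> hspan H S" for a
    proof (rule mem)
      show "a \<odot> x = finsum H (\<lambda>x. (a * c x) \<odot> x) F"
        by (rule cinner_eqI) (use x in_x fs in \<open>auto simp: cinner_finsum_left cinner_smult_left sum_distrib_left
            mult.assoc intro!: M.finsum_closed\<close>)
    qed (use x in auto)
    fix y assume "y \<in> hspan H S"
    then obtain d G where y: "y = finsum H (\<lambda>x. d x \<odot> x) G" "finite G" "G \<subseteq> S" by (auto simp: hspan_def)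
    have in_y: "i \<in> G \<Longrightarrow> i \<in> carrier H" for i using y S by auto
    show "x \<oplus> y \<in> hspan H S"
    proof (rule mem)
      \<comment> \<open>Coefficients are extended by 0 to the union of the two finite sets before
        they are added.\<close>
      show "x \<oplus> y = finsum H (\<lambda>i. ((if i \<in> F then c i else 0) + (if i \<in> G then d i else 0)) \<odot> i) (F \<union> G)"
      proof (rule cinner_eqI)
        fix z assume z: "z \<in> carrier H"
        have "(\<Sum>i\<in>F. c i * cinner H i z) = (\<Sum>i\<in>F \<union> G. (if i \<in> F then c i else 0) * cinner H i z)"
          using x(2) y(2) by (intro sum.mono_neutral_cong_left) auto
        moreover have "(\<Sum>i\<in>G. d i * cinner H i z) = (\<Sum>i\<in>F \<union> G. (if i \<in> G then d i else 0) * cinner H i z)"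
          using x(2) y(2) by (intro sum.mono_neutral_cong_left) auto
        moreover have "cinner H (finsum H (\<lambda>i. ((if i \<in> F then c i else 0) + (if i \<in> G then d i else 0)) \<odot> i) (F \<union> G)) z
          = (\<Sum>i\<in>F \<union> G. ((if i \<in> F then c i else 0) + (if i \<in> G then d i else 0)) * cinner H i z)"
          using x(2) y(2) in_x in_y z by (subst cinner_finsum_left) (auto intro!: sum.cong simp: cinner_smult_left)
        ultimately show "cinner H (x \<oplus> y) z =
          cinner H (finsum H (\<lambda>i. ((if i \<in> F then c i else 0) + (if i \<in> G then d i else 0)) \<odot> i) (F \<union> G)) z"
          using x y in_x in_y z fs
          by (simp add: cinner_add_left cinner_finsum_left cinner_smult_left sum.distrib ring_distribs)
      qed (use x y in_x in_y fs in \<open>auto intro!: M.finsum_closed\<close>)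
    qed (use x y in auto)
  qed
  show "S \<subseteq> hspan H S"
  proof
    fix x assume x: "x \<in> S"
    then have "x \<in> carrier H" using S by auto
    then have "finsum H (\<lambda>x. 1 \<odot> x) {x} = x"
      using smult_one[of x] M.finsum_insert[of "{}" x "\<lambda>x. 1 \<odot> x"] by simp
    then show "x \<in> hspan H S" using x by (intro mem[of _ "\<lambda>_. 1" "{x}"]) auto
  qed
qed

lemma closed_hspan_eq:
  assumes "S \<subseteq> carrier H"
  shows "closed_hspan H S = {x. \<exists>\<sigma>. (\<forall>n. \<sigma> n \<in> hspan H S) \<and> hlim \<sigma> x}"
proof -
  have sub: "hspan H S \<subseteq> carrier H" using hspan_subspace(1)[OF assms] by (simp add: is_subspace_def)
  have "closed_hspan H S = {x \<in> carrier H. \<exists>\<sigma>. range \<sigma> \<subseteq> hspan H S \<and>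
      limitin (Metric_space.mtopology (carrier H) (hdist H)) \<sigma> x sequentially}"
    unfolding closed_hspan_def Metric_space.closure_of_sequentially[OF metric]
    using sub by (simp add: Int_absorb2)
  also have "\<dots> = {x. \<exists>\<sigma>. (\<forall>n. \<sigma> n \<in> hspan H S) \<and> hlim \<sigma> x}"
  proof -
    have "(x \<in> carrier H \<and> range \<sigma> \<subseteq> hspan H S \<and>
      limitin (Metric_space.mtopology (carrier H) (hdist H)) \<sigma> x sequentially) \<longleftrightarrow>
      ((\<forall>n. \<sigma> n \<in> hspan H S) \<and> hlim \<sigma> x)" for \<sigma> x
    proof (cases "\<forall>n. \<sigma> n \<in> hspan H S")
      case True
      then have "\<sigma> n \<in> carrier H" for n using sub by auto
      then show ?thesis using True by (simp add: limitin_iff_hlim image_subset_iff) (auto simp: hlim_def)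
    qed auto
    then show ?thesis by blast
  qed
  finally show ?thesis .
qed

lemma hlimD:
  assumes "hlim \<sigma> x"
  shows "\<sigma> n \<in> carrier H" "x \<in> carrier H" "(\<lambda>n. hnorm H (\<sigma> n \<ominus> x)) \<longlonglongrightarrow> 0"
  using assms by (auto simp: hlim_def)

lemma hlim_add:
  assumes "hlim \<sigma> x" "hlim \<tau> y" shows "hlim (\<lambda>n. \<sigma> n \<oplus> \<tau> n) (x \<oplus> y)"
proof -
  have c: "\<sigma> n \<in> carrier H" "\<tau> n \<in> carrier H" "x \<in> carrier H" "y \<in> carrier H" for n
    using assms by (auto simp: hlim_def)
  have "hnorm H ((\<sigma> n \<oplus> \<tau> n) \<ominus> (x \<oplus> y)) \<le> hnorm H (\<sigma> n \<ominus> x) + hnorm H (\<tau> n \<ominus> y)" for n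
  proof -
    have "(\<sigma> n \<oplus> \<tau> n) \<ominus> (x \<oplus> y) = (\<sigma> n \<ominus> x) \<oplus> (\<tau> n \<ominus> y)"
      by (rule cinner_eqI) (auto simp: c cinner_add_left cinner_diff_left)
    then show ?thesis using hnorm_triangle c by simp
  qed
  moreover have "(\<lambda>n. hnorm H (\<sigma> n \<ominus> x) + hnorm H (\<tau> n \<ominus> y)) \<longlonglongrightarrow> 0 + 0"
    by (intro tendsto_add hlimD(3) assms)
  ultimately have "(\<lambda>n. hnorm H ((\<sigma> n \<oplus> \<tau> n) \<ominus> (x \<oplus> y))) \<longlonglongrightarrow> 0"
    by (intro Lim_null_comparison[of "\<lambda>n. hnorm H ((\<sigma> n \<oplus> \<tau> n) \<ominus> (x \<oplus> y))"
          "\<lambda>n. hnorm H (\<sigma> n \<ominus> x) + hnorm H (\<tau> n \<ominus> y)"]) (use c in auto)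
  then show ?thesis using c by (simp add: hlim_def)
qed

lemma hlim_smult:
  assumes "hlim \<sigma> x" shows "hlim (\<lambda>n. a \<odot> \<sigma> n) (a \<odot> x)"
proof -
  have c: "\<sigma> n \<in> carrier H" "x \<in> carrier H" for n using assms by (auto simp: hlim_def)
  have "hnorm H (a \<odot> \<sigma> n \<ominus> a \<odot> x) = cmod a * hnorm H (\<sigma> n \<ominus> x)" for n
  proof -
    have "a \<odot> \<sigma> n \<ominus> a \<odot> x = a \<odot> (\<sigma> n \<ominus> x)"
      by (rule cinner_eqI) (auto simp: c cinner_smult_left cinner_diff_left algebra_simps)
    then show ?thesis using c by (simp add: hnorm_smult)
  qed
  moreover have "(\<lambda>n. cmod a * hnorm H (\<sigma> n \<ominus> x)) \<longlonglongrightarrow> 0"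
    by (rule tendsto_mult_right_zero[OF hlimD(3)[OF assms]])
  ultimately show ?thesis using c by (simp add: hlim_def)
qed

lemma hlim_norm:
  assumes "hlim \<sigma> x" shows "(\<lambda>n. hnorm H (\<sigma> n)) \<longlonglongrightarrow> hnorm H x"
proof (rule LIM_zero_cancel, rule tendsto_rabs_zero_cancel)
  have c: "\<sigma> n \<in> carrier H" "x \<in> carrier H" for n using assms by (auto simp: hlim_def)
  have "\<bar>hnorm H (\<sigma> n) - hnorm H x\<bar> \<le> hnorm H (\<sigma> n \<ominus> x)" for n
    using hnorm_minus_triangle[of "\<sigma> n" x \<zero>] hnorm_minus_triangle[of x "\<sigma> n" \<zero>] hnorm_minus_commute[of x "\<sigma> n"] c
    by simp
  then show "(\<lambda>n. \<bar>hnorm H (\<sigma> n) - hnorm H x\<bar>) \<longlonglongrightarrow> 0"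
    by (intro Lim_null_comparison[OF _ hlimD(3)[OF assms]]) simp
qed

lemma hlim_unique:
  assumes "hlim \<sigma> x" "hlim \<sigma> y" shows "x = y"
proof -
  have c: "\<sigma> n \<in> carrier H" "x \<in> carrier H" "y \<in> carrier H" for n using assms by (auto simp: hlim_def)
  \<comment> \<open>The difference of the sequence with itself is constantly zero, so the difference
    of the two limits has norm 0.\<close>
  have "hlim (\<lambda>n. \<sigma> n \<oplus> (- 1) \<odot> \<sigma> n) (x \<oplus> (- 1) \<odot> y)"
    by (intro hlim_add hlim_smult assms)
  moreover have "\<sigma> n \<oplus> (- 1) \<odot> \<sigma> n = \<zero>" for n
    by (rule cinner_eqI) (auto simp: c cinner_smult_left cinner_add_left)
  ultimately have "hlim (\<lambda>n. \<zero>) (x \<oplus> (- 1) \<odot> y)" by simp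
  then have "(\<lambda>n. hnorm H \<zero>) \<longlonglongrightarrow> hnorm H (x \<oplus> (- 1) \<odot> y)" by (rule hlim_norm)
  then have "hnorm H (x \<oplus> (- 1) \<odot> y) = hnorm H \<zero>" by (simp add: LIMSEQ_const_iff)
  then have z: "x \<oplus> (- 1) \<odot> y = \<zero>" using c by simp
  have "cinner H x w = cinner H y w" if "w \<in> carrier H" for w
    using arg_cong[OF z, of "\<lambda>v. cinner H v w"] that c by (simp add: cinner_smult_left cinner_add_left)
  then show ?thesis using c by (intro cinner_eqI)
qed

lemma hlim_const: "x \<in> carrier H \<Longrightarrow> hlim (\<lambda>_. x) x"
  by (simp add: hlim_def)

lemma hlim_imp_hcauchy:
  assumes "hlim \<sigma> x" shows "hcauchy \<sigma>"
  unfolding hcauchy_def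
proof (intro conjI allI impI)
  have c: "\<sigma> n \<in> carrier H" "x \<in> carrier H" for n using assms by (auto simp: hlim_def)
  show "\<sigma> n \<in> carrier H" for n by (rule c)
  fix e :: real assume "e > 0"
  have "(\<lambda>n. hnorm H (\<sigma> n \<ominus> x)) \<longlonglongrightarrow> 0" using assms by (simp add: hlim_def)
  from LIMSEQ_D[OF this, of "e/2"] \<open>e > 0\<close>
  obtain M where M: "\<And>n. n \<ge> M \<Longrightarrow> hnorm H (\<sigma> n \<ominus> x) < e/2" using c by auto
  have "hnorm H (\<sigma> m \<ominus> \<sigma> n) < e" if "M \<le> m" "M \<le> n" for m n
    using hnorm_minus_triangle[of "\<sigma> m" x "\<sigma> n"] hnorm_minus_commute[of x "\<sigma> n"] M[of m] M[of n] that c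
    by simp
  then show "\<exists>M. \<forall>m n. M \<le> m \<longrightarrow> M \<le> n \<longrightarrow> hnorm H (\<sigma> m \<ominus> \<sigma> n) < e" by blast
qed

lemma closed_hspan_subspace:
  assumes "S \<subseteq> carrier H" shows "is_subspace (closed_hspan H S)" "hspan H S \<subseteq> closed_hspan H S"
proof -
  note sp = hspan_subspace(1)[OF assms, unfolded is_subspace_def]
  show 2: "hspan H S \<subseteq> closed_hspan H S"
  proof
    fix x assume "x \<in> hspan H S"
    moreover from this have "hlim (\<lambda>_. x) x" using sp hlim_const by auto
    ultimately show "x \<in> closed_hspan H S"
      unfolding closed_hspan_eq[OF assms] by (intro CollectI exI[of _ "\<lambda>_. x"]) simp
  qed
  show "is_subspace (closed_hspan H S)"
    unfolding is_subspace_def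
  proof (intro conjI ballI allI)
    show "closed_hspan H S \<subseteq> carrier H" by (auto simp: closed_hspan_eq[OF assms] hlim_def)
    show "\<zero> \<in> closed_hspan H S" by (rule subsetD[OF 2]) (simp add: sp)
    fix x assume "x \<in> closed_hspan H S"
    then obtain \<sigma> where s: "\<And>n. \<sigma> n \<in> hspan H S" "hlim \<sigma> x" by (auto simp: closed_hspan_eq[OF assms])
    show "c \<odot> x \<in> closed_hspan H S" for c
    proof -
      have "\<forall>n. c \<odot> \<sigma> n \<in> hspan H S" using s(1) sp by auto
      then show ?thesis unfolding closed_hspan_eq[OF assms] mem_Collect_eq using hlim_smult[OF s(2), of c] by (intro exI conjI)
    qed
    fix y assume "y \<in> closed_hspan H S"
    then obtain \<tau> where t: "\<And>n. \<tau> n \<in> hspan H S" "hlim \<tau> y" by (auto simp: closed_hspan_eq[OF assms])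
    show "x \<oplus> y \<in> closed_hspan H S"
    proof -
      have "\<forall>n. \<sigma> n \<oplus> \<tau> n \<in> hspan H S" using s(1) t(1) sp by auto
      then show ?thesis unfolding closed_hspan_eq[OF assms] mem_Collect_eq using hlim_add[OF s(2) t(2)] by (intro exI conjI)
    qed
  qed
qed

end

sublocale hilbert_space \<subseteq> prehilbert
  by (intro prehilbert.intro module_axioms prehilbert_axioms.intro
      cinner_add_left cinner_smult_left cinner_commute cinner_self_nonneg cinner_self_eq_0)

lemma hilbert_spaceI:
  assumes H: "prehilbert H" and c: "\<And>\<sigma>. prehilbert.hcauchy H \<sigma> \<Longrightarrow> \<exists>x. prehilbert.hlim H \<sigma> x"
  shows "hilbert_space H"
proof -
  have "Metric_space.mcomplete (carrier H) (hdist H)"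
    unfolding prehilbert.mcomplete_iff[OF H] using c by blast
  then show ?thesis
    by (intro hilbert_space.intro hilbert_space_axioms.intro prehilbert.axioms(1)[OF H]
        prehilbert.cinner_add_left[OF H] prehilbert.cinner_smult_left[OF H] prehilbert.cinner_commute[OF H]
        prehilbert.cinner_self_nonneg[OF H] prehilbert.cinner_self_eq_0[OF H])
qed


section \<open>Gram matrices\<close>

text \<open>If \<open>G\<close> is the Gram matrix of a family, this is the squared norm of its
  combination with coefficients \<open>c\<close> over \<open>F\<close>.\<close>

definition gram_form :: "(nat \<Rightarrow> nat \<Rightarrow> complex) \<Rightarrow> (nat \<Rightarrow> complex) \<Rightarrow> nat set \<Rightarrow> real" where
  "gram_form G c F = Re (\<Sum>i\<in>F. \<Sum>j\<in>F. c i * cnj (c j) * G i j)"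

definition gram_upper :: "(nat \<Rightarrow> nat \<Rightarrow> complex) \<Rightarrow> nat set \<Rightarrow> real \<Rightarrow> bool" where
  "gram_upper G J B \<longleftrightarrow> (\<forall>F c. finite F \<longrightarrow> F \<subseteq> J \<longrightarrow> gram_form G c F \<le> B * (\<Sum>i\<in>F. (cmod (c i))\<^sup>2))"

definition gram_lower :: "(nat \<Rightarrow> nat \<Rightarrow> complex) \<Rightarrow> nat set \<Rightarrow> real \<Rightarrow> bool" where
  "gram_lower G J m \<longleftrightarrow> (\<forall>F c. finite F \<longrightarrow> F \<subseteq> J \<longrightarrow> m * (\<Sum>i\<in>F. (cmod (c i))\<^sup>2) \<le> gram_form G c F)"

section \<open>Riesz bounds of a family and its Gram matrix\<close>

context prehilbert
begin

text \<open>Summed over indices, unlike \<open>hspan\<close>, which sums over vectors: repeated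
  members of the family count separately.\<close>

definition lin :: "(nat \<Rightarrow> complex) \<Rightarrow> (nat \<Rightarrow> 'a) \<Rightarrow> nat set \<Rightarrow> 'a" where
  "lin c f F = finsum H (\<lambda>i. c i \<odot> f i) F"

lemma lin_closed [simp]: "(\<And>i. i \<in> F \<Longrightarrow> f i \<in> carrier H) \<Longrightarrow> lin c f F \<in> carrier H"
  unfolding lin_def by (rule M.finsum_closed) auto

lemma cinner_lin_left:
  "\<lbrakk>finite F; \<And>i. i \<in> F \<Longrightarrow> f i \<in> carrier H; y \<in> carrier H\<rbrakk> \<Longrightarrow>
    cinner H (lin c f F) y = (\<Sum>i\<in>F. c i * cinner H (f i) y)"
  unfolding lin_def by (simp add: cinner_finsum_left cinner_smult_left)

lemma cinner_lin_right:
  "\<lbrakk>finite F; \<And>i. i \<in> F \<Longrightarrow> f i \<in> carrier H; y \<in> carrier H\<rbrakk> \<Longrightarrow>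
    cinner H y (lin c f F) = (\<Sum>i\<in>F. cnj (c i) * cinner H y (f i))"
  unfolding lin_def by (simp add: cinner_finsum_right cinner_smult_right)

lemma hnorm_lin:
  assumes F: "finite F" and f: "\<And>i. i \<in> F \<Longrightarrow> f i \<in> carrier H"
  shows "(hnorm H (lin c f F))\<^sup>2 = gram_form (\<lambda>i j. cinner H (f i) (f j)) c F"
proof -
  have "cinner H (lin c f F) (lin c f F) = (\<Sum>i\<in>F. c i * cinner H (f i) (lin c f F))"
    using f by (intro cinner_lin_left F) auto
  also have "\<dots> = (\<Sum>i\<in>F. \<Sum>j\<in>F. c i * cnj (c j) * cinner H (f i) (f j))"
    using f by (intro sum.cong refl) (simp add: cinner_lin_right F sum_distrib_left mult.assoc)
  finally show ?thesis using f by (simp add: hnorm_square gram_form_def)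
qed

lemma hnorm_lin_orthonormal:
  assumes F: "finite F" and u: "\<And>i. i \<in> F \<Longrightarrow> u i \<in> carrier H"
    and o: "\<And>i j. i \<in> F \<Longrightarrow> j \<in> F \<Longrightarrow> cinner H (u i) (u j) = (if i = j then 1 else 0)"
  shows "(hnorm H (lin c u F))\<^sup>2 = (\<Sum>i\<in>F. (cmod (c i))\<^sup>2)"
proof -
  have "(hnorm H (lin c u F))\<^sup>2 = gram_form (\<lambda>i j. cinner H (u i) (u j)) c F"
    by (rule hnorm_lin[OF F u])
  also have "\<dots> = Re (\<Sum>i\<in>F. \<Sum>j\<in>F. if i = j then c i * cnj (c j) else 0)"
    unfolding gram_form_def using o by (intro arg_cong[of _ _ Re] sum.cong refl) auto
  also have "\<dots> = (\<Sum>i\<in>F. (cmod (c i))\<^sup>2)"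
    using F by (simp add: sum.delta complex_norm_square[symmetric] flip: of_real_power)
  finally show ?thesis .
qed

lemma lin_subspace:
  assumes N: "is_subspace N" and "finite F" "\<And>i. i \<in> F \<Longrightarrow> f i \<in> N"
  shows "lin c f F \<in> N"
  using assms(2,3)
proof (induction F rule: finite_induct)
  case empty then show ?case using N by (simp add: is_subspace_def lin_def)
next
  case (insert x F)
  then have c: "f x \<in> carrier H" "f i \<in> carrier H" if "i \<in> F" for i
    using N that by (auto simp: is_subspace_def)
  have "lin c f (insert x F) = c x \<odot> f x \<oplus> lin c f F"
    unfolding lin_def using insert N by (intro M.finsum_insert) (auto simp: is_subspace_def)
  then show ?case using insert N by (simp add: is_subspace_def)
qed

lemma lin_insert:
  assumes "finite F" "x \<notin> F" "\<And>i. i \<in> insert x F \<Longrightarrow> f i \<in> carrier H"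
  shows "lin c f (insert x F) = c x \<odot> f x \<oplus> lin c f F"
  unfolding lin_def using assms by (intro M.finsum_insert) auto

lemma prehilbert_subspace:
  assumes N: "is_subspace N" shows "prehilbert (H\<lparr>carrier := N\<rparr>)"
proof -
  have sub: "N \<subseteq> carrier H" using N by (simp add: is_subspace_def)
  have "submodule N complex_ring H"
    using N uminus_eq_smult by (intro submoduleI) (auto simp: is_subspace_def subset_eq)
  from submodule.submodule_is_module[OF this module_axioms]
  have "Module.module complex_ring (H\<lparr>carrier := N\<rparr>)" .
  then show ?thesis
    using sub by (intro prehilbert.intro prehilbert_axioms.intro)
      (auto simp: cinner_add_left cinner_smult_left cinner_self_nonneg cinner_self_eq_0 subset_eq
        intro: cinner_commute)
qed

text \<open>An orthonormal basis of a closed span refers to spans and closures inside the restricted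
  carrier. Operations and norm are unchanged there, and exactly the limits in \<open>N\<close>
  survive.\<close>

lemma closed_hspan_restrict:
  assumes N: "is_subspace N" and S: "S \<subseteq> N"
  shows "closed_hspan (H\<lparr>carrier := N\<rparr>) S = closed_hspan H S \<inter> N"
proof -
  interpret K: prehilbert "H\<lparr>carrier := N\<rparr>" by (rule prehilbert_subspace[OF N])
  have sub: "N \<subseteq> carrier H" using N by (simp add: is_subspace_def)
  \<comment> \<open>\<open>finsum\<close> depends on the carrier, so the two sums are compared by
    induction.\<close>
  have fs: "finsum (H\<lparr>carrier := N\<rparr>) (\<lambda>x. c x \<odot> x) F = finsum H (\<lambda>x. c x \<odot> x) F"
    if "finite F" "F \<subseteq> S" for c F
    using that
  proof (induction F rule: finite_induct)
    case (insert x F)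
    then have "finsum (H\<lparr>carrier := N\<rparr>) (\<lambda>x. c x \<odot> x) (insert x F) =
        c x \<odot> x \<oplus> finsum (H\<lparr>carrier := N\<rparr>) (\<lambda>x. c x \<odot> x) F"
      using K.M.finsum_insert[of F x "\<lambda>x. c x \<odot> x"] S N by (auto simp: is_subspace_def subset_eq)
    moreover have "finsum H (\<lambda>x. c x \<odot> x) (insert x F) = c x \<odot> x \<oplus> finsum H (\<lambda>x. c x \<odot> x) F"
      using insert M.finsum_insert[of F x "\<lambda>x. c x \<odot> x"] S sub by (auto simp: subset_eq)
    ultimately show ?case using insert by simp
  qed simp
  have hs: "hspan (H\<lparr>carrier := N\<rparr>) S = hspan H S"
  proof (rule subset_antisym; rule subsetI)
    fix x assume "x \<in> hspan (H\<lparr>carrier := N\<rparr>) S"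
    then obtain c F where "x = finsum (H\<lparr>carrier := N\<rparr>) (\<lambda>x. c x \<odot> x) F" "finite F" "F \<subseteq> S"
      by (auto simp: hspan_def)
    then show "x \<in> hspan H S" using fs[of F c] unfolding hspan_def by blast
  next
    fix x assume "x \<in> hspan H S"
    then obtain c F where "x = finsum H (\<lambda>x. c x \<odot> x) F" "finite F" "F \<subseteq> S"
      by (auto simp: hspan_def)
    then have "x = finsum (H\<lparr>carrier := N\<rparr>) (\<lambda>x. c x \<odot>\<^bsub>H\<lparr>carrier := N\<rparr>\<^esub> x) F" "finite F" "F \<subseteq> S"
      using fs[of F c] by auto
    then show "x \<in> hspan (H\<lparr>carrier := N\<rparr>) S" unfolding hspan_def by blast
  qed
  have hn: "hnorm (H\<lparr>carrier := N\<rparr>) = hnorm H" by (simp add: hnorm_def fun_eq_iff)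
  \<comment> \<open>The inverse \<open>\<ominus>\<close> is determined by its property within the
    carrier; writing it as multiplication by -1 removes this dependence.\<close>
  have mi: "x \<ominus>\<^bsub>H\<lparr>carrier := N\<rparr>\<^esub> y = x \<ominus> y" if "x \<in> N" "y \<in> N" for x y
    using K.uminus_eq_smult[of y] uminus_eq_smult[of y] that sub
    by (simp add: a_minus_def subset_eq)
  have hl: "K.hlim \<sigma> x \<longleftrightarrow> hlim \<sigma> x \<and> x \<in> N" if "\<And>n. \<sigma> n \<in> N" for \<sigma> x
    using that sub mi unfolding K.hlim_def hlim_def hn by (auto simp: subset_eq)
  have hsub: "hspan H S \<subseteq> N" by (rule hspan_mono_subspace[OF N S])
  have "S \<subseteq> carrier H" using S sub by auto
  then show ?thesis
    using closed_hspan_eq[of S] K.closed_hspan_eq[of S] S hl hsub unfolding hs by (auto simp: subset_eq)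
qed

text \<open>Converse of the duality in \<open>sum_cip_le\<close>: for a combination
  \<open>x\<close>, expand one factor of \<open>cinner H x x\<close> and apply Cauchy--Schwarz to
  the coefficients and the products. The Bessel bound then puts the fourth power of the norm of
  \<open>x\<close> below \<open>B * S\<close> times its square.\<close>

lemma gram_upper_if_bessel:
  assumes "bessel_sequence H J f"
  shows "\<exists>B>0. gram_upper (\<lambda>i j. cinner H (f i) (f j)) J B"
proof -
  from assms obtain B where f: "f \<in> J \<rightarrow> carrier H" and B: "B > 0"
    "\<And>x. x \<in> carrier H \<Longrightarrow> (\<lambda>i. (cmod (cinner H x (f i)))\<^sup>2) summable_on J"
    "\<And>x. x \<in> carrier H \<Longrightarrow> (\<Sum>\<^sub>\<infinity>i\<in>J. (cmod (cinner H x (f i)))\<^sup>2) \<le> B * (hnorm H x)\<^sup>2"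
    unfolding bessel_sequence_def by blast
  have "(hnorm H (lin c f F))\<^sup>2 \<le> B * (\<Sum>i\<in>F. (cmod (c i))\<^sup>2)" if F: "finite F" "F \<subseteq> J" for F c
  proof -
    have fF: "f i \<in> carrier H" if "i \<in> F" for i using f F that by auto
    define x where "x = lin c f F"
    have x: "x \<in> carrier H" unfolding x_def using fF by (rule lin_closed)
    define S where "S = (\<Sum>i\<in>F. (cmod (c i))\<^sup>2)"
    have S: "S \<ge> 0" by (simp add: S_def sum_nonneg)
    have "(\<Sum>i\<in>F. (cmod (cinner H x (f i)))\<^sup>2) \<le> (\<Sum>\<^sub>\<infinity>i\<in>J. (cmod (cinner H x (f i)))\<^sup>2)"
      using finite_sum_le_infsum[OF B(2)[OF x] F] by simp
    also have "\<dots> \<le> B * (hnorm H x)\<^sup>2" by (rule B(3)[OF x])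
    finally have 1: "(\<Sum>i\<in>F. (cmod (cinner H x (f i)))\<^sup>2) \<le> B * (hnorm H x)\<^sup>2" .
    have "(hnorm H x)\<^sup>2 = Re (\<Sum>i\<in>F. cnj (c i) * cinner H x (f i))"
      unfolding hnorm_square[OF x] using cinner_lin_right[OF F(1) fF x, where c = c] by (simp add: x_def)
    also have "\<dots> \<le> cmod (\<Sum>i\<in>F. cnj (c i) * cinner H x (f i))" by (rule complex_Re_le_cmod)
    also have "\<dots> \<le> (\<Sum>i\<in>F. \<bar>cmod (c i)\<bar> * \<bar>cmod (cinner H x (f i))\<bar>)"
      by (rule order_trans[OF norm_sum]) (simp add: norm_mult)
    also have "\<dots> \<le> L2_set (\<lambda>i. cmod (c i)) F * L2_set (\<lambda>i. cmod (cinner H x (f i))) F"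
      by (rule L2_set_mult_ineq)
    finally have "((hnorm H x)\<^sup>2)\<^sup>2 \<le> (L2_set (\<lambda>i. cmod (c i)) F * L2_set (\<lambda>i. cmod (cinner H x (f i))) F)\<^sup>2"
      by (rule power_mono) simp
    also have "\<dots> = S * (\<Sum>i\<in>F. (cmod (cinner H x (f i)))\<^sup>2)"
      by (simp add: L2_set_def power_mult_distrib sum_nonneg S_def)
    also have "\<dots> \<le> S * (B * (hnorm H x)\<^sup>2)" using 1 S by (rule mult_left_mono)
    finally have "(hnorm H x)\<^sup>2 * (hnorm H x)\<^sup>2 \<le> (B * S) * (hnorm H x)\<^sup>2"
      by (simp add: power2_eq_square mult_ac)
    then have "(hnorm H x)\<^sup>2 \<le> B * S"
    proof (cases "hnorm H x = 0")
      case False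
      then have "(hnorm H x)\<^sup>2 > 0" by simp
      with \<open>(hnorm H x)\<^sup>2 * (hnorm H x)\<^sup>2 \<le> (B * S) * (hnorm H x)\<^sup>2\<close> show ?thesis
        by (rule mult_right_le_imp_le)
    qed (use B S in simp)
    then show ?thesis unfolding x_def S_def .
  qed
  moreover have "(hnorm H (lin c f F))\<^sup>2 = gram_form (\<lambda>i j. cinner H (f i) (f j)) c F" if "finite F" "F \<subseteq> J" for F c
    using that f by (intro hnorm_lin) auto
  ultimately show ?thesis using B(1) unfolding gram_upper_def by metis
qed

text \<open>The inverse of \<open>S\<close> sends a combination of the \<open>f i\<close> to the
  combination of the orthonormal \<open>u i\<close> with the same coefficients, whose norm is that
  of the coefficients.\<close>

lemma gram_bounds_if_riesz:
  assumes R: "riesz_basic_sequence H A f" and f: "f \<in> A \<rightarrow> carrier H"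
  shows "\<exists>m>0. gram_lower (\<lambda>i j. cinner H (f i) (f j)) A m"
proof -
  define K where "K = closed_hspan H (f ` A)"
  have fA: "f ` A \<subseteq> carrier H" using f by auto
  have K: "is_subspace K" "f ` A \<subseteq> K"
    using closed_hspan_subspace[OF fA] hspan_subspace[OF fA] unfolding K_def by auto
  have Kc: "K \<subseteq> carrier H" using K by (simp add: is_subspace_def)
  from R obtain u S where u: "orthonormal_basis (H\<lparr>carrier := K\<rparr>) A u"
    and S: "invertible_operator (H\<lparr>carrier := K\<rparr>) S" and Su: "\<And>i. i \<in> A \<Longrightarrow> S (u i) = f i"
    unfolding riesz_basic_sequence_def riesz_basis_def K_def by blast
  from S obtain T where SB: "bounded_operator (H\<lparr>carrier := K\<rparr>) S" and TB: "bounded_operator (H\<lparr>carrier := K\<rparr>) T"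
    and TS: "\<And>x. x \<in> K \<Longrightarrow> T (S x) = x"
    unfolding invertible_operator_def by auto
  have hn: "hnorm (H\<lparr>carrier := K\<rparr>) = hnorm H" by (simp add: hnorm_def fun_eq_iff)
  have uK: "u i \<in> K" if "i \<in> A" for i using u that by (auto simp: orthonormal_basis_def)
  have uo: "cinner H (u i) (u j) = (if i = j then 1 else 0)" if "i \<in> A" "j \<in> A" for i j
    using u that by (auto simp: orthonormal_basis_def)
  have S_add: "S (x \<oplus> y) = S x \<oplus> S y" if "x \<in> K" "y \<in> K" for x y
    using SB that by (auto simp: bounded_operator_def)
  have S_sm: "S (c \<odot> x) = c \<odot> S x" if "x \<in> K" for x c
    using SB that by (auto simp: bounded_operator_def)
  have SK: "S x \<in> K" if "x \<in> K" for x
    using SB that by (auto simp: bounded_operator_def)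
  have S0: "S \<zero> = \<zero>"
    using S_sm[of \<zero> 0] SK[of \<zero>] K Kc smult_l_null[of "S \<zero>"] smult_l_null[of \<zero>]
    by (auto simp: is_subspace_def subset_eq)
  have "\<exists>C. \<forall>x\<in>K. hnorm H (T x) \<le> C * hnorm H x"
    using TB by (simp add: bounded_operator_def hn)
  then obtain C where C: "\<And>x. x \<in> K \<Longrightarrow> hnorm H (T x) \<le> C * hnorm H x" by blast
  have lin_S: "S (lin c u F) = lin c f F" if "finite F" "F \<subseteq> A" for c F
    using that
  proof (induction F rule: finite_induct)
    case empty then show ?case by (simp add: lin_def S0)
  next
    case (insert i F)
    have "lin c u (insert i F) = c i \<odot> u i \<oplus> lin c u F"
      using insert uK Kc by (intro lin_insert) auto
    moreover have "lin c f (insert i F) = c i \<odot> f i \<oplus> lin c f F"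
      using insert f by (intro lin_insert) auto
    moreover have "lin c u F \<in> K" using insert uK by (intro lin_subspace[OF K(1)]) auto
    moreover have "c i \<odot> u i \<in> K" using insert uK[of i] K(1) by (auto simp: is_subspace_def)
    ultimately show ?case using insert S_add S_sm Su uK by simp
  qed
  \<comment> \<open>Nothing forces the operator bound \<open>C\<close> to be positive;
    \<open>C\<^sup>2 + 1\<close> is positive in every case.\<close>
  have "(1 / (C\<^sup>2 + 1)) * (\<Sum>i\<in>F. (cmod (c i))\<^sup>2) \<le> gram_form (\<lambda>i j. cinner H (f i) (f j)) c F"
    if F: "finite F" "F \<subseteq> A" for c F
  proof -
    have uF: "u i \<in> carrier H" "f i \<in> carrier H" if "i \<in> F" for i using that F uK Kc f by auto
    have xK: "lin c u F \<in> K" using F uK by (intro lin_subspace[OF K(1)]) auto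
    have 1: "(\<Sum>i\<in>F. (cmod (c i))\<^sup>2) = (hnorm H (lin c u F))\<^sup>2"
      using F uo by (intro hnorm_lin_orthonormal[symmetric] F(1) uF(1)) (auto simp: subset_eq)
    have "hnorm H (lin c u F) \<le> C * hnorm H (lin c f F)"
      using C[OF SK[OF xK]] TS[OF xK] by (simp add: lin_S F)
    then have "(hnorm H (lin c u F))\<^sup>2 \<le> (C * hnorm H (lin c f F))\<^sup>2"
      using xK Kc by (intro power_mono) auto
    also have "\<dots> \<le> (C\<^sup>2 + 1) * (hnorm H (lin c f F))\<^sup>2"
      by (simp add: power_mult_distrib ring_distribs)
    also have "(hnorm H (lin c f F))\<^sup>2 = gram_form (\<lambda>i j. cinner H (f i) (f j)) c F"
      by (rule hnorm_lin[OF F(1) uF(2)])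
    finally have "(\<Sum>i\<in>F. (cmod (c i))\<^sup>2) \<le> (C\<^sup>2 + 1) * gram_form (\<lambda>i j. cinner H (f i) (f j)) c F"
      unfolding 1 .
    then show ?thesis by (simp add: pos_divide_le_eq add_nonneg_pos mult.commute)
  qed
  moreover have "1 / (C\<^sup>2 + 1) > 0" by (simp add: add_nonneg_pos)
  ultimately show ?thesis unfolding gram_lower_def by blast
qed

end


section \<open>Synthesis operators of Riesz families\<close>

text \<open>Stands for the square summable sequences indexed by \<open>A\<close>, kept inside one
  type for all \<open>A\<close>.\<close>

definition supported_on :: "nat set \<Rightarrow> ell2 set" where
  "supported_on A = {c. \<forall>k. k \<notin> A \<longrightarrow> coord c k = 0}"

lemma supported_on_closed:
  "c \<in> supported_on A \<Longrightarrow> d \<in> supported_on A \<Longrightarrow> c + d \<in> supported_on A"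
  "c \<in> supported_on A \<Longrightarrow> d \<in> supported_on A \<Longrightarrow> c - d \<in> supported_on A"
  "c \<in> supported_on A \<Longrightarrow> csc a c \<in> supported_on A"
  "0 \<in> supported_on A"
  "i \<in> A \<Longrightarrow> ell2_unit i \<in> supported_on A"
  by (auto simp: supported_on_def)

lemma supported_on_mono: "A \<subseteq> B \<Longrightarrow> supported_on A \<subseteq> supported_on B"
  by (auto simp: supported_on_def)

lemma supported_on_lim:
  assumes "\<And>n. c n \<in> supported_on A" "c \<longlonglongrightarrow> d" shows "d \<in> supported_on A"
  unfolding supported_on_def
proof (intro CollectI allI impI)
  fix k assume k: "k \<notin> A"
  have "(\<lambda>n. cip (c n) (ell2_unit k)) \<longlonglongrightarrow> cip d (ell2_unit k)"
    by (rule bounded_linear.tendsto[OF bounded_linear_cip_left assms(2)])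
  moreover have "cip (c n) (ell2_unit k) = 0" for n using assms(1)[of n] k by (simp add: supported_on_def)
  ultimately show "coord d k = 0" by (simp add: LIMSEQ_const_iff)
qed

locale riesz_family = hilbert_space H for H :: "'a inner_space" (structure) +
  fixes f :: "nat \<Rightarrow> 'a" and A :: "nat set" and m B :: real
  assumes in_carrier: "i \<in> A \<Longrightarrow> f i \<in> carrier H"
    and m_pos: "m > 0" and B_nonneg: "B \<ge> 0"
    and lower: "\<lbrakk>finite F; F \<subseteq> A\<rbrakk> \<Longrightarrow> m * (\<Sum>i\<in>F. (cmod (c i))\<^sup>2) \<le> (hnorm H (lin c f F))\<^sup>2"
    and upper: "\<lbrakk>finite F; F \<subseteq> A\<rbrakk> \<Longrightarrow> (hnorm H (lin c f F))\<^sup>2 \<le> B * (\<Sum>i\<in>F. (cmod (c i))\<^sup>2)"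
begin

definition psum :: "ell2 \<Rightarrow> nat \<Rightarrow> 'a" where
  "psum c n = lin (coord c) f (A \<inter> {..<n})"

definition syn :: "ell2 \<Rightarrow> 'a" where
  "syn c = (SOME x. hlim (psum c) x)"

definition coeffs :: "'a \<Rightarrow> ell2" where
  "coeffs = inv_into (supported_on A) syn"

lemma psum_closed [simp]: "psum c n \<in> carrier H"
  unfolding psum_def by (rule lin_closed) (auto intro: in_carrier)

lemma cinner_psum: "z \<in> carrier H \<Longrightarrow> cinner H (psum c n) z = (\<Sum>i\<in>A \<inter> {..<n}. coord c i * cinner H (f i) z)"
  unfolding psum_def by (rule cinner_lin_left) (auto intro: in_carrier)

text \<open>The difference is a combination over indices from \<open>n\<close> to below
  \<open>k\<close>, so the upper Riesz bound compares it with the corresponding piece of the series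
  for \<open>(norm c)\<^sup>2\<close>.\<close>

lemma psum_diff_le:
  assumes "n \<le> k"
  shows "(hnorm H (psum c k \<ominus> psum c n))\<^sup>2 \<le> B * ((\<Sum>i<k. (cmod (coord c i))\<^sup>2) - (\<Sum>i<n. (cmod (coord c i))\<^sup>2))"
proof -
  have un: "A \<inter> {..<k} = (A \<inter> {..<n}) \<union> (A \<inter> {n..<k})" using assms by auto
  have l: "lin (coord c) f (A \<inter> {n..<k}) \<in> carrier H" by (rule lin_closed) (auto intro: in_carrier)
  have "psum c k \<ominus> psum c n = lin (coord c) f (A \<inter> {n..<k})"
  proof (rule cinner_eqI[OF _ l])
    fix z assume z: "z \<in> carrier H"
    have "cinner H (lin (coord c) f (A \<inter> {n..<k})) z = (\<Sum>i\<in>A \<inter> {n..<k}. coord c i * cinner H (f i) z)"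
      using z by (intro cinner_lin_left) (auto intro: in_carrier)
    then show "cinner H (psum c k \<ominus> psum c n) z = cinner H (lin (coord c) f (A \<inter> {n..<k})) z"
      using z unfolding un by (simp add: cinner_diff_left cinner_psum un) (subst sum.union_disjoint, auto)
  qed simp
  then have "(hnorm H (psum c k \<ominus> psum c n))\<^sup>2 \<le> B * (\<Sum>i\<in>A \<inter> {n..<k}. (cmod (coord c i))\<^sup>2)"
    using upper[of "A \<inter> {n..<k}" "coord c"] by simp
  also have "\<dots> \<le> B * (\<Sum>i\<in>{n..<k}. (cmod (coord c i))\<^sup>2)"
    using B_nonneg by (intro mult_left_mono sum_mono2) auto
  also have "(\<Sum>i\<in>{n..<k}. (cmod (coord c i))\<^sup>2) = (\<Sum>i<k. (cmod (coord c i))\<^sup>2) - (\<Sum>i<n. (cmod (coord c i))\<^sup>2)"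
    using sum_diff_nat_ivl[of 0 n k "\<lambda>i. (cmod (coord c i))\<^sup>2"] assms by (simp add: atLeast0LessThan)
  finally show ?thesis .
qed

lemma hlim_syn: "hlim (psum c) (syn c)"
proof -
  define S where "S n = (\<Sum>i<n. (cmod (coord c i))\<^sup>2)" for n
  have le: "(hnorm H (psum c k \<ominus> psum c n))\<^sup>2 \<le> B * \<bar>S k - S n\<bar>" for k n
  proof (cases "n \<le> k")
    case True
    have "B * (S k - S n) \<le> B * \<bar>S k - S n\<bar>" using B_nonneg by (intro mult_left_mono) auto
    with psum_diff_le[OF True, of c] show ?thesis unfolding S_def by linarith
  next
    case False
    have "B * (S n - S k) \<le> B * \<bar>S k - S n\<bar>" using B_nonneg by (intro mult_left_mono) auto
    with psum_diff_le[of k n c] False show ?thesis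
      unfolding S_def hnorm_minus_commute[OF psum_closed[of c k] psum_closed[of c n]] by linarith
  qed
  have "Cauchy S"
    using summable_LIMSEQ[OF summable_coord[of c]] unfolding S_def by (rule LIMSEQ_imp_Cauchy)
  have "hcauchy (psum c)"
    unfolding hcauchy_def
  proof (intro conjI allI impI)
    fix e :: real assume e: "e > 0"
    \<comment> \<open>Dividing by \<open>B + 1\<close> also covers \<open>B = 0\<close>.\<close>
    then have "e\<^sup>2 / (B + 1) > 0" using B_nonneg by simp
    then obtain M where M: "\<And>k n. k \<ge> M \<Longrightarrow> n \<ge> M \<Longrightarrow> dist (S k) (S n) < e\<^sup>2 / (B + 1)"
      using metric_CauchyD[OF \<open>Cauchy S\<close>] by blast
    have "hnorm H (psum c k \<ominus> psum c n) < e" if "M \<le> k" "M \<le> n" for k n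
    proof (rule power_less_imp_less_base[where n = 2])
      have "(hnorm H (psum c k \<ominus> psum c n))\<^sup>2 \<le> B * \<bar>S k - S n\<bar>" by (rule le)
      also have "\<dots> \<le> (B + 1) * \<bar>S k - S n\<bar>" by (simp add: ring_distribs)
      also have "\<dots> < (B + 1) * (e\<^sup>2 / (B + 1))"
        using M[OF that] B_nonneg by (intro mult_strict_left_mono) (auto simp: dist_real_def)
      also have "\<dots> = e\<^sup>2" using B_nonneg by simp
      finally show "(hnorm H (psum c k \<ominus> psum c n))\<^sup>2 < e\<^sup>2" .
    qed (use e in simp)
    then show "\<exists>M. \<forall>k n. M \<le> k \<longrightarrow> M \<le> n \<longrightarrow> hnorm H (psum c k \<ominus> psum c n) < e" by blast
  qed simp
  then have "\<exists>x. hlim (psum c) x" using complete mcomplete_iff by blast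
  then show ?thesis unfolding syn_def by (rule someI_ex)
qed

lemma syn_closed [simp]: "syn c \<in> carrier H"
  by (rule hlimD(2)[OF hlim_syn])

lemma syn_eqI: "hlim (psum c) x \<Longrightarrow> syn c = x"
  by (rule hlim_unique[OF hlim_syn])

lemma syn_add: "syn (c + d) = syn c \<oplus> syn d"
proof (rule syn_eqI)
  have "psum (c + d) n = psum c n \<oplus> psum d n" for n
    by (rule cinner_eqI) (auto simp: cinner_psum cinner_add_left sum.distrib ring_distribs)
  then have "psum (c + d) = (\<lambda>n. psum c n \<oplus> psum d n)" by auto
  then show "hlim (psum (c + d)) (syn c \<oplus> syn d)" using hlim_add[OF hlim_syn hlim_syn, of c d] by simp
qed

lemma syn_csc: "syn (csc a c) = a \<odot> syn c"
proof (rule syn_eqI)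
  have "psum (csc a c) n = a \<odot> psum c n" for n
    by (rule cinner_eqI) (auto simp: cinner_psum cinner_smult_left sum_distrib_left mult.assoc)
  then have "psum (csc a c) = (\<lambda>n. a \<odot> psum c n)" by auto
  then show "hlim (psum (csc a c)) (a \<odot> syn c)" using hlim_smult[OF hlim_syn, of a c] by simp
qed

lemma syn_diff: "syn (c - d) = syn c \<ominus> syn d"
proof -
  have "c - d = c + csc (- 1) d" by (rule ell2_eqI) simp
  then have "syn (c - d) = syn c \<oplus> (- 1) \<odot> syn d" by (simp only: syn_add syn_csc)
  then show ?thesis by (simp add: a_minus_def uminus_eq_smult)
qed

lemma syn_unit:
  assumes "i \<in> A" shows "syn (ell2_unit i) = f i"
proof (rule syn_eqI)
  have "psum (ell2_unit i) n = f i" if "n > i" for n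
  proof (rule cinner_eqI)
    fix z assume z: "z \<in> carrier H"
    have "cinner H (psum (ell2_unit i) n) z = (\<Sum>k\<in>A \<inter> {..<n}. if k = i then cinner H (f i) z else 0)"
      unfolding cinner_psum[OF z] by (rule sum.cong) auto
    then show "cinner H (psum (ell2_unit i) n) z = cinner H (f i) z" using assms that by simp
  qed (use assms in_carrier in auto)
  then have "\<forall>\<^sub>F n in sequentially. hnorm H (psum (ell2_unit i) n \<ominus> f i) = 0"
    using assms in_carrier by (intro eventually_sequentiallyI[of "Suc i"]) simp
  then have "(\<lambda>n. hnorm H (psum (ell2_unit i) n \<ominus> f i)) \<longlonglongrightarrow> 0"
    by (rule tendsto_eventually)
  then show "hlim (psum (ell2_unit i)) (f i)" using assms in_carrier by (simp add: hlim_def)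
qed

lemma syn_upper: "(hnorm H (syn c))\<^sup>2 \<le> B * (norm c)\<^sup>2"
proof (rule LIMSEQ_le_const2)
  show "(\<lambda>n. (hnorm H (psum c n))\<^sup>2) \<longlonglongrightarrow> (hnorm H (syn c))\<^sup>2"
    by (intro tendsto_power hlim_norm hlim_syn)
  have "(hnorm H (psum c n))\<^sup>2 \<le> B * (norm c)\<^sup>2" for n
  proof -
    have "(hnorm H (psum c n))\<^sup>2 \<le> B * (\<Sum>i\<in>A \<inter> {..<n}. (cmod (coord c i))\<^sup>2)"
      unfolding psum_def by (rule upper) auto
    also have "\<dots> \<le> B * (\<Sum>i<n. (cmod (coord c i))\<^sup>2)"
      using B_nonneg by (intro mult_left_mono sum_mono2) auto
    also have "\<dots> \<le> B * (norm c)\<^sup>2" using B_nonneg by (intro mult_left_mono sum_coord_le)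
    finally show ?thesis .
  qed
  then show "\<exists>N. \<forall>n\<ge>N. (hnorm H (psum c n))\<^sup>2 \<le> B * (norm c)\<^sup>2" by blast
qed

lemma syn_lower:
  assumes c: "c \<in> supported_on A" shows "m * (norm c)\<^sup>2 \<le> (hnorm H (syn c))\<^sup>2"
proof (rule LIMSEQ_le)
  show "(\<lambda>n. (hnorm H (psum c n))\<^sup>2) \<longlonglongrightarrow> (hnorm H (syn c))\<^sup>2"
    by (intro tendsto_power hlim_norm hlim_syn)
  show "(\<lambda>n. m * (\<Sum>i<n. (cmod (coord c i))\<^sup>2)) \<longlonglongrightarrow> m * (norm c)\<^sup>2"
    unfolding norm_ell2_square by (intro tendsto_mult_left summable_LIMSEQ summable_coord)
  have "m * (\<Sum>i<n. (cmod (coord c i))\<^sup>2) \<le> (hnorm H (psum c n))\<^sup>2" for n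
  proof -
    have "(\<Sum>i<n. (cmod (coord c i))\<^sup>2) = (\<Sum>i\<in>A \<inter> {..<n}. (cmod (coord c i))\<^sup>2)"
      using c by (intro sum.mono_neutral_right) (auto simp: supported_on_def)
    then show ?thesis using lower[of "A \<inter> {..<n}" "coord c"] by (simp add: psum_def)
  qed
  then show "\<exists>N. \<forall>n\<ge>N. m * (\<Sum>i<n. (cmod (coord c i))\<^sup>2) \<le> (hnorm H (psum c n))\<^sup>2" by blast
qed

lemma inj_on_syn: "inj_on syn (supported_on A)"
proof (rule inj_onI)
  fix c d assume cd: "c \<in> supported_on A" "d \<in> supported_on A" "syn c = syn d"
  then have "hnorm H (syn (c - d)) = 0" by (simp add: syn_diff)
  then have "m * (norm (c - d))\<^sup>2 \<le> 0" using syn_lower[OF supported_on_closed(2)[OF cd(1,2)]] by simp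
  then show "c = d" using m_pos by (simp add: mult_le_0_iff)
qed

text \<open>\<open>X\<close> is arbitrary because spans of initial segments are described in the
  same way, with \<open>X = A \<inter> {..n}\<close>.\<close>

lemma syn_image_subspace: "is_subspace (syn ` supported_on X)"
  unfolding is_subspace_def
proof (intro conjI ballI allI)
  have "syn 0 = \<zero>" using syn_csc[of 0 0] smult_l_null[of "syn 0"] by simp
  then show "\<zero> \<in> syn ` supported_on X" using supported_on_closed(4) by (metis imageI)
  fix x assume "x \<in> syn ` supported_on X"
  then obtain c where c: "c \<in> supported_on X" "x = syn c" by blast
  show "a \<odot> x \<in> syn ` supported_on X" for a
    using supported_on_closed(3)[OF c(1), of a] unfolding c(2) by (metis imageI syn_csc)
  fix y assume "y \<in> syn ` supported_on X"
  then obtain d where d: "d \<in> supported_on X" "y = syn d" by blast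
  show "x \<oplus> y \<in> syn ` supported_on X"
    using supported_on_closed(1)[OF c(1) d(1)] unfolding c(2) d(2) by (metis imageI syn_add)
qed auto

text \<open>The range of the synthesis operator is closed: along a convergent sequence of values the
  lower bound makes the coefficients Cauchy, and the upper bound identifies the limit as the value
  at their limit. Conversely, each value is the limit of its partial sums.\<close>

lemma closed_hspan_eq_image: "closed_hspan H (f ` A) = syn ` supported_on A"
proof (rule subset_antisym; rule subsetI)
  have fA: "f ` A \<subseteq> carrier H" using in_carrier by auto
  have "f ` A \<subseteq> syn ` supported_on A"
    using syn_unit supported_on_closed(5) by (metis image_subsetI imageI)
  then have sp: "hspan H (f ` A) \<subseteq> syn ` supported_on A"
    by (rule hspan_mono_subspace[OF syn_image_subspace])
  fix y
  assume "y \<in> closed_hspan H (f ` A)"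
  then obtain \<sigma> where \<sigma>: "\<And>n. \<sigma> n \<in> hspan H (f ` A)" "hlim \<sigma> y" by (auto simp: closed_hspan_eq[OF fA])
  have "\<forall>n. \<exists>c. c \<in> supported_on A \<and> \<sigma> n = syn c" using sp \<sigma>(1) by blast
  then obtain c where c: "\<And>n. c n \<in> supported_on A" "\<And>n. \<sigma> n = syn (c n)" by metis
  have "Cauchy c"
  proof (rule metric_CauchyI)
    fix e :: real assume e: "e > 0"
    then have "sqrt m * e > 0" using m_pos by simp
    then obtain M where M: "\<And>k n. M \<le> k \<Longrightarrow> M \<le> n \<Longrightarrow> hnorm H (\<sigma> k \<ominus> \<sigma> n) < sqrt m * e"
      using hlim_imp_hcauchy[OF \<sigma>(2)] unfolding hcauchy_def by blast
    have "dist (c k) (c n) < e" if "M \<le> k" "M \<le> n" for k n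
    proof -
      have "m * (norm (c k - c n))\<^sup>2 \<le> (hnorm H (\<sigma> k \<ominus> \<sigma> n))\<^sup>2"
        using syn_lower[OF supported_on_closed(2)[OF c(1) c(1)], of k n] by (simp add: syn_diff c(2))
      also have "\<dots> < (sqrt m * e)\<^sup>2"
        using M[OF that] by (intro power_strict_mono) (auto simp: c(2))
      finally have "(norm (c k - c n))\<^sup>2 < e\<^sup>2" using m_pos by (simp add: power_mult_distrib)
      then show ?thesis unfolding dist_norm by (rule power_less_imp_less_base) (use e in simp)
    qed
    then show "\<exists>M. \<forall>k\<ge>M. \<forall>n\<ge>M. dist (c k) (c n) < e" by blast
  qed
  then have "convergent c" by (rule Cauchy_convergent)
  then obtain d where d: "c \<longlonglongrightarrow> d" unfolding convergent_def by blast
  have dA: "d \<in> supported_on A" by (rule supported_on_lim[OF c(1) d])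
  have lim: "(\<lambda>n. sqrt B * norm (c n - d)) \<longlonglongrightarrow> 0"
    using tendsto_norm_zero[OF LIM_zero[OF d]] by (rule tendsto_mult_right_zero)
  have "norm (hnorm H (\<sigma> n \<ominus> syn d)) \<le> sqrt B * norm (c n - d)" for n
  proof -
    have "hnorm H (\<sigma> n \<ominus> syn d) \<le> sqrt B * norm (c n - d)"
    proof (rule power2_le_imp_le)
      show "(hnorm H (\<sigma> n \<ominus> syn d))\<^sup>2 \<le> (sqrt B * norm (c n - d))\<^sup>2"
        using syn_upper[of "c n - d"] B_nonneg by (simp add: power_mult_distrib syn_diff c(2))
    qed (use B_nonneg in simp)
    then show ?thesis by (simp add: c(2))
  qed
  then have "(\<lambda>n. hnorm H (\<sigma> n \<ominus> syn d)) \<longlonglongrightarrow> 0"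
    by (rule Lim_null_comparison[OF always_eventually[OF allI] lim])
  then have "hlim \<sigma> (syn d)" by (simp add: hlim_def c(2))
  then have "y = syn d" by (rule hlim_unique[OF \<sigma>(2)])
  then show "y \<in> syn ` supported_on A" using dA by blast
next
  have fA: "f ` A \<subseteq> carrier H" using in_carrier by auto
  fix y assume "y \<in> syn ` supported_on A"
  then obtain c where c: "y = syn c" by blast
  have "psum c n \<in> hspan H (f ` A)" for n
    unfolding psum_def using hspan_subspace[OF fA] by (intro lin_subspace) auto
  then show "y \<in> closed_hspan H (f ` A)"
    unfolding closed_hspan_eq[OF fA] c using hlim_syn[of c] by (intro CollectI exI[of _ "psum c"]) simp
qed

lemma coeffs:
  assumes "x \<in> closed_hspan H (f ` A)"
  shows "coeffs x \<in> supported_on A" "syn (coeffs x) = x"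
  using inv_into_into[of x syn "supported_on A"] f_inv_into_f[of x syn "supported_on A"] assms
  unfolding closed_hspan_eq_image coeffs_def by auto

lemma coeffs_syn: "c \<in> supported_on A \<Longrightarrow> coeffs (syn c) = c"
  unfolding coeffs_def by (rule inv_into_f_f[OF inj_on_syn])

end

text \<open>This operator replaces \<open>f i\<close> by \<open>g i\<close> in every expansion. The
  upper bound of \<open>g\<close> and the lower bound of \<open>f\<close> control its norm;
  exchanging the families gives the inverse.\<close>

lemma riesz_transfer_operator:
  fixes H :: "'a inner_space" (structure)
  assumes F: "riesz_family H f A m B" and G: "riesz_family H g A m' B'"
    and K: "closed_hspan H (f ` A) = K" "closed_hspan H (g ` A) = K"
  shows "bounded_operator (H\<lparr>carrier := K\<rparr>) (\<lambda>x. riesz_family.syn H g A (riesz_family.coeffs H f A x))"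
proof -
  interpret F: riesz_family H f A m B by fact
  interpret G: riesz_family H g A m' B' by fact
  note Fc = F.coeffs[unfolded K]
  have GK: "G.syn c \<in> K" if "c \<in> supported_on A" for c
    using that G.closed_hspan_eq_image K by auto
  have add: "F.coeffs (x \<oplus> y) = F.coeffs x + F.coeffs y" if "x \<in> K" "y \<in> K" for x y
    using F.coeffs_syn[OF supported_on_closed(1)[OF Fc(1)[OF that(1)] Fc(1)[OF that(2)]]]
    by (simp add: F.syn_add Fc that)
  have smult: "F.coeffs (a \<odot> x) = csc a (F.coeffs x)" if "x \<in> K" for a x
    using F.coeffs_syn[OF supported_on_closed(3)[OF Fc(1)[OF that]]]
    by (simp add: F.syn_csc Fc that)
  have hn: "hnorm (H\<lparr>carrier := K\<rparr>) = hnorm H" by (simp add: hnorm_def fun_eq_iff)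
  have bd: "hnorm H (G.syn (F.coeffs x)) \<le> sqrt (B' / m) * hnorm H x" if "x \<in> K" for x
  proof (rule power2_le_imp_le)
    have "m * (norm (F.coeffs x))\<^sup>2 \<le> (hnorm H x)\<^sup>2" using F.syn_lower[OF Fc(1)[OF that]] Fc(2)[OF that] by simp
    then have "(norm (F.coeffs x))\<^sup>2 \<le> (hnorm H x)\<^sup>2 / m" using F.m_pos by (simp add: pos_le_divide_eq mult.commute)
    then have "B' * (norm (F.coeffs x))\<^sup>2 \<le> B' * ((hnorm H x)\<^sup>2 / m)" by (rule mult_left_mono[OF _ G.B_nonneg])
    with G.syn_upper[of "F.coeffs x"] have "(hnorm H (G.syn (F.coeffs x)))\<^sup>2 \<le> B' * ((hnorm H x)\<^sup>2 / m)" by linarith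
    also have "\<dots> = (sqrt (B' / m) * hnorm H x)\<^sup>2"
      using F.m_pos G.B_nonneg by (simp add: power_mult_distrib)
    finally show "(hnorm H (G.syn (F.coeffs x)))\<^sup>2 \<le> (sqrt (B' / m) * hnorm H x)\<^sup>2" .
    have "x \<in> carrier H" using Fc(2)[OF that] F.syn_closed by metis
    then show "0 \<le> sqrt (B' / m) * hnorm H x" using F.m_pos G.B_nonneg by simp
  qed
  have "\<exists>C. \<forall>x\<in>K. hnorm H (G.syn (F.coeffs x)) \<le> C * hnorm H x" using bd by blast
  then show ?thesis
    unfolding bounded_operator_def hn
    using GK Fc(1) add smult by (simp add: G.syn_add G.syn_csc)
qed


section \<open>Gram--Schmidt orthonormalization\<close>

context prehilbert
begin

lemma subspace_minus: "is_subspace N \<Longrightarrow> x \<in> N \<Longrightarrow> y \<in> N \<Longrightarrow> x \<ominus> y \<in> N"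
  by (auto simp: is_subspace_def a_minus_def uminus_eq_smult subset_eq)

text \<open>The last two clauses relate the families in both directions: \<open>f n\<close> lies in
  the span of the \<open>e k\<close> with \<open>k \<le> n\<close>, and, inductively,
  \<open>e n\<close> in the span of the \<open>f k\<close> with \<open>k \<le> n\<close>.\<close>

definition orthonormalization :: "(nat \<Rightarrow> 'a) \<Rightarrow> (nat \<Rightarrow> 'a) \<Rightarrow> bool" where
  "orthonormalization f e \<longleftrightarrow> (\<forall>n. e n \<in> carrier H) \<and> (\<forall>i j. i \<noteq> j \<longrightarrow> cinner H (e i) (e j) = 0) \<and>
    (\<forall>n. e n = \<zero> \<or> cinner H (e n) (e n) = 1) \<and>
    (\<forall>n. f n = lin (\<lambda>k. cinner H (f n) (e k)) e {..n}) \<and>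
    (\<forall>n. \<exists>t. e n = t \<odot> (f n \<ominus> lin (\<lambda>k. cinner H (f n) (e k)) e {..<n}))"

lemma orthonormalizationD:
  assumes "orthonormalization f e"
  shows "e n \<in> carrier H" "i \<noteq> j \<Longrightarrow> cinner H (e i) (e j) = 0"
    "e n = \<zero> \<or> cinner H (e n) (e n) = 1"
    "lin (\<lambda>k. cinner H (f n) (e k)) e {..n} = f n"
    "\<exists>t. e n = t \<odot> (f n \<ominus> lin (\<lambda>k. cinner H (f n) (e k)) e {..<n})"
  using assms unfolding orthonormalization_def by simp_all

text \<open>A vector that depends linearly on its predecessors is turned into \<open>\<zero>\<close>.\<close>

lemma gram_schmidt:
  assumes f: "\<And>n. f n \<in> carrier H"
  shows "\<exists>e. orthonormalization f e"
proof -
  define Q where "Q e n r \<longleftrightarrow> r \<in> carrier H \<and> (\<forall>k<n. cinner H r (e k) = 0) \<and> (r = \<zero> \<or> cinner H r r = 1) \<and>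
    f n = cinner H (f n) r \<odot> r \<oplus> lin (\<lambda>k. cinner H (f n) (e k)) e {..<n} \<and>
    (\<exists>t. r = t \<odot> (f n \<ominus> lin (\<lambda>k. cinner H (f n) (e k)) e {..<n}))" for e n r
  \<comment> \<open>A choice must exist for every \<open>e\<close>, also for one that is not
    orthonormal so far. The premise makes \<open>P\<close> vacuous then; for the sequence finally
    chosen it holds by induction.\<close>
  define P where "P e n r \<longleftrightarrow> (\<forall>k<n. e k \<in> carrier H) \<and>
      (\<forall>i<n. (\<forall>j<i. cinner H (e i) (e j) = 0) \<and> (e i = \<zero> \<or> cinner H (e i) (e i) = 1)) \<longrightarrow> Q e n r" for e n r
  have QD: "r \<in> carrier H" "\<And>k. k < n \<Longrightarrow> cinner H r (e k) = 0" "r = \<zero> \<or> cinner H r r = 1"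
    "cinner H (f n) r \<odot> r \<oplus> lin (\<lambda>k. cinner H (f n) (e k)) e {..<n} = f n"
    "\<exists>t. r = t \<odot> (f n \<ominus> lin (\<lambda>k. cinner H (f n) (e k)) e {..<n})" if "Q e n r" for e n r
    using that unfolding Q_def by simp_all
  have "\<exists>e. \<forall>n. P e n (e n)"
  proof (rule dependent_wellorder_choice)
    fix r and e g :: "nat \<Rightarrow> 'a" and n :: nat
    assume eq: "\<And>k. k < n \<Longrightarrow> e k = g k"
    show "P e n r = P g n r"
    proof (cases "\<forall>k<n. e k \<in> carrier H")
      case True
      have "lin (\<lambda>k. cinner H (f n) (e k)) e {..<n} = lin (\<lambda>k. cinner H (f n) (g k)) g {..<n}"
        unfolding lin_def using True eq by (intro M.finsum_cong') auto
      then have "Q e n r = Q g n r" unfolding Q_def using eq by simp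
      moreover have "(\<forall>k<n. e k \<in> carrier H) = (\<forall>k<n. g k \<in> carrier H)" using eq by simp
      moreover have "(\<forall>i<n. (\<forall>j<i. cinner H (e i) (e j) = 0) \<and> (e i = \<zero> \<or> cinner H (e i) (e i) = 1)) =
        (\<forall>i<n. (\<forall>j<i. cinner H (g i) (g j) = 0) \<and> (g i = \<zero> \<or> cinner H (g i) (g i) = 1))"
        using eq by simp
      ultimately show ?thesis unfolding P_def by simp
    qed (use eq in \<open>auto simp: P_def\<close>)
  next
    fix n :: nat and e :: "nat \<Rightarrow> 'a"
    show "\<exists>r. P e n r"
    proof (cases "(\<forall>k<n. e k \<in> carrier H) \<and>
      (\<forall>i<n. (\<forall>j<i. cinner H (e i) (e j) = 0) \<and> (e i = \<zero> \<or> cinner H (e i) (e i) = 1))")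
      case True
      then have c: "\<And>k. k < n \<Longrightarrow> e k \<in> carrier H"
        and o': "\<And>i j. i < n \<Longrightarrow> j < i \<Longrightarrow> cinner H (e i) (e j) = 0"
        and n: "\<And>i. i < n \<Longrightarrow> e i = \<zero> \<or> cinner H (e i) (e i) = 1" by auto
      have o: "cinner H (e i) (e j) = 0" if "i < n" "j < n" "i \<noteq> j" for i j
        using o'[of i j] o'[of j i] cinner_commute[of "e j" "e i"] c that by (cases "j < i") auto
      define L where "L = lin (\<lambda>k. cinner H (f n) (e k)) e {..<n}"
      have L: "L \<in> carrier H" unfolding L_def using c by (intro lin_closed) auto
      define g where "g = f n \<ominus> L"
      have g: "g \<in> carrier H" unfolding g_def using f L by simp
      have ge: "cinner H g (e k) = 0" if "k < n" for k
      proof -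
        have "cinner H L (e k) = (\<Sum>i<n. cinner H (f n) (e i) * cinner H (e i) (e k))"
          unfolding L_def using c that by (intro cinner_lin_left) auto
        also have "\<dots> = (\<Sum>i<n. if i = k then cinner H (f n) (e k) * cinner H (e k) (e k) else 0)"
          using o that by (intro sum.cong) auto
        \<comment> \<open>Holds for \<open>e k = \<zero>\<close> as well, when both sides are
          0.\<close>
        also have "\<dots> = cinner H (f n) (e k)"
          using n[OF that] f that c[OF that] by auto
        finally show ?thesis unfolding g_def using f L c[OF that] by (simp add: cinner_diff_left)
      qed
      define t where "t = complex_of_real (1 / hnorm H g)"
      define r where "r = t \<odot> g"
      have r: "r \<in> carrier H" unfolding r_def using g by simp
      have re: "cinner H r (e k) = 0" if "k < n" for k
        unfolding r_def using ge[OF that] c[OF that] g by (simp add: cinner_smult_left)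
      have Lr: "cinner H L r = 0"
      proof -
        have "cinner H L r = (\<Sum>i<n. cinner H (f n) (e i) * cinner H (e i) r)"
          unfolding L_def using c r by (intro cinner_lin_left) auto
        also have "\<dots> = 0" using re c r cinner_commute[of r] by (intro sum.neutral) auto
        finally show ?thesis .
      qed
      have fg: "f n = g \<oplus> L" unfolding g_def
        by (rule cinner_eqI) (use f L in \<open>auto simp: cinner_add_left cinner_diff_left\<close>)
      have "Q e n r"
      proof (cases "g = \<zero>")
        case True
        then have "r = \<zero>" by (simp add: r_def)
        moreover have "f n = L" using fg L True by simp
        ultimately show ?thesis
          unfolding Q_def using L c f by (auto simp: L_def[symmetric] intro!: exI[of _ 0])
      next
        case False
        then have hg: "hnorm H g \<noteq> 0" using g by simp
        note gg = cinner_self[OF g]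
        have rr: "cinner H r r = 1"
          unfolding r_def t_def using g hg by (simp add: cinner_smult_left cinner_smult_right gg power2_eq_square)
        have "cinner H (f n) r = cinner H g r" unfolding fg using g L r Lr by (simp add: cinner_add_left)
        also have "\<dots> = complex_of_real (hnorm H g)"
          unfolding r_def t_def using g hg by (simp add: cinner_smult_right gg power2_eq_square)
        finally have fr: "cinner H (f n) r = complex_of_real (hnorm H g)" .
        define s where "s = cinner H (f n) r"
        have "s * t = 1" using hg by (simp add: s_def fr t_def)
        then have "s \<odot> (t \<odot> g) = g"
          using g smult_assoc1[of s t g] smult_one[of g] by simp
        then have "f n = cinner H (f n) r \<odot> r \<oplus> L"
          unfolding s_def[symmetric] r_def[symmetric] using fg by simp
        moreover have "r = t \<odot> (f n \<ominus> L)" by (simp only: r_def g_def)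
        ultimately show ?thesis
          unfolding Q_def L_def[symmetric] using r re rr by blast
      qed
      then show ?thesis unfolding P_def by blast
    qed (auto simp: P_def)
  qed
  then obtain e where e: "\<And>n. P e n (e n)" by blast
  have Q: "Q e n (e n)" for n
  proof (induction n rule: less_induct)
    case (less n)
    have "(\<forall>k<n. e k \<in> carrier H) \<and>
      (\<forall>i<n. (\<forall>j<i. cinner H (e i) (e j) = 0) \<and> (e i = \<zero> \<or> cinner H (e i) (e i) = 1))"
    proof (intro conjI allI impI)
      show "e k \<in> carrier H" if "k < n" for k by (rule QD(1)[OF less[OF that]])
      show "cinner H (e i) (e j) = 0" if "i < n" "j < i" for i j by (rule QD(2)[OF less[OF that(1)] that(2)])
      show "e i = \<zero> \<or> cinner H (e i) (e i) = 1" if "i < n" for i by (rule QD(3)[OF less[OF that]])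
    qed
    then show ?case using e[of n] unfolding P_def by (rule rev_mp)
  qed
  have c: "e n \<in> carrier H" for n using QD(1)[OF Q] .
  have o: "cinner H (e i) (e j) = 0" if "i \<noteq> j" for i j
    using QD(2)[OF Q, of j i] QD(2)[OF Q, of i j] cinner_commute[OF c[of j] c[of i]] that
    by (cases "j < i") auto
  have "f n = lin (\<lambda>k. cinner H (f n) (e k)) e {..n}" for n
  proof -
    have "{..n} = insert n {..<n}" by auto
    then have "lin (\<lambda>k. cinner H (f n) (e k)) e {..n} =
        cinner H (f n) (e n) \<odot> e n \<oplus> lin (\<lambda>k. cinner H (f n) (e k)) e {..<n}"
      using lin_insert[of "{..<n}" n e] c by simp
    then show ?thesis by (simp only: QD(4)[OF Q])
  qed
  moreover have "e n = \<zero> \<or> cinner H (e n) (e n) = 1" "\<exists>t. e n = t \<odot> (f n \<ominus> lin (\<lambda>k. cinner H (f n) (e k)) e {..<n})" for n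
    using QD(3,5)[OF Q[of n]] by blast+
  ultimately show ?thesis unfolding orthonormalization_def using c o by (intro exI[of _ e]) simp
qed

text \<open>For families padded with zero vectors outside an index set: the padding stays
  zero.\<close>

lemma orthonormalization_zero:
  assumes E: "orthonormalization g e" and n: "g n = \<zero>" shows "e n = \<zero>"
proof -
  note e = orthonormalizationD(1)[OF E]
  have "lin (\<lambda>k. cinner H (g n) (e k)) e {..<n} = \<zero>"
    by (rule cinner_eqI) (use e n in \<open>auto simp: cinner_lin_left\<close>)
  then show ?thesis using orthonormalizationD(5)[OF E, of n] n by auto
qed

text \<open>The coordinates of \<open>f i\<close> in the orthonormalized system form a finitely
  supported sequence, and finite expansions preserve inner products. Outside \<open>J\<close>, where
  nothing is prescribed, unit vectors are put so that the full family can remain Bessel and bounded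
  below.\<close>

lemma gram_realization:
  assumes f: "f \<in> J \<rightarrow> carrier H"
  obtains a :: "nat \<Rightarrow> ell2" where "\<And>i j. i \<in> J \<Longrightarrow> j \<in> J \<Longrightarrow> cip (a i) (a j) = cinner H (f i) (f j)"
    "\<And>i. i \<notin> J \<Longrightarrow> a i = ell2_unit i"
proof -
  define g where "g i = (if i \<in> J then f i else \<zero>)" for i
  have g: "g i \<in> carrier H" for i using f by (auto simp: g_def)
  obtain e where E: "orthonormalization g e" using gram_schmidt[of g] g by blast
  note e = orthonormalizationD(1,2)[OF E] and ge = orthonormalizationD(4)[OF E]
  define a where "a n = (\<Sum>k\<in>{..n}. csc (cinner H (g n) (e k)) (ell2_unit k))" for n
  have a: "coord (a n) k = cinner H (g n) (e k)" for n k
  \<comment> \<open>Past index \<open>n\<close> the coefficient is 0, since \<open>g n\<close> is a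
    combination of the \<open>e i\<close> with \<open>i \<le> n\<close>.\<close>
  proof (cases "k \<le> n")
    case False
    have "coord (a n) k = 0" unfolding a_def by (subst coord_finite_combination) (use False in auto)
    have "cinner H (g n) (e k) = cinner H (lin (\<lambda>k. cinner H (g n) (e k)) e {..n}) (e k)"
      by (simp only: ge[of n])
    also have "\<dots> = (\<Sum>i\<le>n. cinner H (g n) (e i) * cinner H (e i) (e k))"
      using e(1) by (intro cinner_lin_left) auto
    also have "\<dots> = 0" using e(2) False by (intro sum.neutral) auto
    finally show ?thesis using \<open>coord (a n) k = 0\<close> by simp
  next
    case True
    then show ?thesis unfolding a_def by (subst coord_finite_combination) auto
  qed
  have "cip (a i) (a j) = cinner H (g i) (g j)" for i j
  proof -
    have "cip (a i) (a j) = (\<Sum>k\<le>j. cnj (cinner H (g j) (e k)) * cinner H (g i) (e k))"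
      by (subst a_def[of j]) (simp add: cip_sum_right cip_csc_right a)
    also have "\<dots> = cinner H (g i) (lin (\<lambda>k. cinner H (g j) (e k)) e {..j})"
      using e(1) g by (simp add: cinner_lin_right)
    also have "\<dots> = cinner H (g i) (g j)" by (simp only: ge[of j])
    finally show ?thesis .
  qed
  then show thesis
    using that[of "\<lambda>i. if i \<in> J then a i else ell2_unit i"] by (simp add: g_def)
qed

end

text \<open>Gram--Schmidt supplies an orthonormal basis of the closed span that is indexed by
  \<open>A\<close> itself. The transfer operators between this basis and \<open>f\<close> are
  bounded and inverse to each other.\<close>

lemma (in hilbert_space) riesz_if_gram_bounds:
  assumes f: "f \<in> A \<rightarrow> carrier H" and m: "m > 0" and B: "B \<ge> 0"
    and low: "gram_lower (\<lambda>i j. cinner H (f i) (f j)) A m"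
    and up: "gram_upper (\<lambda>i j. cinner H (f i) (f j)) A B"
  shows "riesz_basic_sequence H A f"
proof -
  have hl: "(hnorm H (lin c f F))\<^sup>2 = gram_form (\<lambda>i j. cinner H (f i) (f j)) c F" if "finite F" "F \<subseteq> A" for F c
    using that f by (intro hnorm_lin) auto
  interpret F: riesz_family H f A m B
  proof
    show "i \<in> A \<Longrightarrow> f i \<in> carrier H" for i using f by auto
    show "m * (\<Sum>i\<in>F. (cmod (c i))\<^sup>2) \<le> (hnorm H (lin c f F))\<^sup>2" if "finite F" "F \<subseteq> A" for F c
      using low hl[OF that] that unfolding gram_lower_def by simp
    show "(hnorm H (lin c f F))\<^sup>2 \<le> B * (\<Sum>i\<in>F. (cmod (c i))\<^sup>2)" if "finite F" "F \<subseteq> A" for F c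
      using up hl[OF that] that unfolding gram_upper_def by simp
  qed (fact m B)+
  have fA: "f ` A \<subseteq> carrier H" using f by auto
  note sp = hspan_subspace[OF fA]
  define g where "g i = (if i \<in> A then f i else \<zero>)" for i
  have g: "g i \<in> carrier H" for i using f by (auto simp: g_def)
  obtain e where E: "orthonormalization g e" using gram_schmidt[of g] g by blast
  note e = orthonormalizationD(1,2)[OF E] and e1 = orthonormalizationD(3)[OF E]
    and ge = orthonormalizationD(4)[OF E] and et = orthonormalizationD(5)[OF E]
  \<comment> \<open>The span of the \<open>f i\<close> with \<open>i \<in> A\<close> and
    \<open>i \<le> n\<close>, described by coefficient sequences so that injectivity of
    \<open>F.syn\<close> detects linear dependence.\<close>
  define N where "N n = F.syn ` supported_on (A \<inter> {..n})" for n :: nat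
  have Nsub: "is_subspace (N n)" for n unfolding N_def by (rule F.syn_image_subspace)
  have Nmono: "N k \<subseteq> N n" if "k \<le> n" for k n
    unfolding N_def using that by (intro image_mono supported_on_mono) auto
  \<comment> \<open>Used for the increasing spans \<open>N n\<close> and for the constant chain
    given by the span of the whole family.\<close>
  have induct: "e n \<in> V n" if V: "\<And>n. is_subspace (V n)" "\<And>n k. k \<le> n \<Longrightarrow> V k \<subseteq> V n" "\<And>n. g n \<in> V n" for n and V :: "nat \<Rightarrow> 'a set"
  proof (induction n rule: less_induct)
    case (less n)
    have "lin (\<lambda>k. cinner H (g n) (e k)) e {..<n} \<in> V n"
      using less V(2) by (intro lin_subspace[OF V(1)]) (auto intro: less_imp_le)
    then have "g n \<ominus> lin (\<lambda>k. cinner H (g n) (e k)) e {..<n} \<in> V n"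
      by (rule subspace_minus[OF V(1) V(3)])
    moreover obtain t where "e n = t \<odot> (g n \<ominus> lin (\<lambda>k. cinner H (g n) (e k)) e {..<n})" using et by blast
    ultimately show ?case using V(1)[of n] by (simp add: is_subspace_def)
  qed
  have gN: "g n \<in> N n" for n
  proof (cases "n \<in> A")
    case True
    then have "g n = F.syn (ell2_unit n)" by (simp add: F.syn_unit g_def)
    then show ?thesis unfolding N_def using True by (auto intro!: supported_on_closed(5))
  next
    case False then show ?thesis using Nsub[of n] by (simp add: g_def is_subspace_def)
  qed
  have eN: "e n \<in> N n" for n by (rule induct[OF Nsub Nmono gN])
  have espan: "e n \<in> hspan H (f ` A)" for n
  proof (rule induct[of "\<lambda>_. hspan H (f ` A)", OF sp(1) order_refl])
    show "g n \<in> hspan H (f ` A)" for n using sp by (auto simp: g_def is_subspace_def)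
  qed
  have e_off: "e n = \<zero>" if "n \<notin> A" for n
    by (rule orthonormalization_zero[OF E]) (use that in \<open>simp add: g_def\<close>)
  \<comment> \<open>If \<open>e n\<close> vanished, \<open>f n\<close> would be a combination of its
    predecessors, which contradicts uniqueness of coefficients.\<close>
  have e_on: "cinner H (e n) (e n) = 1" if n: "n \<in> A" for n
  proof (rule ccontr)
    assume "cinner H (e n) (e n) \<noteq> 1"
    then have en: "e n = \<zero>" using e1 by blast
    have sub: "is_subspace (F.syn ` supported_on (A \<inter> {..<n}))" by (rule F.syn_image_subspace)
    have "e k \<in> F.syn ` supported_on (A \<inter> {..<n})" if "k \<in> {..n}" for k
    proof (cases "k = n")
      case True then show ?thesis using en sub by (simp add: is_subspace_def)
    next
      case False
      then have "A \<inter> {..k} \<subseteq> A \<inter> {..<n}" using that by auto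
      from image_mono[OF supported_on_mono[OF this], of F.syn]
      show ?thesis using eN[of k] unfolding N_def by (rule subsetD)
    qed
    then have "g n \<in> F.syn ` supported_on (A \<inter> {..<n})"
      by (subst ge[symmetric]) (rule lin_subspace[OF sub], auto)
    then obtain c where c: "c \<in> supported_on (A \<inter> {..<n})" "f n = F.syn c" using n by (auto simp: g_def)
    have "c \<in> supported_on A" using c(1) supported_on_mono[of "A \<inter> {..<n}" A] by auto
    moreover have "F.syn c = F.syn (ell2_unit n)" using c(2) F.syn_unit[OF n] by simp
    ultimately have "c = ell2_unit n"
      using inj_onD[OF F.inj_on_syn] supported_on_closed(5)[OF n] by blast
    then have "coord c n = 1" by simp
    with c(1) show False by (simp add: supported_on_def)
  qed
  have eo: "cinner H (e i) (e j) = (if i = j then 1 else 0)" if "i \<in> A" "j \<in> A" for i j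
    using e(2)[of i j] e_on[of i] that by auto
  interpret G: riesz_family H e A 1 1
  proof
    show "1 * (\<Sum>i\<in>F. (cmod (c i))\<^sup>2) \<le> (hnorm H (lin c e F))\<^sup>2" if "finite F" "F \<subseteq> A" for F c
      using hnorm_lin_orthonormal[of F e c] e(1) eo that by (simp add: subset_eq)
    show "(hnorm H (lin c e F))\<^sup>2 \<le> 1 * (\<Sum>i\<in>F. (cmod (c i))\<^sup>2)" if "finite F" "F \<subseteq> A" for F c
      using hnorm_lin_orthonormal[of F e c] e(1) eo that by (simp add: subset_eq)
  qed (use e(1) in auto)
  have eA: "e ` A \<subseteq> carrier H" using e by auto
  note spe = hspan_subspace[OF eA]
  have "f ` A \<subseteq> hspan H (e ` A)"
  proof
    fix x assume "x \<in> f ` A"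
    then obtain n where "n \<in> A" "x = f n" by blast
    then have n: "x = g n" by (simp add: g_def)
    have "e k \<in> hspan H (e ` A)" for k
      using spe e_off[of k] by (cases "k \<in> A") (auto simp: is_subspace_def)
    then show "x \<in> hspan H (e ` A)"
      unfolding n by (subst ge[symmetric]) (rule lin_subspace[OF spe(1)], auto)
  qed
  then have "hspan H (e ` A) = hspan H (f ` A)"
    using espan by (intro subset_antisym hspan_mono_subspace sp spe) auto
  then have ce: "closed_hspan H (e ` A) = closed_hspan H (f ` A)" by (simp add: closed_hspan_def)
  define K where "K = closed_hspan H (f ` A)"
  have K: "is_subspace K" "e ` A \<subseteq> K"
    using closed_hspan_subspace[OF fA] espan unfolding K_def by auto
  define S where "S x = F.syn (G.coeffs x)" for x
  define T where "T x = G.syn (F.coeffs x)" for x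
  have ceK: "closed_hspan H (f ` A) = K" "closed_hspan H (e ` A) = K" by (simp_all add: K_def ce)
  have "bounded_operator (H\<lparr>carrier := K\<rparr>) S"
    unfolding S_def by (rule riesz_transfer_operator[OF G.riesz_family_axioms F.riesz_family_axioms ceK(2,1)])
  moreover have "bounded_operator (H\<lparr>carrier := K\<rparr>) T"
    unfolding T_def by (rule riesz_transfer_operator[OF F.riesz_family_axioms G.riesz_family_axioms ceK])
  moreover have "T (S x) = x" "S (T x) = x" if "x \<in> K" for x
  proof -
    have x: "x \<in> closed_hspan H (f ` A)" "x \<in> closed_hspan H (e ` A)" using that by (simp_all add: K_def ce)
    show "T (S x) = x" "S (T x) = x"
      by (simp_all add: S_def T_def F.coeffs[OF x(1)] G.coeffs[OF x(2)]
          F.coeffs_syn[OF G.coeffs(1)[OF x(2)]] G.coeffs_syn[OF F.coeffs(1)[OF x(1)]])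
  qed
  ultimately have "invertible_operator (H\<lparr>carrier := K\<rparr>) S"
    unfolding invertible_operator_def by auto
  \<comment> \<open>Density is asked for inside \<open>K\<close>; the closed span of the
    \<open>e i\<close> formed there agrees with the one in \<open>H\<close>, which is
    \<open>K\<close>.\<close>
  moreover have "orthonormal_basis (H\<lparr>carrier := K\<rparr>) A e"
    unfolding orthonormal_basis_def using K eo closed_hspan_restrict[OF K] ce by (auto simp: K_def)
  moreover have "S (e i) = f i" if "i \<in> A" for i
    using G.coeffs_syn[OF supported_on_closed(5)[OF that]] by (simp add: S_def G.syn_unit F.syn_unit that)
  ultimately show ?thesis
    unfolding riesz_basic_sequence_def riesz_basis_def K_def by blast
qed


section \<open>Reduction to Gram matrices\<close>

lemma ell2_gram_form:
  assumes "finite F"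
  shows "gram_form (\<lambda>i j. cip (a i) (a j)) c F = (norm (\<Sum>i\<in>F. csc (c i) (a i)))\<^sup>2"
proof -
  have "cip (\<Sum>i\<in>F. csc (c i) (a i)) (\<Sum>i\<in>F. csc (c i) (a i)) = (\<Sum>i\<in>F. \<Sum>j\<in>F. c i * cnj (c j) * cip (a i) (a j))"
    unfolding cip_sum_left cip_csc_left unfolding cip_sum_right cip_csc_right sum_distrib_left
    by (simp add: mult_ac)
  then show ?thesis unfolding cip_norm gram_form_def by (metis Re_complex_of_real)
qed

text \<open>Only lower bounds appear: for the Gram matrix of a Bessel family every block already has
  an upper bound.\<close>

definition gram_partitionable :: "(nat \<Rightarrow> nat \<Rightarrow> complex) \<Rightarrow> nat set \<Rightarrow> bool" where
  "gram_partitionable G J \<longleftrightarrow> (\<exists>\<A>. finite \<A> \<and> partition_on J \<A> \<and> (\<forall>A\<in>\<A>. \<exists>m>0. gram_lower G A m))"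

lemma gram_cong:
  assumes "\<And>i j. i \<in> J \<Longrightarrow> j \<in> J \<Longrightarrow> G i j = G' i j"
  shows "gram_upper G J B \<longleftrightarrow> gram_upper G' J B" "gram_lower G J m \<longleftrightarrow> gram_lower G' J m"
proof -
  have "gram_form G c F = gram_form G' c F" if "F \<subseteq> J" for c F
    unfolding gram_form_def using assms that by (intro arg_cong[of _ _ Re] sum.cong refl) auto
  then show "gram_upper G J B \<longleftrightarrow> gram_upper G' J B" "gram_lower G J m \<longleftrightarrow> gram_lower G' J m"
    unfolding gram_upper_def gram_lower_def by auto
qed

lemma gram_subset:
  "gram_upper G J B \<Longrightarrow> I \<subseteq> J \<Longrightarrow> gram_upper G I B"
  "gram_lower G J m \<Longrightarrow> I \<subseteq> J \<Longrightarrow> gram_lower G I m"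
  unfolding gram_upper_def gram_lower_def by blast+

text \<open>The partition is kept; only the constants of its blocks change.\<close>

lemma gram_partitionable_mono:
  assumes "gram_partitionable G J" "\<And>A m. A \<subseteq> J \<Longrightarrow> m > 0 \<Longrightarrow> gram_lower G A m \<Longrightarrow> \<exists>m>0. gram_lower G' A m"
  shows "gram_partitionable G' J"
proof -
  obtain \<A> where A: "finite \<A>" "partition_on J \<A>" "\<forall>A\<in>\<A>. \<exists>m>0. gram_lower G A m"
    using assms(1) unfolding gram_partitionable_def by blast
  have "\<exists>m>0. gram_lower G' A m" if "A \<in> \<A>" for A
  proof -
    have "A \<subseteq> J" using A(2) that by (auto simp: partition_on_def)
    then show ?thesis using assms(2) A(3) that by blast
  qed
  then show ?thesis using A unfolding gram_partitionable_def by blast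
qed

lemma gram_partitionable_cong:
  assumes "\<And>i j. i \<in> J \<Longrightarrow> j \<in> J \<Longrightarrow> G i j = G' i j" "gram_partitionable G J"
  shows "gram_partitionable G' J"
proof (rule gram_partitionable_mono[OF assms(2)])
  fix A m assume "A \<subseteq> J" "m > 0" "gram_lower G A m"
  moreover have "gram_lower G A m \<longleftrightarrow> gram_lower G' A m"
    using assms(1) \<open>A \<subseteq> J\<close> by (intro gram_cong(2)) auto
  ultimately show "\<exists>m>0. gram_lower G' A m" by blast
qed

lemma gram_partitionable_subset:
  assumes "gram_partitionable G J" "I \<subseteq> J" shows "gram_partitionable G I"
proof -
  obtain \<A> where A: "finite \<A>" "partition_on J \<A>" "\<forall>A\<in>\<A>. \<exists>m>0. gram_lower G A m"
    using assms(1) unfolding gram_partitionable_def by blast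
  \<comment> \<open>Blocks that miss \<open>I\<close> are removed, because a partition has no empty
    block.\<close>
  define \<B> where "\<B> = (\<lambda>A. A \<inter> I) ` \<A> - {{}}"
  have "finite \<B>" using A(1) by (simp add: \<B>_def)
  moreover have "partition_on I \<B>"
  proof (rule partition_onI)
    have "x \<in> \<Union>\<B>" if x: "x \<in> I" for x
    proof -
      obtain A where "A \<in> \<A>" "x \<in> A" using partition_onD1[OF A(2)] assms(2) x by blast
      then have "A \<inter> I \<in> \<B>" "x \<in> A \<inter> I" using x by (auto simp: \<B>_def)
      then show ?thesis by blast
    qed
    then show "\<Union>\<B> = I" by (auto simp: \<B>_def)
    show "disjnt p q" if "p \<in> \<B>" "q \<in> \<B>" "p \<noteq> q" for p q
      using partition_onD2[OF A(2)] that unfolding \<B>_def disjoint_def disjnt_def by auto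
  qed (auto simp: \<B>_def)
  moreover have "\<exists>m>0. gram_lower G B m" if B: "B \<in> \<B>" for B
  proof -
    obtain A where "A \<in> \<A>" "B = A \<inter> I" using B by (auto simp: \<B>_def)
    then show ?thesis using A(3) gram_subset(2)[of G A _ B] by blast
  qed
  ultimately show ?thesis unfolding gram_partitionable_def by blast
qed

lemma (in hilbert_space) riesz_partitionable_iff_gram:
  assumes bes: "bessel_sequence H J f"
  shows "riesz_partitionable H J f \<longleftrightarrow> gram_partitionable (\<lambda>i j. cinner H (f i) (f j)) J"
proof -
  have f: "f \<in> J \<rightarrow> carrier H" using bes by (simp add: bessel_sequence_def)
  obtain B where B: "B > 0" "gram_upper (\<lambda>i j. cinner H (f i) (f j)) J B"
    using gram_upper_if_bessel[OF bes] by blast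
  have "riesz_basic_sequence H A f \<longleftrightarrow> (\<exists>m>0. gram_lower (\<lambda>i j. cinner H (f i) (f j)) A m)" if "A \<subseteq> J" for A
  proof -
    have fA: "f \<in> A \<rightarrow> carrier H" using f that by auto
    show ?thesis
      using gram_bounds_if_riesz[OF _ fA] riesz_if_gram_bounds[OF fA _ less_imp_le[OF B(1)] _ gram_subset(1)[OF B(2) that]]
      by blast
  qed
  moreover have "A \<subseteq> J" if "partition_on J \<A>" "A \<in> \<A>" for A \<A>
    using that by (auto simp: partition_on_def)
  ultimately show ?thesis unfolding riesz_partitionable_def gram_partitionable_def by meson
qed

text \<open>The factor \<open>r\<close> admits a rescaled norm: it is 1 for \<open>H\<^sup>2\<close>
  and for the copy inside \<open>'a\<close>, and in (iii) it makes the containment contractive.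
  Completeness is inherited from the sequence space through \<open>g\<close>.\<close>

locale ell2_copy =
  fixes H :: "'a inner_space" (structure) and g :: "ell2 \<Rightarrow> 'a" and r :: real
  assumes carrier_eq: "carrier H = range g"
    and inj: "inj g"
    and g_add: "g x \<oplus> g y = g (x + y)"
    and g_smult: "c \<odot> g x = g (csc c x)"
    and g_zero: "\<zero> = g 0"
    and g_cinner: "cinner H (g x) (g y) = complex_of_real r * cip x y"
    and r_pos: "r > 0"
begin

lemma prehilbert: "prehilbert H"
proof (intro prehilbert.intro prehilbert_axioms.intro moduleI)
  show "cring complex_ring" by (rule cring_complex_ring)
  show "abelian_group H"
  proof (rule abelian_groupI)
    fix x assume "x \<in> carrier H"
    then obtain a where "x = g a" unfolding carrier_eq by blast
    then show "\<exists>y\<in>carrier H. y \<oplus> x = \<zero>"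
      by (intro bexI[of _ "g (- a)"]) (auto simp: carrier_eq g_add g_zero)
  qed (auto simp: carrier_eq g_add g_zero add_ac)
next
  fix x assume "x \<in> carrier H"
  then obtain a where x: "x = g a" unfolding carrier_eq by blast
  have xx: "cinner H x x = complex_of_real (r * (norm a)\<^sup>2)"
    unfolding x g_cinner cip_norm by simp
  then show "cinner H x x \<in> \<real>\<^sub>\<ge>\<^sub>0" using r_pos by (simp del: of_real_mult)
  assume "cinner H x x = 0"
  then have "a = 0" unfolding xx of_real_eq_0_iff using r_pos by simp
  then show "x = \<zero>" by (simp add: x g_zero)
next
  fix x y assume "x \<in> carrier H" "y \<in> carrier H"
  then obtain a b where x: "x = g a" "y = g b" unfolding carrier_eq by blast
  show "cinner H y x = cnj (cinner H x y)"
    unfolding x g_cinner using cip_commute[of b a] by simp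
qed (auto simp: carrier_eq g_add g_smult g_cinner csc_add cip_add_left cip_csc_left ring_distribs)

lemma hnorm_g: "hnorm H (g x) = sqrt r * norm x"
  using r_pos by (simp add: hnorm_def g_cinner cip_norm real_sqrt_mult flip: of_real_mult)

lemma minus_g: "g x \<ominus> g y = g (x - y)"
proof -
  interpret prehilbert H by (rule prehilbert)
  have "g (x - y) = g x \<oplus> (- 1) \<odot> g y" 
    unfolding g_add g_smult by (rule arg_cong[of _ _ g], rule ell2_eqI) simp
  then show ?thesis by (simp add: a_minus_def uminus_eq_smult carrier_eq)
qed

lemma hilbert_space: "hilbert_space H"
proof (rule hilbert_spaceI[OF prehilbert])
  interpret prehilbert H by (rule prehilbert)
  fix \<sigma> assume \<sigma>: "hcauchy \<sigma>"
  then have "\<forall>n. \<exists>a. \<sigma> n = g a" unfolding hcauchy_def carrier_eq by blast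
  then obtain X where X: "\<And>n. \<sigma> n = g (X n)" by metis
  have "Cauchy X"
  proof (rule metric_CauchyI)
    fix e :: real assume "e > 0"
    then have "sqrt r * e > 0" using r_pos by simp
    then obtain M where M: "\<And>m n. M \<le> m \<Longrightarrow> M \<le> n \<Longrightarrow> hnorm H (\<sigma> m \<ominus> \<sigma> n) < sqrt r * e"
      using \<sigma> unfolding hcauchy_def by blast
    have "dist (X m) (X n) < e" if "M \<le> m" "M \<le> n" for m n
      using M[OF that] r_pos by (simp add: X minus_g hnorm_g dist_norm)
    then show "\<exists>M. \<forall>m\<ge>M. \<forall>n\<ge>M. dist (X m) (X n) < e" by blast
  qed
  then have "convergent X" by (rule Cauchy_convergent)
  then obtain x where x: "X \<longlonglongrightarrow> x" unfolding convergent_def by blast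
  have "(\<lambda>n. sqrt r * norm (X n - x)) \<longlonglongrightarrow> 0"
    by (rule tendsto_mult_right_zero[OF tendsto_norm_zero[OF LIM_zero[OF x]]])
  then have "hlim \<sigma> (g x)" by (simp add: hlim_def X minus_g hnorm_g carrier_eq)
  then show "\<exists>x. hlim \<sigma> x" by blast
qed

lemma bessel_sequence_g:
  assumes b: "ell2_bessel B b" "B > 0"
  shows "bessel_sequence H UNIV (\<lambda>i. g (b i))"
  unfolding bessel_sequence_def
proof (intro conjI exI[of _ "r * B"] ballI)
  show "0 < r * B" using r_pos b(2) by simp
  fix x assume "x \<in> carrier H"
  then obtain y where x: "x = g y" unfolding carrier_eq by blast
  have fin: "(\<Sum>i\<in>F. (cmod (cinner H x (g (b i))))\<^sup>2) \<le> r * B * (hnorm H x)\<^sup>2" if "finite F" for F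
  proof -
    obtain N where N: "F \<subseteq> {..<N}" using finite_nat_bounded[OF \<open>finite F\<close>] by blast
    have "(\<Sum>i\<in>F. (cmod (cinner H x (g (b i))))\<^sup>2) = r\<^sup>2 * (\<Sum>i\<in>F. (cmod (cip y (b i)))\<^sup>2)"
      using r_pos by (simp add: x g_cinner norm_mult power_mult_distrib sum_distrib_left)
    also have "\<dots> \<le> r\<^sup>2 * (\<Sum>i<N. (cmod (cip y (b i)))\<^sup>2)"
      using N by (intro mult_left_mono sum_mono2) auto
    also have "\<dots> \<le> r\<^sup>2 * (B * (norm y)\<^sup>2)"
      using b(1) unfolding ell2_bessel_def by (intro mult_left_mono) auto
    also have "\<dots> = r * B * (hnorm H x)\<^sup>2"
      using r_pos by (simp add: x hnorm_g power_mult_distrib power2_eq_square)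
    finally show ?thesis .
  qed
  show sm: "(\<lambda>i. (cmod (cinner H x (g (b i))))\<^sup>2) summable_on UNIV"
    by (rule nonneg_bdd_above_summable_on) (use fin in \<open>auto intro!: bdd_aboveI2\<close>)
  show "(\<Sum>\<^sub>\<infinity>i. (cmod (cinner H x (g (b i))))\<^sup>2) \<le> r * B * (hnorm H x)\<^sup>2"
    by (rule infsum_le_finite_sums[OF sm fin])
qed (auto simp: carrier_eq)

end

text \<open>Extends the index set to all naturals. The added unit vectors raise the Bessel constant
  by at most 1 and have norm 1, hence the bounds \<open>B + 1\<close> and
  \<open>min \<delta> 1\<close>.\<close>

lemma bounded_below_realization:
  assumes "hilbert_space H" and J: "J \<subseteq> (UNIV :: nat set)" and f: "bounded_bessel_sequence H J f"
  obtains a B \<delta> where "ell2_bessel B a" "B > 0" "\<delta> > 0" "\<And>i. \<delta> \<le> norm (a i)"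
    "\<And>i j. i \<in> J \<Longrightarrow> j \<in> J \<Longrightarrow> cip (a i) (a j) = cinner H (f i) (f j)"
proof -
  interpret hilbert_space H by fact
  have bes: "bessel_sequence H J f" using f by (simp add: bounded_bessel_sequence_def)
  have fc: "f \<in> J \<rightarrow> carrier H" using bes by (simp add: bessel_sequence_def)
  obtain \<delta> where \<delta>: "\<delta> > 0" "\<And>i. i \<in> J \<Longrightarrow> \<delta> \<le> hnorm H (f i)"
    using f by (auto simp: bounded_bessel_sequence_def)
  obtain B where B: "B > 0" "gram_upper (\<lambda>i j. cinner H (f i) (f j)) J B"
    using gram_upper_if_bessel[OF bes] by blast
  obtain a where a: "\<And>i j. i \<in> J \<Longrightarrow> j \<in> J \<Longrightarrow> cip (a i) (a j) = cinner H (f i) (f j)"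
    "\<And>i. i \<notin> J \<Longrightarrow> a i = ell2_unit i"
    using gram_realization[OF fc] by blast
  have up: "gram_upper (\<lambda>i j. cip (a i) (a j)) J B"
    using B(2) gram_cong(1)[of J "\<lambda>i j. cip (a i) (a j)" "\<lambda>i j. cinner H (f i) (f j)"] a(1) by simp
  have "ell2_bessel (B + 1) a"
    unfolding ell2_bessel_def
  proof (intro allI)
    fix x N
    have "(\<Sum>n<N. (cmod (cip x (a n)))\<^sup>2) = (\<Sum>n\<in>{..<N} \<inter> J. (cmod (cip x (a n)))\<^sup>2) + (\<Sum>n\<in>{..<N} - J. (cmod (cip x (a n)))\<^sup>2)"
      by (subst sum.Int_Diff[of _ _ J]) auto
    also have "(\<Sum>n\<in>{..<N} \<inter> J. (cmod (cip x (a n)))\<^sup>2) \<le> B * (norm x)\<^sup>2"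
      using up B(1) by (intro sum_cip_le) (auto simp: gram_upper_def ell2_gram_form)
    also have "(\<Sum>n\<in>{..<N} - J. (cmod (cip x (a n)))\<^sup>2) = (\<Sum>n\<in>{..<N} - J. (cmod (coord x n))\<^sup>2)"
      using a(2) by (intro sum.cong) auto
    also have "\<dots> \<le> (\<Sum>n<N. (cmod (coord x n))\<^sup>2)" by (intro sum_mono2) auto
    also have "\<dots> \<le> (norm x)\<^sup>2" by (rule sum_coord_le)
    finally show "(\<Sum>n<N. (cmod (cip x (a n)))\<^sup>2) \<le> (B + 1) * (norm x)\<^sup>2" by (simp add: ring_distribs)
  qed
  moreover have "min \<delta> 1 \<le> norm (a i)" for i
  proof (cases "i \<in> J")
    case True
    have fi: "f i \<in> carrier H" using fc True by auto
    have "complex_of_real ((norm (a i))\<^sup>2) = complex_of_real ((hnorm H (f i))\<^sup>2)"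
      using a(1)[OF True True] fc True cip_norm[of "a i"] cinner_self[of "f i"] by auto
    then have "norm (a i) = hnorm H (f i)"
      unfolding of_real_eq_iff by (rule power2_eq_imp_eq) (simp_all add: fi)
    then show ?thesis using \<delta>(2)[OF True] by simp
  next
    case False
    have "norm (ell2_unit i) = 1"
      using norm_finite_combination[of "{i}" "\<lambda>_. 1"] norm_ge_zero[of "ell2_unit i"]
      by (auto simp: power2_eq_1_iff)
    then show ?thesis using a(2)[OF False] by simp
  qed
  ultimately show thesis using that[of "B + 1" a "min \<delta> 1"] B(1) \<delta>(1) a(1) by auto
qed


section \<open>The Hardy space and its kernels\<close>

text \<open>The Taylor coefficients of the Szego kernel at \<open>w\<close>: for \<open>w\<close> in
  the disk, the product of a coefficient sequence with \<open>kern w\<close> is the value of its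
  power series at \<open>w\<close>.\<close>

definition kern :: "complex \<Rightarrow> ell2" where
  "kern w = Abs_ell2 (\<lambda>n. cnj w ^ n)"

text \<open>On the disk this is the sum of the power series with coefficients
  \<open>coord a\<close>; the map is an isometry onto the Hardy space.\<close>

definition hardy_of :: "ell2 \<Rightarrow> complex \<Rightarrow> complex" where
  "hardy_of a z = (if z \<in> \<bbbD> then cip a (kern z) else 0)"

lemma coord_kern: "w \<in> \<bbbD> \<Longrightarrow> coord (kern w) n = cnj w ^ n"
proof -
  assume "w \<in> \<bbbD>"
  then have "(cmod w)\<^sup>2 < 1" by (simp add: abs_square_less_1)
  then have "summable (\<lambda>n. ((cmod w)\<^sup>2) ^ n)" by (intro summable_geometric) simp
  then have "summable (\<lambda>n. (cmod (cnj w ^ n))\<^sup>2)"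
    by (simp add: norm_power power_mult[symmetric] mult.commute)
  then show ?thesis by (simp add: kern_def Abs_ell2_inverse)
qed

lemma sums_hardy_of:
  assumes "z \<in> \<bbbD>" shows "(\<lambda>n. coord a n * z ^ n) sums hardy_of a z"
  using summable_sums[OF summable_cip[of a "kern z"]] assms
  by (simp add: hardy_of_def coord_kern cip_def)

lemma cip_kern:
  assumes "w \<in> \<bbbD>" "z \<in> \<bbbD>" shows "cip (kern w) (kern z) = 1 / (1 - z * cnj w)"
proof -
  have "cmod (z * cnj w) < 1"
    using assms mult_strict_mono'[of "cmod z" 1 "cmod w" 1] by (simp add: norm_mult)
  then have "(\<lambda>n. (z * cnj w) ^ n) sums (1 / (1 - z * cnj w))" by (rule geometric_sums)
  then have "(\<lambda>n. coord (kern w) n * cnj (coord (kern z) n)) sums (1 / (1 - z * cnj w))"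
    using assms by (simp add: coord_kern power_mult_distrib mult.commute)
  then show ?thesis unfolding cip_def by (simp add: sums_iff)
qed

lemma szego_kernel_eq: "w \<in> \<bbbD> \<Longrightarrow> szego_kernel w = hardy_of (kern w)"
  by (auto simp: szego_kernel_def hardy_of_def cip_kern fun_eq_iff)

lemma hardy_of_holomorphic: "hardy_of a holomorphic_on \<bbbD>"
  using power_series_holomorphic[of 0 1 "coord a" "hardy_of a"] sums_hardy_of by simp

lemma taylor_coeff_hardy_of: "taylor_coeff (hardy_of a) n = coord a n"
proof -
  \<comment> \<open>Convergence at one nonzero point, here 1/2, makes the radius of convergence
    positive; then the expansion at 0 is unique.\<close>
  have s: "summable (\<lambda>n. coord a n * (1/2) ^ n)"
    using sums_hardy_of[of "1/2" a] by (simp add: sums_iff)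
  have "conv_radius (coord a) \<ge> norm (1/2 :: complex)"
    by (rule conv_radius_geI[OF s])
  then have "fps_conv_radius (Abs_fps (coord a)) > 0"
    by (simp add: fps_conv_radius_def less_le_trans[of 0 "ereal (1/2)"])
  moreover have "\<forall>\<^sub>F z in nhds 0. eval_fps (Abs_fps (coord a)) z = hardy_of a z"
  proof (rule eventually_mono)
    show "\<forall>\<^sub>F z in nhds 0. z \<in> \<bbbD>" by (rule eventually_nhds_in_open) auto
    show "eval_fps (Abs_fps (coord a)) z = hardy_of a z" if "z \<in> \<bbbD>" for z
      using sums_hardy_of[OF that, of a] by (simp add: eval_fps_def sums_iff)
  qed
  ultimately have "hardy_of a has_fps_expansion Abs_fps (coord a)"
    by (simp add: has_fps_expansion_def)
  from fps_expansion_eqI[OF this] show ?thesis by (simp add: taylor_coeff_def)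
qed

lemma hardy_of_add: "hardy_of (x + y) z = hardy_of x z + hardy_of y z"
  by (simp add: hardy_of_def cip_add_left)

lemma hardy_of_csc: "hardy_of (csc c x) z = c * hardy_of x z"
  by (simp add: hardy_of_def cip_csc_left)

lemma inj_hardy_of: "inj hardy_of"
  by (rule injI, rule ell2_eqI) (metis taylor_coeff_hardy_of)

lemma carrier_hardy_space: "carrier H\<^sup>2 = range hardy_of"
proof (rule subset_antisym; rule subsetI)
  fix f assume "f \<in> carrier H\<^sup>2"
  then have f: "f holomorphic_on \<bbbD>" "\<And>z. z \<notin> \<bbbD> \<Longrightarrow> f z = 0" "summable (\<lambda>n. (cmod (taylor_coeff f n))\<^sup>2)"
    by (auto simp: hardy_space_def)
  define a where "a = Abs_ell2 (taylor_coeff f)"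
  have a: "coord a n = taylor_coeff f n" for n using f(3) by (simp add: a_def Abs_ell2_inverse)
  have "f z = hardy_of a z" for z
  proof (cases "z \<in> \<bbbD>")
    case True
    have "(\<lambda>n. coord a n * z ^ n) sums f z"
      using holomorphic_power_series[OF f(1) True] by (simp add: a taylor_coeff_def fps_expansion_def)
    then show ?thesis by (rule sums_unique2[OF _ sums_hardy_of[OF True]])
  qed (simp add: f(2) hardy_of_def)
  then show "f \<in> range hardy_of" by blast
next
  fix f assume "f \<in> range hardy_of"
  then obtain a where "f = hardy_of a" by blast
  then show "f \<in> carrier H\<^sup>2"
    using hardy_of_holomorphic summable_coord[of a]
    by (auto simp: hardy_space_def taylor_coeff_hardy_of hardy_of_def)
qed

lemma hardy_space_sel:
  "f \<oplus>\<^bsub>H\<^sup>2\<^esub> g = (\<lambda>z. f z + g z)" "c \<odot>\<^bsub>H\<^sup>2\<^esub> f = (\<lambda>z. c * f z)" "\<zero>\<^bsub>H\<^sup>2\<^esub> = (\<lambda>z. 0)"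
  "cinner H\<^sup>2 f g = (\<Sum>n. taylor_coeff f n * cnj (taylor_coeff g n))"
  by (simp_all add: hardy_space_def)

interpretation Hardy: ell2_copy "H\<^sup>2" hardy_of 1
proof
  show "\<zero>\<^bsub>H\<^sup>2\<^esub> = hardy_of 0" by (simp add: hardy_space_sel hardy_of_def fun_eq_iff)
  show "cinner H\<^sup>2 (hardy_of x) (hardy_of y) = complex_of_real 1 * cip x y" for x y
    by (simp add: hardy_space_sel taylor_coeff_hardy_of cip_def)
qed (simp_all add: carrier_hardy_space inj_hardy_of hardy_space_sel hardy_of_add hardy_of_csc fun_eq_iff)

section \<open>Normalized kernels at points tending to the boundary\<close>

definition nkern :: "complex \<Rightarrow> ell2" where
  "nkern w = (1 / norm (kern w)) *\<^sub>R kern w"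

lemma norm_kern:
  assumes "w \<in> \<bbbD>" shows "(norm (kern w))\<^sup>2 = 1 / (1 - (cmod w)\<^sup>2)" "norm (kern w) > 0"
proof -
  have "complex_of_real ((norm (kern w))\<^sup>2) = complex_of_real (1 / (1 - (cmod w)\<^sup>2))"
    unfolding cip_norm[symmetric] cip_kern[OF assms assms] by (simp add: complex_norm_square[symmetric])
  then show 1: "(norm (kern w))\<^sup>2 = 1 / (1 - (cmod w)\<^sup>2)" unfolding of_real_eq_iff .
  have "(cmod w)\<^sup>2 < 1" using assms by (simp add: abs_square_less_1)
  then have "(norm (kern w))\<^sup>2 > 0" unfolding 1 by simp
  then show "norm (kern w) > 0" by simp
qed

lemma kern_eq_nkern: "w \<in> \<bbbD> \<Longrightarrow> kern w = norm (kern w) *\<^sub>R nkern w"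
  using norm_kern(2)[of w] by (simp add: nkern_def)

lemma norm_nkern: "w \<in> \<bbbD> \<Longrightarrow> norm (nkern w) = 1"
  using norm_kern(2)[of w] by (simp add: nkern_def)

lemma cip_scaleR: "cip (r *\<^sub>R x) y = of_real r * cip x y" "cip x (r *\<^sub>R y) = of_real r * cip x y"
  by (simp_all add: scaleR_ell2_def cip_csc_left cip_csc_right)

lemma normalized_szego_kernel:
  assumes "w \<in> \<bbbD>" shows "normalized H\<^sup>2 (szego_kernel w) = hardy_of (nkern w)"
  unfolding normalized_def szego_kernel_eq[OF assms] Hardy.hnorm_g Hardy.g_smult csc_of_real nkern_def by simp

text \<open>The Gram entry of the normalized kernels at \<open>1 - p\<close> and \<open>1 - q\<close> is at most \<open>2 sqrt (q / p)\<close> for \<open>q \<le> p\<close>. The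
  exponent \<open>(Suc j)\<^sup>2\<close> makes this at most \<open>2 u\<^sub>i u\<^sub>j\<close> with a square-summable \<open>u\<close>, so that the Cauchy--Schwarz
  inequality bounds the off-diagonal part of the Gram matrix.\<close>

definition node :: "nat \<Rightarrow> complex" where
  "node j = complex_of_real (1 - (1/9) ^ (Suc j)\<^sup>2)"

lemma node_in_disk: "node j \<in> \<bbbD>"
proof -
  have "0 < (1/9 :: real) ^ (Suc j)\<^sup>2" "(1/9 :: real) ^ (Suc j)\<^sup>2 \<le> 1" by (auto intro: power_le_one)
  then have "\<bar>1 - (1/9 :: real) ^ (Suc j)\<^sup>2\<bar> < 1" by linarith
  then show ?thesis unfolding node_def by (simp only: mem_ball_0 norm_of_real)
qed

lemma cip_nkern_node_less:
  assumes "i < j"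
  shows "cmod (cip (nkern (node i)) (nkern (node j))) \<le> 2 * (1/3) ^ Suc i * (1/3) ^ Suc j"
proof -
  define p where "p = (1/9 :: real) ^ (Suc i)\<^sup>2"
  define q where "q = (1/9 :: real) ^ (Suc j)\<^sup>2"
  define t where "t = (1/3 :: real) ^ Suc i * (1/3) ^ Suc j"
  have p: "0 < p" "p \<le> 1" "0 < q" "q \<le> 1" by (auto simp: p_def q_def intro: power_le_one)
  have qp: "q \<le> p * t\<^sup>2"
  proof -
    \<comment> \<open>The difference of the squares is \<open>(j - i) * (i + j + 2)\<close>, and
      \<open>j - i \<ge> 1\<close>.\<close>
    have e: "(Suc j)\<^sup>2 \<ge> (Suc i)\<^sup>2 + (Suc i + Suc j)"
    proof -
      obtain d where d: "j = Suc (i + d)" using less_imp_Suc_add[OF assms] by blast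
      show ?thesis unfolding d by (simp add: power2_eq_square algebra_simps)
    qed
    have "q \<le> (1/9) ^ ((Suc i)\<^sup>2 + (Suc i + Suc j))"
      unfolding q_def by (rule power_decreasing[OF e]) auto
    also have "\<dots> = p * t\<^sup>2"
    proof -
      have "(1/9 :: real) ^ k = ((1/3) ^ k)\<^sup>2" for k
        by (simp add: power_mult_distrib[symmetric] power2_eq_square)
      then show ?thesis unfolding power_add p_def t_def power_mult_distrib by (simp only:)
    qed
    finally show ?thesis .
  qed
  \<comment> \<open>With nodes \<open>1 - p\<close> and \<open>1 - q\<close> this is the denominator
    \<open>1 - (1 - p) * (1 - q)\<close> of the kernel.\<close>
  define D where "D = p + q - p * q"
  have D: "D \<ge> p" using p mult_left_le_one_le[of q p] by (simp add: D_def)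
  define c where "c = cip (nkern (node i)) (nkern (node j))"
  have ni: "(norm (kern (node i)))\<^sup>2 = 1 / (p * (2 - p))" "(norm (kern (node j)))\<^sup>2 = 1 / (q * (2 - q))"
    unfolding norm_kern(1)[OF node_in_disk] unfolding node_def norm_of_real p_def[symmetric] q_def[symmetric]
    by (simp_all add: power2_eq_square algebra_simps)
  have k: "cip (kern (node i)) (kern (node j)) = complex_of_real (1 / D)"
    unfolding cip_kern[OF node_in_disk node_in_disk] unfolding node_def p_def[symmetric] q_def[symmetric] D_def
    by (simp add: algebra_simps)
  have "cmod c = (1 / D) / (norm (kern (node i)) * norm (kern (node j)))"
    unfolding c_def nkern_def cip_scaleR k using D p by (simp add: norm_mult norm_divide)
  then have "(cmod c)\<^sup>2 = (1 / D)\<^sup>2 * ((p * (2 - p)) * (q * (2 - q)))"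
    by (simp add: power_divide power_mult_distrib ni)
  \<comment> \<open>Lowers \<open>D\<close> to \<open>p\<close> and raises \<open>2 - p\<close> and
    \<open>2 - q\<close> to 2.\<close>
  also have "\<dots> \<le> (1 / p)\<^sup>2 * ((p * 2) * (q * 2))"
    using D p by (intro mult_mono power_mono frac_le mult_left_mono) auto
  also have "\<dots> = 4 * (q / p)" using p by (simp add: power2_eq_square)
  also have "\<dots> \<le> 4 * t\<^sup>2" using qp p by (simp add: pos_divide_le_eq mult.commute)
  also have "\<dots> = (2 * t)\<^sup>2" by (simp add: power_mult_distrib)
  finally have "cmod c \<le> 2 * t" by (rule power2_le_imp_le) (simp add: t_def)
  then show ?thesis by (simp add: c_def t_def mult.assoc)
qed

lemma cip_nkern_node:
  assumes "i \<noteq> j"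
  shows "cmod (cip (nkern (node i)) (nkern (node j))) \<le> 2 * (1/3) ^ Suc i * (1/3) ^ Suc j"
proof (cases "i < j")
  case False
  then have "j < i" using assms by simp
  from cip_nkern_node_less[OF this] show ?thesis
    unfolding cip_commute[of "nkern (node i)"] complex_mod_cnj by (simp only: mult_ac)
qed (rule cip_nkern_node_less)

text \<open>The Gram matrix is the identity plus an off-diagonal part dominated by the rank one
  matrix \<open>2 * u i * u j\<close>. The squares of \<open>u\<close> sum to at most 1/9 + 1/81 +
  ... = 1/8, so the perturbation is at most 2/8 = 1/4.\<close>

lemma nkern_node_riesz:
  "\<bar>(norm (\<Sum>n<N. csc (c n) (nkern (node n))))\<^sup>2 - (\<Sum>n<N. (cmod (c n))\<^sup>2)\<bar> \<le> 1/4 * (\<Sum>n<N. (cmod (c n))\<^sup>2)"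
proof -
  define b where "b n = nkern (node n)" for n
  define u where "u n = (1/3 :: real) ^ Suc n" for n
  define S where "S = (\<Sum>n<N. (cmod (c n))\<^sup>2)"
  define R where "R = (\<Sum>i<N. \<Sum>j<N. if i = j then 0 else c i * cnj (c j) * cip (b i) (b j))"
  have bb: "cip (b n) (b n) = 1" for n by (simp add: b_def cip_norm norm_nkern[OF node_in_disk])
  have "(\<Sum>i<N. \<Sum>j<N. c i * cnj (c j) * cip (b i) (b j)) =
      (\<Sum>i<N. \<Sum>j<N. (if i = j then c i * cnj (c i) else 0) + (if i = j then 0 else c i * cnj (c j) * cip (b i) (b j)))"
    by (intro sum.cong refl) (auto simp: bb)
  also have "\<dots> = complex_of_real S + R"
    unfolding S_def of_real_sum complex_norm_square by (simp add: sum.distrib sum.delta R_def)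
  finally have "(norm (\<Sum>n<N. csc (c n) (b n)))\<^sup>2 = S + Re R"
    using ell2_gram_form[of "{..<N}" b c] by (simp add: gram_form_def)
  then have "\<bar>(norm (\<Sum>n<N. csc (c n) (b n)))\<^sup>2 - S\<bar> = \<bar>Re R\<bar>" by simp
  also have "\<dots> \<le> cmod R" by (rule abs_Re_le_cmod)
  also have "\<dots> \<le> (\<Sum>i<N. \<Sum>j<N. 2 * (cmod (c i) * u i) * (cmod (c j) * u j))"
    unfolding R_def
  proof (intro order_trans[OF norm_sum] sum_mono)
    fix i j
    have u0: "u n \<ge> 0" for n by (simp add: u_def)
    show "cmod (if i = j then 0 else c i * cnj (c j) * cip (b i) (b j)) \<le> 2 * (cmod (c i) * u i) * (cmod (c j) * u j)"
    proof (cases "i = j")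
      case False
      have "cmod (c i) * cmod (c j) * cmod (cip (b i) (b j)) \<le> cmod (c i) * cmod (c j) * (2 * u i * u j)"
        using cip_nkern_node[OF False] unfolding b_def u_def by (intro mult_left_mono) auto
      then show ?thesis using False by (simp add: norm_mult mult_ac)
    qed (simp add: u0)
  qed
  also have "\<dots> = 2 * (\<Sum>i<N. cmod (c i) * u i)\<^sup>2"
    unfolding power2_eq_square sum_product unfolding sum_distrib_left by (simp only: mult.assoc)
  also have "\<dots> \<le> 2 * (S * (\<Sum>i<N. (u i)\<^sup>2))"
    unfolding S_def by (intro mult_left_mono Cauchy_Schwarz_ineq_sum) auto
  also have "\<dots> \<le> 2 * (S * (1/8))"
  proof (intro mult_left_mono)
    have "(\<Sum>i<N. (u i)\<^sup>2) = (1 - (1/9) ^ N) / 8"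
    proof (induction N)
      case (Suc N)
      have "(u N)\<^sup>2 = (1/9) ^ Suc N" by (simp add: u_def power2_eq_square power_mult_distrib[symmetric])
      then show ?case using Suc by (simp add: field_simps)
    qed simp
    then show "(\<Sum>i<N. (u i)\<^sup>2) \<le> 1/8" by simp
    show "0 \<le> S" by (simp add: S_def sum_nonneg)
  qed simp
  finally show ?thesis by (simp add: b_def S_def)
qed

lemma kernel_realization:
  assumes a: "ell2_bessel B a" "B \<ge> 0"
  obtains W K z where "bounded_clinear W" "K > 0" "\<And>x. norm x \<le> K * norm (W x)"
    "\<And>i :: nat. z i \<in> \<bbbD>" "\<And>i. adj W (nkern (z i)) = a i"
proof -
  have up: "(norm (\<Sum>n<N. csc (c n) (nkern (node n))))\<^sup>2 \<le> 5/4 * (\<Sum>n<N. (cmod (c n))\<^sup>2)" for N c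
    using nkern_node_riesz[of c N] by linarith
  have low: "3/4 * (\<Sum>n<N. (cmod (c n))\<^sup>2) \<le> (norm (\<Sum>n<N. csc (c n) (nkern (node n))))\<^sup>2" for N c
    using nkern_node_riesz[of c N] by linarith
  obtain W K where "bounded_clinear W" "K > 0" "\<And>x. norm x \<le> K * norm (W x)"
    "\<And>i. adj W (nkern (node (2 * i))) = a i"
    using riesz_realization[of "\<lambda>n. nkern (node n)" "5/4" "3/4" B a] up low a by auto
  \<comment> \<open>Nodes with even index carry the vectors \<open>a i\<close>; those with odd index
    were spent on the lower bound of \<open>W\<close>.\<close>
  then show thesis using that[of W K "\<lambda>i. node (2 * i)"] node_in_disk by blast
qed


section \<open>The equivalence\<close>

text \<open>Statement (i) is available for spaces on \<open>'a\<close>, whereas \<open>H\<close>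
  lives on another type. The Gram matrix of \<open>f\<close> is moved into the sequence space, which
  an injection of sequences copies into \<open>'a\<close>.\<close>

lemma statement_i_transfer:
  fixes H :: "'b inner_space"
  assumes univ: "(UNIV :: (nat \<Rightarrow> complex) set) \<lesssim> (UNIV :: 'a set)"
    and i: "\<And>(H :: 'a inner_space) (J :: nat set) f.
        hilbert_space H \<Longrightarrow> bounded_bessel_sequence H J f \<Longrightarrow> riesz_partitionable H J f"
    and H: "hilbert_space H" and f: "bounded_bessel_sequence H (UNIV :: nat set) f"
  shows "riesz_partitionable H UNIV f"
proof -
  interpret H: hilbert_space H by fact
  obtain a B \<delta> where a: "ell2_bessel B a" "B > 0" "\<delta> > 0" "\<And>i. \<delta> \<le> norm (a i)"
    "\<And>i j. cip (a i) (a j) = cinner H (f i) (f j)"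
    by (rule bounded_below_realization[OF H subset_UNIV f]) (rule that; (assumption | blast | simp))
  obtain \<iota> :: "(nat \<Rightarrow> complex) \<Rightarrow> 'a" where \<iota>: "inj \<iota>" using univ by (auto simp: lepoll_def)
  define g where "g x = \<iota> (coord x)" for x
  have g: "inj g" unfolding g_def using \<iota> by (intro injI) (simp add: inj_eq coord_inject)
  define H' :: "'a inner_space" where "H' = \<lparr>carrier = range g, mult = undefined, one = undefined,
    zero = g 0, add = (\<lambda>x y. g (inv_into UNIV g x + inv_into UNIV g y)), smult = (\<lambda>c x. g (csc c (inv_into UNIV g x))),
    cinner = (\<lambda>x y. cip (inv_into UNIV g x) (inv_into UNIV g y))\<rparr>"
  interpret C: ell2_copy H' g 1
    by unfold_locales (simp_all add: H'_def g inv_f_f)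
  interpret H': hilbert_space H' by (rule C.hilbert_space)
  have bes: "bessel_sequence H' UNIV (\<lambda>i. g (a i))" by (rule C.bessel_sequence_g[OF a(1,2)])
  then have "bounded_bessel_sequence H' UNIV (\<lambda>i. g (a i))"
    unfolding bounded_bessel_sequence_def using a(3,4) by (auto simp: C.hnorm_g)
  then have "riesz_partitionable H' UNIV (\<lambda>i. g (a i))" by (rule i[OF C.hilbert_space])
  then have "gram_partitionable (\<lambda>i j. cinner H (f i) (f j)) UNIV"
    unfolding H'.riesz_partitionable_iff_gram[OF bes] by (simp add: C.g_cinner a(5))
  then show ?thesis
    using H.riesz_partitionable_iff_gram f unfolding bounded_bessel_sequence_def by blast
qed

text \<open>Discards the vectors added outside \<open>J\<close> by restricting the partition to
  \<open>J\<close>.\<close>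

lemma riesz_partitionable_from_realization:
  assumes H: "hilbert_space H" and f: "bounded_bessel_sequence H J f"
    and a: "\<And>i j. i \<in> J \<Longrightarrow> j \<in> J \<Longrightarrow> cip (a i) (a j) = cinner H (f i) (f j)"
    and part: "gram_partitionable (\<lambda>i j. cip (a i) (a j)) UNIV"
  shows "riesz_partitionable H J f"
proof -
  have "gram_partitionable (\<lambda>i j. cinner H (f i) (f j)) J"
    by (rule gram_partitionable_cong[OF a gram_partitionable_subset[OF part subset_UNIV]])
  then show ?thesis
    using hilbert_space.riesz_partitionable_iff_gram[OF H] f unfolding bounded_bessel_sequence_def by blast
qed

text \<open>The adjoint moves \<open>W\<close> from the family to the vector tested against
  it.\<close>

lemma ell2_bessel_image:
  assumes b: "ell2_bessel B b" "B > 0" and W: "bounded_clinear W"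
  shows "\<exists>B'>0. ell2_bessel B' (\<lambda>i. W (b i))"
proof -
  obtain K where K: "K > 0" "\<And>x. norm (adj W x) \<le> K * norm x"
    using bounded_clinear_bound[OF bounded_clinear_adj[OF W]] by blast
  have "ell2_bessel (B * K\<^sup>2) (\<lambda>i. W (b i))"
    unfolding ell2_bessel_def
  proof (intro allI)
    fix x N
    have "cmod (cip x (W (b n))) = cmod (cip (adj W x) (b n))" for n
      using cip_adj[OF W, of "b n" x] cip_commute[of x "W (b n)"] cip_commute[of "adj W x" "b n"] by simp
    then have "(\<Sum>n<N. (cmod (cip x (W (b n))))\<^sup>2) \<le> B * (norm (adj W x))\<^sup>2"
      using b(1) by (simp add: ell2_bessel_def)
    also have "\<dots> \<le> B * (K * norm x)\<^sup>2" using b(2) K by (intro mult_left_mono power_mono) auto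
    finally show "(\<Sum>n<N. (cmod (cip x (W (b n))))\<^sup>2) \<le> B * K\<^sup>2 * (norm x)\<^sup>2"
      by (simp add: power_mult_distrib mult.assoc)
  qed
  moreover have "B * K\<^sup>2 > 0" using b(2) K by simp
  ultimately show ?thesis by blast
qed

lemma statement_i_if_statement_ii:
  fixes H :: "'a inner_space"
  assumes ii: "\<And>P (z :: nat \<Rightarrow> complex). positive_operator H\<^sup>2 P \<Longrightarrow> range z \<subseteq> \<bbbD> \<Longrightarrow>
        bounded_bessel_sequence H\<^sup>2 UNIV (\<lambda>i. P (normalized H\<^sup>2 (szego_kernel (z i)))) \<Longrightarrow>
        riesz_partitionable H\<^sup>2 UNIV (\<lambda>i. P (normalized H\<^sup>2 (szego_kernel (z i))))"
    and H: "hilbert_space H" and f: "bounded_bessel_sequence H (J :: nat set) f"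
  shows "riesz_partitionable H J f"
proof -
  interpret HS: hilbert_space "H\<^sup>2" by (rule Hardy.hilbert_space)
  obtain a B \<delta> where a: "ell2_bessel B a" "B > 0" "\<delta> > 0" "\<And>i. \<delta> \<le> norm (a i)"
    and af: "\<And>i j. i \<in> J \<Longrightarrow> j \<in> J \<Longrightarrow> cip (a i) (a j) = cinner H (f i) (f j)"
    by (rule bounded_below_realization[OF H subset_UNIV f]) (rule that; (assumption | blast | simp))
  obtain W K z where W: "bounded_clinear W" "K > 0" "\<And>x. norm x \<le> K * norm (W x)"
    and z: "\<And>i :: nat. z i \<in> \<bbbD>" "\<And>i. adj W (nkern (z i)) = a i"
    using kernel_realization[OF a(1) less_imp_le[OF a(2)]] by blast
  define V where "V x = W (adj W x)" for x
  have V: "bounded_clinear V"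
    unfolding V_def by (rule bounded_clinear_compose[OF W(1) bounded_clinear_adj[OF W(1)]])
  define P where "P h = hardy_of (V (inv_into UNIV hardy_of h))" for h
  have P: "P (hardy_of x) = hardy_of (V x)" for x by (simp add: P_def inj_hardy_of)
  obtain C where C: "C > 0" "\<And>x. norm (V x) \<le> C * norm x" using bounded_clinear_bound[OF V] by blast
  have "bounded_operator H\<^sup>2 P"
    unfolding bounded_operator_def carrier_hardy_space
    using C(2) by (auto simp: P Hardy.g_add Hardy.g_smult Hardy.hnorm_g bounded_clinear_add[OF V] bounded_clinear_csc[OF V])
  moreover have "cinner H\<^sup>2 (P h) h \<in> \<real>\<^sub>\<ge>\<^sub>0" if h: "h \<in> carrier H\<^sup>2" for h
  proof -
    obtain x where x: "h = hardy_of x" using h unfolding carrier_hardy_space by blast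
    have "cinner H\<^sup>2 (P h) h = cip (V x) x" by (simp add: x P Hardy.g_cinner)
    also have "\<dots> = complex_of_real ((norm (adj W x))\<^sup>2)"
      unfolding V_def cip_adj[OF W(1)] cip_norm ..
    finally show ?thesis by (simp del: of_real_power)
  qed
  ultimately have pos: "positive_operator H\<^sup>2 P" by (simp add: positive_operator_def)
  have Pk: "P (normalized H\<^sup>2 (szego_kernel (z i))) = hardy_of (W (a i))" for i
    unfolding normalized_szego_kernel[OF z(1)] P V_def z(2) ..
  obtain B' where B': "B' > 0" "ell2_bessel B' (\<lambda>i. W (a i))"
    using ell2_bessel_image[OF a(1,2) W(1)] by blast
  have bes: "bessel_sequence H\<^sup>2 UNIV (\<lambda>i. hardy_of (W (a i)))"
    by (rule Hardy.bessel_sequence_g[OF B'(2,1)])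
  \<comment> \<open>Here the lower bound of \<open>W\<close> enters: it keeps the image family
    bounded below.\<close>
  have "\<delta> / K \<le> hnorm H\<^sup>2 (hardy_of (W (a i)))" for i
    using order_trans[OF a(4)[of i] W(3)] W(2) by (simp add: Hardy.hnorm_g pos_divide_le_eq mult.commute)
  moreover have "\<delta> / K > 0" using a(3) W(2) by simp
  ultimately have "bounded_bessel_sequence H\<^sup>2 UNIV (\<lambda>i. hardy_of (W (a i)))"
    unfolding bounded_bessel_sequence_def using bes by blast
  then have "riesz_partitionable H\<^sup>2 UNIV (\<lambda>i. hardy_of (W (a i)))"
    using ii[OF pos, of z] z(1) unfolding Pk by blast
  then have "gram_partitionable (\<lambda>i j. cip (W (a i)) (W (a j))) UNIV"
    unfolding HS.riesz_partitionable_iff_gram[OF bes] by (simp add: Hardy.g_cinner)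
  \<comment> \<open>For the way back boundedness of \<open>W\<close> suffices: the norm of
    \<open>W s\<close> is at most \<open>L * norm s\<close>, so a lower bound \<open>m\<close> for
    the images gives the lower bound \<open>m / L\<^sup>2\<close>.\<close>
  then have part: "gram_partitionable (\<lambda>i j. cip (a i) (a j)) UNIV"
  proof (rule gram_partitionable_mono)
    fix A m assume m: "m > 0" and low: "gram_lower (\<lambda>i j. cip (W (a i)) (W (a j))) A m"
    obtain L where L: "L > 0" "\<And>x. norm (W x) \<le> L * norm x" using bounded_clinear_bound[OF W(1)] by blast
    have "m / L\<^sup>2 * (\<Sum>i\<in>F. (cmod (c i))\<^sup>2) \<le> gram_form (\<lambda>i j. cip (a i) (a j)) c F"
      if F: "finite F" "F \<subseteq> A" for F c
    proof -
      define s where "s = (\<Sum>i\<in>F. csc (c i) (a i))"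
      have "m * (\<Sum>i\<in>F. (cmod (c i))\<^sup>2) \<le> (norm (\<Sum>i\<in>F. csc (c i) (W (a i))))\<^sup>2"
        using low F unfolding gram_lower_def ell2_gram_form[OF F(1), symmetric] by blast
      also have "(\<Sum>i\<in>F. csc (c i) (W (a i))) = W s"
        by (simp add: s_def bounded_clinear_sum[OF W(1)] bounded_clinear_csc[OF W(1)])
      also have "(norm (W s))\<^sup>2 \<le> (L * norm s)\<^sup>2" by (intro power_mono L) simp
      finally have "m * (\<Sum>i\<in>F. (cmod (c i))\<^sup>2) \<le> L\<^sup>2 * (norm s)\<^sup>2" by (simp add: power_mult_distrib)
      then show ?thesis
        unfolding ell2_gram_form[OF F(1)] s_def[symmetric] using L(1) by (simp add: pos_divide_le_eq mult.commute)
    qed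
    then show "\<exists>m>0. gram_lower (\<lambda>i j. cip (a i) (a j)) A m"
      using m L(1) unfolding gram_lower_def by (intro exI[of _ "m / L\<^sup>2"]) simp
  qed
  show ?thesis by (rule riesz_partitionable_from_realization[OF H f _ part]) (rule af)
qed

lemma statement_i_if_statement_iii:
  fixes H :: "'a inner_space"
  assumes iii: "\<And>H (z :: nat \<Rightarrow> complex). contractively_contained H \<Longrightarrow> range z \<subseteq> \<bbbD> \<Longrightarrow>
        (\<forall>i. kernel_at H (z i) \<noteq> \<zero>\<^bsub>H\<^esub>) \<Longrightarrow>
        bounded_bessel_sequence H UNIV (\<lambda>i. normalized H (kernel_at H (z i))) \<Longrightarrow>
        riesz_partitionable H UNIV (\<lambda>i. normalized H (kernel_at H (z i)))"
    and H: "hilbert_space H" and f: "bounded_bessel_sequence H (J :: nat set) f"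
  shows "riesz_partitionable H J f"
proof -
  obtain a B \<delta> where a: "ell2_bessel B a" "B > 0" "\<delta> > 0" "\<And>i. \<delta> \<le> norm (a i)"
    and af: "\<And>i j. i \<in> J \<Longrightarrow> j \<in> J \<Longrightarrow> cip (a i) (a j) = cinner H (f i) (f j)"
    by (rule bounded_below_realization[OF H subset_UNIV f]) (rule that; (assumption | blast | simp))
  have an: "norm (a i) > 0" for i using a(3) a(4)[of i] by linarith
  obtain W K z where W: "bounded_clinear W" "K > 0" "\<And>x. norm x \<le> K * norm (W x)"
    and z: "\<And>i :: nat. z i \<in> \<bbbD>" "\<And>i. adj W (nkern (z i)) = a i"
    using kernel_realization[OF a(1) less_imp_le[OF a(2)]] by blast
  obtain C where C: "C > 0" "\<And>x. norm (W x) \<le> C * norm x" using bounded_clinear_bound[OF W(1)] by blast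
  define g where "g x = hardy_of (W x)" for x
  have g: "inj g"
  proof (rule injI)
    fix x y assume "g x = g y"
    then have "W (x - y) = 0" using injD[OF inj_hardy_of] by (simp add: g_def bounded_clinear_diff[OF W(1)])
    then show "x = y" using W(3)[of "x - y"] by simp
  qed
  define L :: "(complex \<Rightarrow> complex) inner_space" where
    "L = \<lparr>carrier = range g, mult = undefined, one = undefined,
      zero = (\<lambda>z. 0), add = (\<lambda>f g z. f z + g z), smult = (\<lambda>c f z. c * f z),
      cinner = (\<lambda>x y. complex_of_real (C\<^sup>2) * cip (inv_into UNIV g x) (inv_into UNIV g y))\<rparr>"
  \<comment> \<open>The norm of \<open>g x\<close> in \<open>L\<close> is \<open>C * norm x\<close>,
    which dominates \<open>norm (W x)\<close>, its norm in the Hardy space; this is the contractive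
    containment.\<close>
  interpret C: ell2_copy L g "C\<^sup>2"
  proof
    show "\<zero>\<^bsub>L\<^esub> = g 0" by (simp add: L_def g_def bounded_clinear_zero[OF W(1)] hardy_of_def fun_eq_iff)
    show "g x \<oplus>\<^bsub>L\<^esub> g y = g (x + y)" for x y
      by (simp add: L_def g_def bounded_clinear_add[OF W(1)] hardy_of_add fun_eq_iff)
    show "c \<odot>\<^bsub>L\<^esub> g x = g (csc c x)" for c x
      by (simp add: L_def g_def bounded_clinear_csc[OF W(1)] hardy_of_csc fun_eq_iff)
  qed (use g C(1) in \<open>simp_all add: L_def inv_f_f\<close>)
  interpret L: hilbert_space L by (rule C.hilbert_space)
  have "contractively_contained L"
    unfolding contractively_contained_def
  proof (intro conjI ballI allI)
    show "hilbert_space L" by (rule C.hilbert_space)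
    show "carrier L \<subseteq> carrier H\<^sup>2" by (auto simp: C.carrier_eq carrier_hardy_space g_def)
    fix h assume "h \<in> carrier L"
    then obtain x where x: "h = g x" unfolding C.carrier_eq by blast
    have "hnorm H\<^sup>2 h = norm (W x)" by (simp add: x g_def Hardy.hnorm_g)
    also have "\<dots> \<le> hnorm L h" using C by (simp add: x C.hnorm_g)
    finally show "hnorm H\<^sup>2 h \<le> hnorm L h" .
  qed (simp_all add: L_def hardy_space_sel)
  \<comment> \<open>The value of \<open>g x\<close> at \<open>z i\<close> is
    \<open>norm (kern (z i)) * cip x (a i)\<close>; the factor \<open>C\<^sup>2\<close> in the inner
    product of \<open>L\<close> has to be divided out.\<close>
  define t where "t i = norm (kern (z i)) / C\<^sup>2" for i
  have t: "t i > 0" for i using norm_kern(2)[OF z(1)] C(1) by (simp add: t_def)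
  have eval: "h (z i) = cinner L h (g (t i *\<^sub>R a i))" if h: "h \<in> carrier L" for h i
  proof -
    obtain x where x: "h = g x" using h unfolding C.carrier_eq by blast
    have "h (z i) = cip (W x) (kern (z i))" using z(1)[of i] by (simp add: x g_def hardy_of_def)
    also have "\<dots> = cip (W x) (norm (kern (z i)) *\<^sub>R nkern (z i))" using kern_eq_nkern[OF z(1)] by simp
    also have "\<dots> = complex_of_real (norm (kern (z i))) * cip x (a i)"
      by (simp add: cip_scaleR cip_adj[OF W(1)] z(2))
    also have "\<dots> = cinner L h (g (t i *\<^sub>R a i))"
      using C(1) by (simp add: x C.g_cinner cip_scaleR t_def)
    finally show ?thesis .
  qed
  have ker: "kernel_at L (z i) = g (t i *\<^sub>R a i)" for i
    unfolding kernel_at_def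
  proof (rule the_equality)
    show "g (t i *\<^sub>R a i) \<in> carrier L \<and> (\<forall>h\<in>carrier L. h (z i) = cinner L h (g (t i *\<^sub>R a i)))"
      using eval by (auto simp: C.carrier_eq)
    fix k assume k: "k \<in> carrier L \<and> (\<forall>h\<in>carrier L. h (z i) = cinner L h k)"
    then obtain y where y: "k = g y" unfolding C.carrier_eq by blast
    have "cip x y = cip x (t i *\<^sub>R a i)" for x
    proof -
      have "g x \<in> carrier L" by (simp add: C.carrier_eq)
      then have "cinner L (g x) (g y) = cinner L (g x) (g (t i *\<^sub>R a i))"
        using k eval[of "g x" i] unfolding y by metis
      then show ?thesis using C(1) by (simp add: C.g_cinner)
    qed
    then have "y = t i *\<^sub>R a i" by (rule ell2_eqI_cip)
    then show "k = g (t i *\<^sub>R a i)" by (simp add: y)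
  qed
  have kne: "kernel_at L (z i) \<noteq> \<zero>\<^bsub>L\<^esub>" for i
    unfolding ker C.g_zero using injD[OF g, of "t i *\<^sub>R a i" 0] t[of i] an[of i] by auto
  \<comment> \<open>In \<open>L\<close> the vector \<open>g (a i)\<close> has norm
    \<open>C * norm (a i)\<close>, so this factor normalizes it; the positive \<open>t i\<close>
    cancels.\<close>
  define v where "v i = 1 / (C * norm (a i))" for i
  have v: "v i > 0" for i using C(1) an by (simp add: v_def)
  have nk: "normalized L (kernel_at L (z i)) = g (v i *\<^sub>R a i)" for i
  proof -
    have "1 / (C * (t i * norm (a i))) * t i = v i" using t[of i] by (simp add: v_def)
    then show ?thesis
      unfolding normalized_def ker C.hnorm_g C.g_smult csc_of_real
      using t[of i] C(1) by simp
  qed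
  \<comment> \<open>Normalization keeps the Bessel property because the norms of the
    \<open>a i\<close> are at least \<open>\<delta>\<close>.\<close>
  have "ell2_bessel ((1 / (C * \<delta>))\<^sup>2 * B) (\<lambda>i. v i *\<^sub>R a i)"
    unfolding ell2_bessel_def
  proof (intro allI)
    fix x N
    have "(\<Sum>n<N. (cmod (cip x (v n *\<^sub>R a n)))\<^sup>2) \<le> (\<Sum>n<N. (1 / (C * \<delta>))\<^sup>2 * (cmod (cip x (a n)))\<^sup>2)"
    proof (rule sum_mono)
      fix n
      have "v n \<le> 1 / (C * \<delta>)" unfolding v_def using C(1) a(3) a(4)[of n] by (intro divide_left_mono mult_left_mono mult_pos_pos an) auto
      then have "(v n)\<^sup>2 \<le> (1 / (C * \<delta>))\<^sup>2" using v[of n] by (intro power_mono) auto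
      then show "(cmod (cip x (v n *\<^sub>R a n)))\<^sup>2 \<le> (1 / (C * \<delta>))\<^sup>2 * (cmod (cip x (a n)))\<^sup>2"
        unfolding cip_scaleR norm_mult power_mult_distrib norm_of_real power2_abs by (rule mult_right_mono) simp
    qed
    also have "\<dots> \<le> (1 / (C * \<delta>))\<^sup>2 * (B * (norm x)\<^sup>2)"
      using a(1) unfolding sum_distrib_left[symmetric] ell2_bessel_def by (intro mult_left_mono) auto
    finally show "(\<Sum>n<N. (cmod (cip x (v n *\<^sub>R a n)))\<^sup>2) \<le> (1 / (C * \<delta>))\<^sup>2 * B * (norm x)\<^sup>2"
      by (simp add: mult.assoc)
  qed
  then have bes: "bessel_sequence L UNIV (\<lambda>i. g (v i *\<^sub>R a i))"
    by (rule C.bessel_sequence_g) (use a(2,3) C(1) in simp)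
  have "hnorm L (g (v i *\<^sub>R a i)) = 1" for i
    using C(1) an[of i] by (simp add: C.hnorm_g v_def)
  then have "bounded_bessel_sequence L UNIV (\<lambda>i. g (v i *\<^sub>R a i))"
    unfolding bounded_bessel_sequence_def using bes by (auto intro!: exI[of _ 1])
  then have "riesz_partitionable L UNIV (\<lambda>i. g (v i *\<^sub>R a i))"
    using iii[OF \<open>contractively_contained L\<close>, of z] z(1) kne unfolding nk by blast
  then have "gram_partitionable (\<lambda>i j. complex_of_real (C\<^sup>2) * cip (v i *\<^sub>R a i) (v j *\<^sub>R a j)) UNIV"
    unfolding L.riesz_partitionable_iff_gram[OF bes] C.g_cinner .
  then have part: "gram_partitionable (\<lambda>i j. cip (a i) (a j)) UNIV"
  proof (rule gram_partitionable_mono)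
    fix A m assume m: "m > 0"
      and low: "gram_lower (\<lambda>i j. complex_of_real (C\<^sup>2) * cip (v i *\<^sub>R a i) (v j *\<^sub>R a j)) A m"
    have "m * \<delta>\<^sup>2 * (\<Sum>i\<in>F. (cmod (c i))\<^sup>2) \<le> gram_form (\<lambda>i j. cip (a i) (a j)) c F"
      if F: "finite F" "F \<subseteq> A" for F c
    proof -
      \<comment> \<open>These coefficients undo the normalization: the factors
        \<open>C\<^sup>2\<close>, \<open>v i\<close> and \<open>v j\<close> cancel against the
        norms. Passing from \<open>d\<close> back to \<open>c\<close> costs the factor
        \<open>\<delta>\<^sup>2\<close>.\<close>
      define d where "d i = c i * complex_of_real (norm (a i))" for i
      have "m * (\<delta>\<^sup>2 * (\<Sum>i\<in>F. (cmod (c i))\<^sup>2)) \<le> m * (\<Sum>i\<in>F. (cmod (d i))\<^sup>2)"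
        unfolding sum_distrib_left[of "\<delta>\<^sup>2"]
      proof (intro mult_left_mono sum_mono)
        fix i
        have "\<delta>\<^sup>2 \<le> (norm (a i))\<^sup>2" using a(3,4) by (intro power_mono) auto
        moreover have "(cmod (d i))\<^sup>2 = (norm (a i))\<^sup>2 * (cmod (c i))\<^sup>2"
          by (simp add: d_def norm_mult power_mult_distrib)
        ultimately show "\<delta>\<^sup>2 * (cmod (c i))\<^sup>2 \<le> (cmod (d i))\<^sup>2"
          by (simp only: mult_right_mono zero_le_power2)
      qed (use m in simp)
      also have "\<dots> \<le> gram_form (\<lambda>i j. complex_of_real (C\<^sup>2) * cip (v i *\<^sub>R a i) (v j *\<^sub>R a j)) d F"
        using low F unfolding gram_lower_def by blast
      also have "\<dots> = gram_form (\<lambda>i j. cip (a i) (a j)) c F"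
      proof -
        have "d i * cnj (d j) * (complex_of_real (C\<^sup>2) * cip (v i *\<^sub>R a i) (v j *\<^sub>R a j)) = c i * cnj (c j) * cip (a i) (a j)" for i j
          using an[of i] an[of j] C(1)
          by (simp add: d_def cip_scaleR v_def power2_eq_square field_simps)
        then show ?thesis by (simp add: gram_form_def)
      qed
      finally show ?thesis by (simp add: mult.assoc)
    qed
    then show "\<exists>m>0. gram_lower (\<lambda>i j. cip (a i) (a j)) A m"
      using m a(3) unfolding gram_lower_def by (intro exI[of _ "m * \<delta>\<^sup>2"]) simp
  qed
  show ?thesis by (rule riesz_partitionable_from_realization[OF H f _ part]) (rule af)
qed

theorem theorem1p2:
  assumes universe_large: "(UNIV :: (nat \<Rightarrow> complex) set) \<lesssim> (UNIV :: 'a set)"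
  defines "statement_i \<equiv>
      (\<forall>(H :: 'a inner_space) (J :: nat set) f.
        hilbert_space H \<longrightarrow> bounded_bessel_sequence H J f \<longrightarrow> riesz_partitionable H J f)"
    and "statement_ii \<equiv>
      (\<forall>P (z :: nat \<Rightarrow> complex).
        positive_operator H\<^sup>2 P \<longrightarrow> range z \<subseteq> \<bbbD> \<longrightarrow>
        bounded_bessel_sequence H\<^sup>2 UNIV (\<lambda>i. P (normalized H\<^sup>2 (szego_kernel (z i)))) \<longrightarrow>
        riesz_partitionable H\<^sup>2 UNIV (\<lambda>i. P (normalized H\<^sup>2 (szego_kernel (z i)))))"
    and "statement_iii \<equiv>
      (\<forall>H (z :: nat \<Rightarrow> complex).
        contractively_contained H \<longrightarrow> range z \<subseteq> \<bbbD> \<longrightarrow>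
        (\<forall>i. kernel_at H (z i) \<noteq> \<zero>\<^bsub>H\<^esub>) \<longrightarrow>
        bounded_bessel_sequence H UNIV (\<lambda>i. normalized H (kernel_at H (z i))) \<longrightarrow>
        riesz_partitionable H UNIV (\<lambda>i. normalized H (kernel_at H (z i))))"
  shows "(statement_i \<longleftrightarrow> statement_ii) \<and> (statement_ii \<longleftrightarrow> statement_iii)"
proof -
  \<comment> \<open>Statements (ii) and (iii) concern spaces of complex functions, while (i) ranges
    over spaces on \<open>'a\<close>; \<open>universe_large\<close> leaves room there for a copy of
    the sequence space.\<close>
  have transfer: "riesz_partitionable H UNIV f"
    if "statement_i" "hilbert_space H" "bounded_bessel_sequence H UNIV f"
    for H :: "(complex \<Rightarrow> complex) inner_space" and f :: "nat \<Rightarrow> complex \<Rightarrow> complex"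
    using statement_i_transfer[OF universe_large _ that(2,3)] that(1) unfolding statement_i_def by blast
  have "statement_i \<Longrightarrow> statement_ii"
    unfolding statement_ii_def using transfer Hardy.hilbert_space by blast
  moreover have "statement_i \<Longrightarrow> statement_iii"
    unfolding statement_iii_def contractively_contained_def using transfer by blast
  moreover have "statement_ii \<Longrightarrow> statement_i"
    unfolding statement_i_def statement_ii_def using statement_i_if_statement_ii by blast
  moreover have "statement_iii \<Longrightarrow> statement_i"
    unfolding statement_i_def statement_iii_def using statement_i_if_statement_iii by blast
  ultimately show ?thesis by blast
qed

end
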